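(* Let $d\ge1$ and $h\in(0,1)$. There exists a constant $C=C(d,h)>0$ such that, for all $\varepsilon\in(0,1)$ with $\varepsilon^{-1}\in\mathbb N$, all $t>0$, all $g=(g^i)_{i=1,\dots,d}\in(\mathcal C([0,\infty)\times\mathbb T^d))^d$ and all $u_0\in\mathcal C(\mathbb T^d)$, if the averaging process $(u_s^\varepsilon)_{s\ge0}$ is started from $u_0^\varepsilon=u_0|_{\mathbb T_\varepsilon^d}$ and $$\varGamma_t^\varepsilon(g)=\sum_{i=1}^d\int_0^t\varepsilon^d\sum_{x\in\mathbb T_\varepsilon^d}\big(\nabla^{\varepsilon,i}u_s^\varepsilon(x)\big)^2g_s^i(x)\,\mathrm ds,$$ then $$\varepsilon^{-(d+2)}\int_0^\infty\varepsilon^d\sum_{x\in\mathbb T_\varepsilon^d}\sum_{i=1}^d\mathbb E\big[\big(D_{(s,x,i)}\varGamma_t^\varepsilon(g)\big)^2\big]\,\mathrm ds\le C\,\|g\|_\infty^2\,\|u_0\|_\infty^4\,(\varepsilon^{d/2})^{(1-h)\frac d{d+2}}.$$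
   Context: Torus and process. $\mathbb T^d=(\mathbb R/\mathbb Z)^d$; $\mathbb T_\varepsilon^d=(\varepsilon\mathbb Z/\mathbb Z)^d\subset\mathbb T^d$ is the lattice discretization with mesh $\varepsilon$; $e_1,\dots,e_d$ is the canonical basis. Let $N^\varepsilon=(N_t^{\varepsilon,i}(x))_{t\ge0,x\in\mathbb T_\varepsilon^d,i=1,\dots,d}$ be i.i.d. Poisson processes of intensity $\varepsilon^{-2}$, with expectation $\mathbb E$. The averaging process $(u_t^\varepsilon)_{t\ge0}\subset\mathbb R^{\mathbb T_\varepsilon^d}$ started from a deterministic $u_0^\varepsilon$ is the càdlàg process which, at each arrival time $t$ of $N^{\varepsilon,i}(x)$, replaces both $u_{t^-}^\varepsilon(x)$ and $u_{t^-}^\varepsilon(x+\varepsilon e_i)$ with $\tfrac12(u_{t^-}^\varepsilon(x)+u_{t^-}^\varepsilon(x+\varepsilon e_i))$, leaves the other values unchanged, and is constant between arrivals. Discrete gradients: $\nabla^{\varepsilon,i}h(x)=\varepsilon^{-1}(h(x+\varepsilon e_i)-h(x))$; $g_s^i(x)=g^i(s,x)$. Difference operator. View $N^\varepsilon$ as a Poisson point process on $[0,\infty)\times\mathbb T_\varepsilon^d\times\{1,\dots,d\}$ with intensity $\varepsilon^{-2}\mathrm dt\otimes$ (counting measures). For a functional $F=F(N^\varepsilon)$, $D_{(s,x,i)}F(N^\varepsilon)=F(N^\varepsilon+\delta_{(s,x,i)})-F(N^\varepsilon)$, i.e. the change in $F$ produced by adding one extra averaging update at time $s$ between $x$ and $x+\varepsilon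 e_i$. Norms. $\|g\|_\infty=\max_i\sup_{t\ge0}\sup_{x\in\mathbb T^d}|g^i(t,x)|$, $\|u_0\|_\infty=\sup_{x\in\mathbb T^d}|u_0(x)|$. *)

theory Defs
  imports "HOL-Probability.Probability"
begin

(* Functions on the torus (R/Z)^d, d = CARD('d), are Z^d-periodic functions on real^'d. *)

definition periodic :: "(real^'d \<Rightarrow> real) \<Rightarrow> bool" where
  "periodic f \<longleftrightarrow> (\<forall>x j. f (x + axis j 1) = f x)"

definition torus_continuous :: "(real^'d \<Rightarrow> real) \<Rightarrow> bool" where
  "torus_continuous f \<longleftrightarrow> periodic f \<and> continuous_on UNIV f"

definition time_torus_continuous :: "(real \<Rightarrow> real^'d \<Rightarrow> real) \<Rightarrow> bool" where
  "time_torus_continuous f \<longleftrightarrow>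
     (\<forall>s\<ge>0. periodic (f s)) \<and> continuous_on ({0..} \<times> UNIV) (\<lambda>(s, x). f s x)"

(* The sup norms are extended nonnegative: a continuous g on [0,oo) x T^d may be unbounded.
   In that case the norm is oo, and oo * 0 = 0 in ennreal. *)

definition torus_norm :: "(real^'d \<Rightarrow> real) \<Rightarrow> ennreal" where
  "torus_norm f = (SUP x. ennreal \<bar>f x\<bar>)"

definition time_torus_norm :: "('d \<Rightarrow> real \<Rightarrow> real^'d \<Rightarrow> real) \<Rightarrow> ennreal" where
  "time_torus_norm g = (MAX i. SUP s\<in>{0..}. SUP x. ennreal \<bar>g i s x\<bar>)"

(* The discrete torus is represented in the fundamental domain [0,1)^d;
   torus_shift \<epsilon> i x is x + \<epsilon> e_i modulo 1. *)

definition torus_lattice :: "real \<Rightarrow> (real^'d) set" where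
  "torus_lattice \<epsilon> = {x. \<forall>j. 0 \<le> x $ j \<and> x $ j < 1 \<and> (\<exists>k::int. x $ j = \<epsilon> * of_int k)}"

definition torus_shift :: "real \<Rightarrow> 'd \<Rightarrow> real^'d \<Rightarrow> real^'d" where
  "torus_shift \<epsilon> i x = (\<chi> j. if j = i then frac (x $ j + \<epsilon>) else x $ j)"

definition discrete_grad :: "real \<Rightarrow> 'd \<Rightarrow> (real^'d \<Rightarrow> real) \<Rightarrow> real^'d \<Rightarrow> real" where
  "discrete_grad \<epsilon> i f x = (f (torus_shift \<epsilon> i x) - f x) / \<epsilon>"

definition poisson_process :: "'w measure \<Rightarrow> real \<Rightarrow> (real \<Rightarrow> 'w \<Rightarrow> nat) \<Rightarrow> bool" where
  "poisson_process M rate N \<longleftrightarrow>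
     (\<forall>t\<ge>0. N t \<in> measurable M (count_space UNIV)) \<and>
     (AE \<omega> in M. N 0 \<omega> = 0) \<and>
     (AE \<omega> in M. mono_on {0..} (\<lambda>t. N t \<omega>) \<and>
        (\<forall>t\<ge>0. continuous (at_right t) (\<lambda>s. real (N s \<omega>)))) \<and>
     (\<forall>s t. 0 \<le> s \<longrightarrow> s < t \<longrightarrow>
        distr M (count_space UNIV) (\<lambda>\<omega>. N t \<omega> - N s \<omega>)
          = measure_pmf (poisson_pmf (rate * (t - s)))) \<and>
     (\<forall>n \<tau>. 0 \<le> \<tau> 0 \<longrightarrow> strict_mono_on {..n} \<tau> \<longrightarrow>
        prob_space.indep_vars M (\<lambda>_. count_space UNIV)
          (\<lambda>k \<omega>. N (\<tau> (Suc k)) \<omega> - N (\<tau> k) \<omega>) {..<n})"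

(* A realization of all the clocks is the set of its points (s, x, i): at time s the clock
   attached to the site x and the direction i rings.
   Adding a unit mass at p is inserting p: Poisson points are almost surely simple. *)

type_synonym 'd config = "(real \<times> (real^'d) \<times> 'd) set"

definition arrival_count :: "real^'d \<Rightarrow> 'd \<Rightarrow> real \<Rightarrow> 'd config \<Rightarrow> nat" where
  "arrival_count x i t \<eta> = card {s. 0 \<le> s \<and> s \<le> t \<and> (s, x, i) \<in> \<eta>}"

definition locally_finite_config :: "real \<Rightarrow> 'd::finite config \<Rightarrow> bool" where
  "locally_finite_config \<epsilon> \<eta> \<longleftrightarrow>
     \<eta> \<subseteq> {0..} \<times> torus_lattice \<epsilon> \<times> UNIV \<and> (\<forall>t. finite {p \<in> \<eta>. fst p \<le> t})"

(* P is a law on configurations under which the counting processes N^i(x) are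
   i.i.d. Poisson processes of intensity \<epsilon>^(-2). *)

definition poisson_clocks :: "real \<Rightarrow> 'd::finite config measure \<Rightarrow> bool" where
  "poisson_clocks \<epsilon> P \<longleftrightarrow>
     prob_space P \<and>
     (AE \<eta> in P. locally_finite_config \<epsilon> \<eta>) \<and>
     (\<forall>x\<in>torus_lattice \<epsilon>. \<forall>i. poisson_process P (1 / \<epsilon>\<^sup>2) (arrival_count x i)) \<and>
     prob_space.indep_vars P (\<lambda>_. \<Pi>\<^sub>M t\<in>{0..}. count_space UNIV)
       (\<lambda>(x, i) \<eta>. \<lambda>t\<in>{0..}. arrival_count x i t \<eta>) (torus_lattice \<epsilon> \<times> UNIV)"

definition average_pair :: "real \<Rightarrow> (real^'d) \<times> 'd \<Rightarrow> (real^'d \<Rightarrow> real) \<Rightarrow> real^'d \<Rightarrow> real" where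
  "average_pair \<epsilon> = (\<lambda>(x, i) u y.
     if y = x \<or> y = torus_shift \<epsilon> i x then (u x + u (torus_shift \<epsilon> i x)) / 2 else u y)"

(* The updates of \<eta> up to time t, applied in increasing order of time. The choice of the update
   at a given time is arbitrary only if two clocks ring at once, which has probability zero. *)

definition averaging :: "real \<Rightarrow> (real^'d \<Rightarrow> real) \<Rightarrow> 'd config \<Rightarrow> real \<Rightarrow> real^'d \<Rightarrow> real" where
  "averaging \<epsilon> u0 \<eta> t =
     fold (\<lambda>s. average_pair \<epsilon> (SOME p. (s, p) \<in> \<eta>))
       (sorted_list_of_set {s \<in> fst ` \<eta>. s \<le> t}) u0"

lemma averaging_constant:
  assumes "s \<le> t" and "\<And>r p. (r, p) \<in> \<eta> \<Longrightarrow> \<not> (s < r \<and> r \<le> t)"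
  shows "averaging \<epsilon> u0 \<eta> t = averaging \<epsilon> u0 \<eta> s"
proof -
  have "{r \<in> fst ` \<eta>. r \<le> t} = {r \<in> fst ` \<eta>. r \<le> s}"
  proof (intro Collect_cong conj_cong refl)
    fix r assume "r \<in> fst ` \<eta>"
    then obtain p where "(r, p) \<in> \<eta>" by auto
    with assms show "r \<le> t \<longleftrightarrow> r \<le> s" by (smt (verit))
  qed
  then show ?thesis by (simp add: averaging_def)
qed

lemma averaging_update:
  assumes lf: "locally_finite_config \<epsilon> \<eta>"
    and t: "(t, x, i) \<in> \<eta>" "\<And>p. (t, p) \<in> \<eta> \<Longrightarrow> p = (x, i)"
    and s: "s < t" "\<And>r p. (r, p) \<in> \<eta> \<Longrightarrow> \<not> (s < r \<and> r < t)"
  shows "averaging \<epsilon> u0 \<eta> t = average_pair \<epsilon> (x, i) (averaging \<epsilon> u0 \<eta> s)"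
proof -
  let ?A = "{r \<in> fst ` \<eta>. r \<le> s}"
  have "?A = fst ` {p \<in> \<eta>. fst p \<le> s}" by auto
  then have fin: "finite ?A" using lf by (simp add: locally_finite_config_def)
  have "{r \<in> fst ` \<eta>. r \<le> t} = insert t ?A"
  proof (intro set_eqI iffI)
    fix r assume r: "r \<in> {r \<in> fst ` \<eta>. r \<le> t}"
    then obtain p where "(r, p) \<in> \<eta>" by auto
    then have "\<not> (s < r \<and> r < t)" by (rule s(2))
    with r have "r \<le> s \<or> r = t" by auto
    with r show "r \<in> insert t ?A" by blast
  next
    fix r assume "r \<in> insert t ?A"
    moreover have "t \<in> fst ` \<eta>" using image_eqI[OF _ t(1), of t fst] by simp
    ultimately show "r \<in> {r \<in> fst ` \<eta>. r \<le> t}" using s(1) by auto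
  qed
  moreover have "sorted_list_of_set (insert t ?A) = sorted_list_of_set ?A @ [t]"
  proof -
    let ?L = "sorted_list_of_set ?A @ [t]"
    have "sorted_wrt (<) ?L"
      using fin s(1) by (auto simp: sorted_wrt_append)
    then have "sorted ?L \<and> distinct ?L"
      by (simp only: strict_sorted_iff)
    then have "sorted_list_of_set (set ?L) = ?L"
      by (intro sorted_list_of_set.idem_if_sorted_distinct) blast+
    moreover have "set ?L = insert t ?A"
      using fin by auto
    ultimately show ?thesis by (simp only:)
  qed
  moreover have "(SOME p. (t, p) \<in> \<eta>) = (x, i)"
    by (rule some_equality) (fact t)+
  ultimately show ?thesis by (simp add: averaging_def)
qed

definition carre_du_champ ::
  "real \<Rightarrow> (real^'d \<Rightarrow> real) \<Rightarrow> ('d::finite \<Rightarrow> real \<Rightarrow> real^'d \<Rightarrow> real) \<Rightarrow> real \<Rightarrow> 'd config \<Rightarrow> real"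
  where
  "carre_du_champ \<epsilon> u0 g t \<eta> =
     (\<Sum>i\<in>UNIV. LINT s:{0..t}|lborel. \<epsilon> ^ CARD('d) *
        (\<Sum>x\<in>torus_lattice \<epsilon>.
           (discrete_grad \<epsilon> i (averaging \<epsilon> (restrict u0 (torus_lattice \<epsilon>)) \<eta> s) x)\<^sup>2 * g i s x))"

definition add_one_cost :: "'p \<Rightarrow> ('p set \<Rightarrow> real) \<Rightarrow> 'p set \<Rightarrow> real" where
  "add_one_cost p F \<eta> = F (insert p \<eta>) - F \<eta>"

end

theory Submission
  imports Defs
begin

text \<open>
  Inserting an update at time \<open>s\<close> on a bond \<open>p\<close> perturbs the process by a dipole \<open>\<delta>\<close> of strength
  \<open>a\<close>, the gradient of \<open>u\<close> across \<open>p\<close>. Afterwards \<open>\<delta>\<close> and the sum \<open>w\<close> of the perturbed and the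
  unperturbed process evolve by the same random linear averagings, and the change of the functional
  is at most a multiple of the time integral of \<open>\<Sum> \<bar>\<nabla>\<delta>\<bar> \<bar>\<nabla>w\<bar>\<close>. For the first \<open>k\<close> units of lattice time this is
  bounded deterministically, since averaging contracts the \<open>l1\<close> norm of \<open>\<delta>\<close> and the sup norm of \<open>w\<close>.
  The remaining part is bounded by the two energies, whose second moments are controlled by the
  squared \<open>l2\<close> norms at the starting time; by Nash's inequality at scale \<open>R\<close> the \<open>l2\<close> norm
  of \<open>\<delta>\<close> has dropped to order \<open>R powr (- d / 2)\<close> by then. Summing \<open>a\<^sup>2\<close> over all bonds and times gives the
  dissipated energy of \<open>u\<close>, and optimising over \<open>k\<close> and \<open>R\<close> yields the power of \<open>\<epsilon>\<close>.

  The expectations are computed on a time grid with \<open>m\<close> slots, each of which typically contains at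
  most one arrival; the exceptional event has probability \<open>O(1/m)\<close> and disappears as \<open>m \<rightarrow> \<infinity>\<close>.
\<close>

section \<open>Discrete calculus on the lattice torus\<close>

text \<open>The functional is quadratic, so its change is bilinear in the difference and the sum of
  the two processes. These are driven by the same updates and are not independent; the product of
  their gradients is therefore split along each path, by Young's inequality, before any expectation
  is taken. Only the product of the two resulting bounds matters, so a small energy of the late
  difference compensates an energy of the sum of order \<open>card V\<close>. Since the change is
  squared, second moments of accumulated energies are required, hence a decay estimate for the
  square of the \<open>l2\<close> norm. Nash's inequality is kept at a fixed scale because it is
  then linear in the energy: the recursion for the expected squared \<open>l2\<close> norm becomes
  affine and can be iterated directly. Replacing continuous time by words of independent letters
  turns conditioning on the past into concatenation of words and every expectation into a finite
  sum.\<close>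

locale torus_mesh =
  fixes \<epsilon> :: real and n :: nat and V :: "(real^'d::finite) set"
  assumes eps_n: "\<epsilon> * real n = 1" and n2: "2 \<le> n" and V_def: "V = torus_lattice \<epsilon>"
begin

text \<open>Displacements are counted in mesh steps by natural numbers, so that a path can be
  shortened by induction on its length and the displacements in a box can be counted.\<close>

definition translate :: "('d \<Rightarrow> nat) \<Rightarrow> real^'d \<Rightarrow> real^'d" where
  "translate y x = (\<chi> j. frac (x $ j + \<epsilon> * real (y j)))"

text \<open>Labels of clocks rather than pairs of sites: for \<open>n = 2\<close> two labels of the
  same direction join the same two sites and still carry separate clocks.\<close>

definition bonds :: "((real^'d) \<times> 'd) set" where
  "bonds = V \<times> UNIV"

text \<open>The difference is not divided by \<epsilon>. The factor
  \<open>1 / \<epsilon>\<^sup>2\<close> is restored in \<open>weighted_energy_eq\<close>, which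
  keeps the estimates on the chain in lattice units.\<close>

definition bond_grad :: "(real^'d) \<times> 'd \<Rightarrow> (real^'d \<Rightarrow> real) \<Rightarrow> real" where
  "bond_grad p v = v (torus_shift \<epsilon> (snd p) (fst p)) - v (fst p)"

definition energy :: "(real^'d \<Rightarrow> real) \<Rightarrow> real" where
  "energy v = (\<Sum>p\<in>bonds. (bond_grad p v)\<^sup>2)"

text \<open>With \<open>v\<close> the difference and \<open>w\<close> the sum of two configurations,
  this controls the change of the energy even when the bonds are weighted with arbitrary
  signs.\<close>

definition cross_energy :: "(real^'d \<Rightarrow> real) \<Rightarrow> (real^'d \<Rightarrow> real) \<Rightarrow> real" where
  "cross_energy v w = (\<Sum>p\<in>bonds. \<bar>bond_grad p v\<bar> * \<bar>bond_grad p w\<bar>)"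

definition l1 :: "(real^'d \<Rightarrow> real) \<Rightarrow> real" where
  "l1 v = (\<Sum>x\<in>V. \<bar>v x\<bar>)"

definition l2 :: "(real^'d \<Rightarrow> real) \<Rightarrow> real" where
  "l2 v = (\<Sum>x\<in>V. (v x)\<^sup>2)"

section \<open>Geometry of the lattice and its translations\<close>

lemma n_pos: "0 < real n"
  using n2 by simp

lemma eps_eq: "\<epsilon> = 1 / real n"
  using eps_n n_pos by (simp add: field_simps)

lemma eps_pos: "0 < \<epsilon>"
  using n_pos by (simp add: eps_eq)

lemma eps_less_1: "\<epsilon> < 1"
  using n2 by (simp add: eps_eq)

lemma lattice_iff: "x \<in> V \<longleftrightarrow> (\<forall>j. \<exists>k<n. x $ j = \<epsilon> * real k)"
proof
  assume x: "x \<in> V"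
  show "\<forall>j. \<exists>k<n. x $ j = \<epsilon> * real k"
  proof
    fix j
    obtain k :: int where k: "x $ j = \<epsilon> * of_int k" and b: "0 \<le> x $ j" "x $ j < 1"
      using x unfolding V_def torus_lattice_def by blast
    have "0 \<le> real_of_int k" using b k eps_pos by (simp add: zero_le_mult_iff)
    moreover have "\<epsilon> * real_of_int k < \<epsilon> * real n" using b k eps_n by simp
    then have "real_of_int k < real n" using eps_pos by simp
    ultimately show "\<exists>k<n. x $ j = \<epsilon> * real k"
      using k by (intro exI[of _ "nat k"]) auto
  qed
next
  assume x: "\<forall>j. \<exists>k<n. x $ j = \<epsilon> * real k"
  show "x \<in> V"
    unfolding V_def torus_lattice_def
  proof safe
    fix j
    obtain k where k: "k < n" "x $ j = \<epsilon> * real k" using x by blast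
    then show "0 \<le> x $ j" "\<exists>k::int. x $ j = \<epsilon> * of_int k"
      using eps_pos by (auto intro: exI[of _ "int k"])
    have "\<epsilon> * real k < \<epsilon> * real n" using k eps_pos by simp
    then show "x $ j < 1" using k eps_n by simp
  qed
qed

lemma lattice_bounds: "x \<in> V \<Longrightarrow> 0 \<le> x $ j \<and> x $ j < 1"
  by (simp add: V_def torus_lattice_def)

lemma card_box: "card {y :: 'd \<Rightarrow> nat. \<forall>j. y j < m} = m ^ CARD('d)"
  and finite_box: "finite {y :: 'd \<Rightarrow> nat. \<forall>j. y j < m}"
proof -
  have eq: "{y :: 'd \<Rightarrow> nat. \<forall>j. y j < m} = PiE UNIV (\<lambda>_. {..<m})"
    by (auto simp: PiE_def)
  show "card {y :: 'd \<Rightarrow> nat. \<forall>j. y j < m} = m ^ CARD('d)"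
    unfolding eq by (simp add: card_PiE)
  show "finite {y :: 'd \<Rightarrow> nat. \<forall>j. y j < m}"
    unfolding eq by (simp add: finite_PiE)
qed

lemma lattice_image: "V = (\<lambda>y. \<chi> j. \<epsilon> * real (y j)) ` {y :: 'd \<Rightarrow> nat. \<forall>j. y j < n}"
proof (intro set_eqI iffI)
  fix x assume "x \<in> V"
  then obtain y where y: "\<forall>j. y j < n \<and> x $ j = \<epsilon> * real (y j)"
    unfolding lattice_iff by metis
  then have "x = (\<chi> j. \<epsilon> * real (y j))" by (simp add: vec_eq_iff)
  with y show "x \<in> (\<lambda>y. \<chi> j. \<epsilon> * real (y j)) ` {y. \<forall>j. y j < n}" by blast
next
  fix x assume "x \<in> (\<lambda>y. \<chi> j. \<epsilon> * real (y j)) ` {y :: 'd \<Rightarrow> nat. \<forall>j. y j < n}"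
  then show "x \<in> V" unfolding lattice_iff by auto
qed

lemma finite_lattice [simp]: "finite V"
  unfolding lattice_image by (intro finite_imageI finite_box)

lemma card_lattice_le: "card V \<le> n ^ CARD('d)"
  unfolding lattice_image card_box[symmetric] by (intro card_image_le finite_box)

lemma zero_in_lattice: "0 \<in> V"
  unfolding lattice_iff using n2 by (auto intro!: exI[of _ 0])

lemma card_lattice_pos: "0 < card V"
  using zero_in_lattice by (auto simp: card_gt_0_iff)

lemma finite_bonds [simp]: "finite bonds"
  by (simp add: bonds_def)

lemma translate_in_lattice:
  assumes "x \<in> V" shows "translate y x \<in> V"
  unfolding V_def torus_lattice_def
proof safe
  fix j
  obtain k where k: "x $ j = \<epsilon> * real k" using assms unfolding lattice_iff by blast
  show "0 \<le> translate y x $ j" "translate y x $ j < 1"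
    by (simp_all add: translate_def frac_lt_1)
  show "\<exists>k::int. translate y x $ j = \<epsilon> * of_int k"
  proof
    let ?f = "\<lfloor>x $ j + \<epsilon> * real (y j)\<rfloor>"
    have "real_of_int ?f = \<epsilon> * real n * real_of_int ?f" by (simp add: eps_n)
    then show "translate y x $ j = \<epsilon> * of_int (int k + int (y j) - int n * ?f)"
      by (simp add: translate_def frac_def k algebra_simps)
  qed
qed

lemma frac_eq_imp_eq:
  fixes a b c :: real
  assumes "frac (a + c) = frac (b + c)" "0 \<le> a" "a < 1" "0 \<le> b" "b < 1"
  shows "a = b"
proof -
  have "a - b = real_of_int (\<lfloor>a + c\<rfloor> - \<lfloor>b + c\<rfloor>)" using assms(1) by (simp add: frac_def)
  moreover have "\<bar>a - b\<bar> < 1" using assms by linarith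
  ultimately have "\<bar>real_of_int (\<lfloor>a + c\<rfloor> - \<lfloor>b + c\<rfloor>)\<bar> < 1" by simp
  then have "\<lfloor>a + c\<rfloor> - \<lfloor>b + c\<rfloor> = 0" by linarith
  then show ?thesis using \<open>a - b = _\<close> by simp
qed

lemma inj_translate: "inj_on (translate y) V"
proof (rule inj_onI)
  fix x x' assume V: "x \<in> V" "x' \<in> V" and eq: "translate y x = translate y x'"
  have "x $ j = x' $ j" for j
  proof (rule frac_eq_imp_eq)
    show "frac (x $ j + \<epsilon> * real (y j)) = frac (x' $ j + \<epsilon> * real (y j))"
      using arg_cong[OF eq, of "\<lambda>z. z $ j"] by (simp add: translate_def)
  qed (use V lattice_bounds in auto)
  then show "x = x'" by (simp add: vec_eq_iff)
qed

lemma bij_translate: "bij_betw (translate y) V V"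
proof -
  have "translate y ` V = V"
    using translate_in_lattice inj_translate by (intro endo_inj_surj) auto
  then show ?thesis using inj_translate by (simp add: bij_betw_def)
qed

lemma shift_eq_translate:
  assumes "x \<in> V"
  shows "torus_shift \<epsilon> i x = translate (\<lambda>j. if j = i then 1 else 0) x"
proof -
  have "frac (x $ j) = x $ j" for j
    using lattice_bounds[OF assms, of j] by (simp add: frac_eq)
  then show ?thesis by (simp add: torus_shift_def translate_def vec_eq_iff)
qed

lemma shift_in_lattice: "x \<in> V \<Longrightarrow> torus_shift \<epsilon> i x \<in> V"
  by (simp add: shift_eq_translate translate_in_lattice)

text \<open>A fixed site would make \<epsilon> an integer strictly between 0 and 1. Every bond thus
  has two different endpoints, on which the computations for a single update rely.\<close>

lemma shift_neq:
  assumes "x \<in> V" shows "torus_shift \<epsilon> i x \<noteq> x"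
proof
  assume "torus_shift \<epsilon> i x = x"
  then have "torus_shift \<epsilon> i x $ i = x $ i" by simp
  then have "frac (x $ i + \<epsilon>) = x $ i" by (simp add: torus_shift_def)
  then have "\<epsilon> = real_of_int \<lfloor>x $ i + \<epsilon>\<rfloor>" by (simp add: frac_def)
  with eps_pos eps_less_1 have "0 < real_of_int \<lfloor>x $ i + \<epsilon>\<rfloor>" "real_of_int \<lfloor>x $ i + \<epsilon>\<rfloor> < 1"
    by metis+
  then show False by (simp only: of_int_0_less_iff of_int_less_1_iff)
qed

lemma bij_shift: "bij_betw (torus_shift \<epsilon> i) V V"
  using bij_translate[of "\<lambda>j. if j = i then 1 else 0"]
  by (rule bij_betw_cong[THEN iffD1, rotated]) (simp add: shift_eq_translate)

lemma sum_translate: "(\<Sum>x\<in>V. f (translate y x)) = (\<Sum>x\<in>V. f x)"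
  by (rule sum.reindex_bij_betw[OF bij_translate])

lemma sum_shift: "(\<Sum>x\<in>V. f (torus_shift \<epsilon> i x)) = (\<Sum>x\<in>V. f x)"
  by (rule sum.reindex_bij_betw[OF bij_shift])

lemma sum_bonds: "(\<Sum>p\<in>bonds. f p) = (\<Sum>i\<in>UNIV. \<Sum>x\<in>V. f (x, i))"
  unfolding bonds_def by (subst sum.swap) (simp add: sum.cartesian_product case_prod_beta)

section \<open>Energies bounded by norms\<close>

lemma l1_nonneg [simp]: "0 \<le> l1 v" and l2_nonneg [simp]: "0 \<le> l2 v"
  and energy_nonneg [simp]: "0 \<le> energy v" and cross_energy_nonneg [simp]: "0 \<le> cross_energy v w"
  by (simp_all add: l1_def l2_def energy_def cross_energy_def sum_nonneg)

lemma energy_le: "energy v \<le> 4 * real CARD('d) * l2 v"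
proof -
  have "energy v \<le> (\<Sum>p\<in>bonds. 2 * (v (torus_shift \<epsilon> (snd p) (fst p)))\<^sup>2 + 2 * (v (fst p))\<^sup>2)"
    unfolding energy_def
  proof (rule sum_mono)
    fix p
    show "(bond_grad p v)\<^sup>2 \<le> 2 * (v (torus_shift \<epsilon> (snd p) (fst p)))\<^sup>2 + 2 * (v (fst p))\<^sup>2"
      unfolding bond_grad_def
      using zero_le_power2[of "v (torus_shift \<epsilon> (snd p) (fst p)) + v (fst p)"]
      by (simp add: power2_sum power2_diff)
  qed
  also have "\<dots> = 4 * real CARD('d) * l2 v"
    unfolding sum_bonds l2_def
    by (simp add: sum.distrib sum_distrib_left[symmetric] sum_shift[of "\<lambda>x. (v x)\<^sup>2"])
  finally show ?thesis .
qed

lemma sum_abs_grad_le: "(\<Sum>p\<in>bonds. \<bar>bond_grad p v\<bar>) \<le> 2 * real CARD('d) * l1 v"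
proof -
  have "(\<Sum>p\<in>bonds. \<bar>bond_grad p v\<bar>)
      \<le> (\<Sum>p\<in>bonds. \<bar>v (torus_shift \<epsilon> (snd p) (fst p))\<bar> + \<bar>v (fst p)\<bar>)"
    unfolding bond_grad_def by (intro sum_mono) linarith
  also have "\<dots> = 2 * real CARD('d) * l1 v"
    unfolding sum_bonds l1_def
    by (simp add: sum.distrib sum_distrib_left[symmetric] sum_shift[of "\<lambda>x. \<bar>v x\<bar>"])
  finally show ?thesis .
qed

text \<open>A sup bound times an \<open>l1\<close> norm, because both are preserved by every update
  along each path; this is what makes the early part of the estimate deterministic.\<close>

lemma cross_energy_le:
  assumes "\<And>x. x \<in> V \<Longrightarrow> \<bar>w x\<bar> \<le> W"
  shows "cross_energy v w \<le> 4 * real CARD('d) * W * l1 v"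
proof -
  have "cross_energy v w \<le> (\<Sum>p\<in>bonds. \<bar>bond_grad p v\<bar> * (2 * W))"
    unfolding cross_energy_def
  proof (intro sum_mono mult_left_mono)
    fix p assume "p \<in> bonds"
    then have "fst p \<in> V" "torus_shift \<epsilon> (snd p) (fst p) \<in> V"
      by (auto simp: bonds_def shift_in_lattice)
    from assms[OF this(1)] assms[OF this(2)] show "\<bar>bond_grad p w\<bar> \<le> 2 * W"
      unfolding bond_grad_def by linarith
  qed simp
  also have "\<dots> = 2 * W * (\<Sum>p\<in>bonds. \<bar>bond_grad p v\<bar>)"
    by (simp add: sum_distrib_left mult.commute)
  also have "\<dots> \<le> 2 * W * (2 * real CARD('d) * l1 v)"
  proof (rule mult_left_mono[OF sum_abs_grad_le])
    have "\<bar>w 0\<bar> \<le> W" by (rule assms[OF zero_in_lattice])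
    then show "0 \<le> 2 * W" by linarith
  qed
  finally show ?thesis by (simp add: ac_simps)
qed

text \<open>Young's inequality with a free weight: the energies of a dipole and of a bulk
  configuration differ by a power of the number of sites, and \<open>c\<close> will balance
  them.\<close>

lemma cross_energy_le_weighted:
  assumes "0 < c"
  shows "cross_energy v w \<le> (c * energy w + energy v / c) / 2"
proof -
  have "cross_energy v w \<le> (\<Sum>p\<in>bonds. (c * (bond_grad p w)\<^sup>2 + (bond_grad p v)\<^sup>2 / c) / 2)"
    unfolding cross_energy_def
  proof (rule sum_mono)
    fix p
    let ?a = "\<bar>bond_grad p v\<bar>" and ?b = "\<bar>bond_grad p w\<bar>"
    have "0 \<le> (?a - c * ?b)\<^sup>2 / c" using assms by simp
    also have "\<dots> = ?a\<^sup>2 / c + c * ?b\<^sup>2 - 2 * (?a * ?b)"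
      using assms by (simp add: power2_eq_square field_simps)
    finally show "?a * ?b \<le> (c * (bond_grad p w)\<^sup>2 + (bond_grad p v)\<^sup>2 / c) / 2" by simp
  qed
  also have "\<dots> = (c * energy w + energy v / c) / 2"
    by (simp add: energy_def sum.distrib sum_distrib_left sum_divide_distrib add_divide_distrib)
  finally show ?thesis .
qed

end

section \<open>Nash's inequality and single updates\<close>

lemma frac_frac_add: "frac (frac a + b) = frac (a + b)" for a b :: real
proof -
  have "frac a + b = (a + b) - of_int \<lfloor>a\<rfloor>" by (simp add: frac_def)
  then show ?thesis by (simp only: frac_def floor_diff_of_int of_int_diff)
qed

context torus_mesh
begin

lemma translate_0: "x \<in> V \<Longrightarrow> translate (\<lambda>_. 0) x = x"
  using lattice_bounds by (simp add: translate_def vec_eq_iff frac_eq)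

lemma translate_shift:
  assumes x: "x \<in> V" and y: "0 < y i"
  shows "translate (y(i := y i - 1)) (torus_shift \<epsilon> i x) = translate y x"
proof -
  have "x $ i + \<epsilon> + \<epsilon> * real (y i - 1) = x $ i + \<epsilon> * real (y i)"
    using y by (simp add: of_nat_diff algebra_simps)
  then have "frac (frac (x $ i + \<epsilon>) + \<epsilon> * real (y i - 1)) = frac (x $ i + \<epsilon> * real (y i))"
    by (simp only: frac_frac_add)
  then show ?thesis
    by (simp add: translate_def torus_shift_def vec_eq_iff)
qed

lemma L2_shift_diff_le: "L2_set (\<lambda>x. v (torus_shift \<epsilon> i x) - v x) V \<le> sqrt (energy v)"
proof -
  have "(\<Sum>x\<in>V. (v (torus_shift \<epsilon> i x) - v x)\<^sup>2) \<le> (\<Sum>j\<in>UNIV. \<Sum>x\<in>V. (v (torus_shift \<epsilon> j x) - v x)\<^sup>2)"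
    by (rule member_le_sum) (auto intro: sum_nonneg)
  then show ?thesis unfolding L2_set_def energy_def sum_bonds bond_grad_def by simp
qed

text \<open>Walk from \<open>x\<close> to its translate one mesh step at a time. Sums over
  \<open>V\<close> are invariant under shifts, so by the triangle inequality each step costs at most
  the square root of the energy.\<close>

lemma L2_translate_diff_le:
  "L2_set (\<lambda>x. v (translate y x) - v x) V \<le> real (\<Sum>j\<in>UNIV. y j) * sqrt (energy v)"
proof (induction "\<Sum>j\<in>UNIV. y j" arbitrary: y)
  case 0
  then have y: "y = (\<lambda>_. 0)" by auto
  show ?case unfolding y by (simp add: L2_set_def translate_0)
next
  case (Suc m)
  then obtain i where i: "0 < y i" by (metis gr0I nat.distinct(1) sum.neutral)
  define z where "z = y(i := y i - 1)"
  have "(\<Sum>j\<in>UNIV. y j) = y i + (\<Sum>j\<in>UNIV - {i}. y j)"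
    "(\<Sum>j\<in>UNIV. z j) = z i + (\<Sum>j\<in>UNIV - {i}. z j)"
    by (simp_all add: sum.remove)
  moreover have "(\<Sum>j\<in>UNIV - {i}. z j) = (\<Sum>j\<in>UNIV - {i}. y j)"
    by (rule sum.cong) (auto simp: z_def)
  ultimately have z: "m = (\<Sum>j\<in>UNIV. z j)" using Suc(2) i by (simp add: z_def)
  have "L2_set (\<lambda>x. v (translate y x) - v x) V
      = L2_set (\<lambda>x. (v (translate z (torus_shift \<epsilon> i x)) - v (torus_shift \<epsilon> i x))
          + (v (torus_shift \<epsilon> i x) - v x)) V"
    by (rule L2_set_cong) (simp_all add: z_def translate_shift[where y = y and i = i, OF _ i] del: One_nat_def)
  also have "\<dots> \<le> L2_set (\<lambda>x. v (translate z (torus_shift \<epsilon> i x)) - v (torus_shift \<epsilon> i x)) V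
      + L2_set (\<lambda>x. v (torus_shift \<epsilon> i x) - v x) V"
    by (rule L2_set_triangle_ineq)
  also have "L2_set (\<lambda>x. v (translate z (torus_shift \<epsilon> i x)) - v (torus_shift \<epsilon> i x)) V
      = L2_set (\<lambda>x. v (translate z x) - v x) V"
    unfolding L2_set_def using sum_shift[of "\<lambda>x. (v (translate z x) - v x)\<^sup>2" i] by simp
  also have "\<dots> \<le> real m * sqrt (energy v)" using Suc(1)[OF z] z by simp
  also have "L2_set (\<lambda>x. v (torus_shift \<epsilon> i x) - v x) V \<le> sqrt (energy v)"
    by (rule L2_shift_diff_le)
  finally show ?case unfolding Suc(2)[symmetric] by (simp add: algebra_simps)
qed

text \<open>\<open>R \<le> n\<close> prevents the box from wrapping around the torus, so it visits
  each site at most once.\<close>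

lemma sum_box_translate_le:
  assumes x: "x \<in> V" and R: "R \<le> n"
  shows "(\<Sum>y | \<forall>j. y j < R. \<bar>v (translate y x)\<bar>) \<le> l1 v"
proof -
  let ?Y = "{y :: 'd \<Rightarrow> nat. \<forall>j. y j < R}"
  have inj: "inj_on (\<lambda>y. translate y x) ?Y"
  proof (rule inj_onI)
    fix y z assume Y: "y \<in> ?Y" "z \<in> ?Y" and eq: "translate y x = translate z x"
    have "y j = z j" for j
    proof -
      have bnd: "0 \<le> \<epsilon> * real (u j) \<and> \<epsilon> * real (u j) < 1" if "u \<in> ?Y" for u
      proof -
        have "real (u j) < real n" using that R by (auto intro: less_le_trans)
        then have "\<epsilon> * real (u j) < \<epsilon> * real n" using eps_pos by simp
        then show ?thesis using eps_pos eps_n by simp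
      qed
      have "frac (\<epsilon> * real (y j) + x $ j) = frac (\<epsilon> * real (z j) + x $ j)"
        using arg_cong[OF eq, of "\<lambda>z. z $ j"] by (simp add: translate_def add.commute)
      then have "\<epsilon> * real (y j) = \<epsilon> * real (z j)"
        by (rule frac_eq_imp_eq) (use bnd Y in blast)+
      then show ?thesis using eps_pos by simp
    qed
    then show "y = z" by auto
  qed
  have "(\<Sum>y\<in>?Y. \<bar>v (translate y x)\<bar>) = (\<Sum>z\<in>(\<lambda>y. translate y x) ` ?Y. \<bar>v z\<bar>)"
    by (simp add: sum.reindex[OF inj])
  also have "\<dots> \<le> l1 v"
    unfolding l1_def using x translate_in_lattice by (intro sum_mono2) auto
  finally show ?thesis .
qed

text \<open>Nash's inequality with the scale \<open>R\<close> left free: compare \<open>v\<close> with its average over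
  translations by a box of side \<open>R\<close>.\<close>

lemma nash_inequality:
  assumes R: "1 \<le> R" "R \<le> n"
  shows "l2 v \<le> 2 * (real CARD('d) * real R)\<^sup>2 * energy v + 2 * (l1 v)\<^sup>2 / real R ^ CARD('d)"
proof -
  let ?Y = "{y :: 'd \<Rightarrow> nat. \<forall>j. y j < R}"
  define m where "m = real (card ?Y)"
  have m: "m = real R ^ CARD('d)" by (simp add: m_def card_box)
  have m_pos: "0 < m" using R by (simp add: m)
  define avg where "avg x = (\<Sum>y\<in>?Y. v (translate y x)) / m" for x
  \<comment> \<open>Jensen's inequality: the square of an average is at most the average of the
    squares.\<close>
  have diff: "(v x - avg x)\<^sup>2 \<le> (\<Sum>y\<in>?Y. (v (translate y x) - v x)\<^sup>2) / m" for x
  proof -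
    have "v x - avg x = - ((\<Sum>y\<in>?Y. v (translate y x) - v x) / m)"
      using m_pos by (simp add: avg_def sum_subtractf m_def[symmetric] field_simps)
    then have "(v x - avg x)\<^sup>2 = (\<Sum>y\<in>?Y. v (translate y x) - v x)\<^sup>2 / m\<^sup>2"
      by (simp add: power_divide)
    also have "\<dots> \<le> ((\<Sum>y\<in>?Y. (v (translate y x) - v x)\<^sup>2) * m) / m\<^sup>2"
      unfolding m_def by (intro divide_right_mono sum_squared_le_sum_of_squares) simp
    finally show ?thesis using m_pos by (simp add: power2_eq_square)
  qed
  have tr: "(\<Sum>x\<in>V. (v (translate y x) - v x)\<^sup>2) \<le> (real CARD('d) * real R)\<^sup>2 * energy v"
    if y: "y \<in> ?Y" for y
  proof -
    have "(\<Sum>j\<in>UNIV. real (y j)) \<le> (\<Sum>j\<in>(UNIV::'d set). real R)"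
      using y by (intro sum_mono) (auto intro: less_imp_le)
    then have le: "real (\<Sum>j\<in>UNIV. y j) \<le> real CARD('d) * real R"
      by simp
    have "L2_set (\<lambda>x. v (translate y x) - v x) V \<le> real CARD('d) * real R * sqrt (energy v)"
      by (rule order_trans[OF L2_translate_diff_le mult_right_mono[OF le]]) simp
    then have "(L2_set (\<lambda>x. v (translate y x) - v x) V)\<^sup>2 \<le> (real CARD('d) * real R * sqrt (energy v))\<^sup>2"
      by (rule power_mono) simp
    then show ?thesis by (simp add: L2_set_def sum_nonneg power_mult_distrib)
  qed
  have 1: "(\<Sum>x\<in>V. (v x - avg x)\<^sup>2) \<le> (real CARD('d) * real R)\<^sup>2 * energy v"
  proof -
    have "(\<Sum>x\<in>V. (v x - avg x)\<^sup>2) \<le> (\<Sum>x\<in>V. (\<Sum>y\<in>?Y. (v (translate y x) - v x)\<^sup>2) / m)"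
      by (intro sum_mono diff)
    also have "\<dots> = (\<Sum>y\<in>?Y. \<Sum>x\<in>V. (v (translate y x) - v x)\<^sup>2) / m"
      by (subst sum.swap) (simp add: sum_divide_distrib)
    also have "\<dots> \<le> (\<Sum>y\<in>?Y. (real CARD('d) * real R)\<^sup>2 * energy v) / m"
      using m_pos by (intro divide_right_mono sum_mono tr) auto
    also have "\<dots> = (real CARD('d) * real R)\<^sup>2 * energy v"
      using m_pos by (simp add: m_def[symmetric])
    finally show ?thesis .
  qed
  have abs_avg: "\<bar>avg x\<bar> \<le> (\<Sum>y\<in>?Y. \<bar>v (translate y x)\<bar>) / m" for x
    unfolding avg_def using m_pos by (simp add: abs_divide divide_right_mono sum_abs)
  \<comment> \<open>One factor \<open>avg x\<close> is bounded by \<open>l1 v / m\<close>, since the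
    box visits distinct sites; the other is summed over \<open>x\<close>, where translation
    invariance gives \<open>l1 v\<close>.\<close>
  have 2: "(\<Sum>x\<in>V. (avg x)\<^sup>2) \<le> (l1 v)\<^sup>2 / m"
  proof -
    have "(\<Sum>x\<in>V. (avg x)\<^sup>2) \<le> (\<Sum>x\<in>V. l1 v / m * \<bar>avg x\<bar>)"
    proof (rule sum_mono)
      fix x assume "x \<in> V"
      then have "\<bar>avg x\<bar> \<le> l1 v / m"
        using abs_avg[of x] sum_box_translate_le[of x R v] R m_pos
        by (meson divide_right_mono less_imp_le order_trans)
      then have "\<bar>avg x\<bar> * \<bar>avg x\<bar> \<le> l1 v / m * \<bar>avg x\<bar>" by (rule mult_right_mono) simp
      then show "(avg x)\<^sup>2 \<le> l1 v / m * \<bar>avg x\<bar>" by (simp add: power2_eq_square)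
    qed
    also have "\<dots> = l1 v / m * (\<Sum>x\<in>V. \<bar>avg x\<bar>)" by (simp add: sum_distrib_left)
    also have "\<dots> \<le> l1 v / m * (\<Sum>x\<in>V. (\<Sum>y\<in>?Y. \<bar>v (translate y x)\<bar>) / m)"
      using m_pos by (intro mult_left_mono sum_mono abs_avg) simp
    also have "(\<Sum>x\<in>V. (\<Sum>y\<in>?Y. \<bar>v (translate y x)\<bar>) / m) = (\<Sum>y\<in>?Y. \<Sum>x\<in>V. \<bar>v (translate y x)\<bar>) / m"
      by (subst sum.swap) (simp add: sum_divide_distrib)
    also have "\<dots> = l1 v"
      using m_pos by (simp add: sum_translate[of "\<lambda>x. \<bar>v x\<bar>"] l1_def[symmetric] m_def[symmetric])
    finally show ?thesis by (simp add: power2_eq_square)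
  qed
  have "l2 v \<le> (\<Sum>x\<in>V. 2 * (v x - avg x)\<^sup>2 + 2 * (avg x)\<^sup>2)"
    unfolding l2_def
  proof (rule sum_mono)
    fix x
    show "(v x)\<^sup>2 \<le> 2 * (v x - avg x)\<^sup>2 + 2 * (avg x)\<^sup>2"
      using zero_le_power2[of "v x - 2 * avg x"] by (simp add: power2_eq_square algebra_simps)
  qed
  also have "\<dots> = 2 * (\<Sum>x\<in>V. (v x - avg x)\<^sup>2) + 2 * (\<Sum>x\<in>V. (avg x)\<^sup>2)"
    by (simp add: sum.distrib sum_distrib_left)
  also have "\<dots> \<le> 2 * ((real CARD('d) * real R)\<^sup>2 * energy v) + 2 * ((l1 v)\<^sup>2 / m)"
    using 1 2 by linarith
  finally show ?thesis by (simp add: m)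
qed

section \<open>A single update: linearity, dissipation and contraction\<close>

lemma average_pair_add:
  "average_pair \<epsilon> p (\<lambda>x. v x + w x) = (\<lambda>x. average_pair \<epsilon> p v x + average_pair \<epsilon> p w x)"
  by (auto simp: average_pair_def add_divide_distrib split: prod.split)

lemma average_pair_diff:
  "average_pair \<epsilon> p (\<lambda>x. v x - w x) = (\<lambda>x. average_pair \<epsilon> p v x - average_pair \<epsilon> p w x)"
  by (auto simp: average_pair_def diff_divide_distrib add_divide_distrib split: prod.split)

text \<open>Leaving \<open>f\<close> free serves two purposes: the square yields the exact
  dissipation of \<open>l2\<close>, the absolute value the contraction of \<open>l1\<close>.\<close>

lemma sum_average_pair:
  fixes f :: "real \<Rightarrow> real" and v :: "real^'d \<Rightarrow> real"
  assumes p: "p \<in> bonds"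
  defines "a \<equiv> v (fst p)" and "b \<equiv> v (torus_shift \<epsilon> (snd p) (fst p))"
  shows "(\<Sum>x\<in>V. f (average_pair \<epsilon> p v x)) = (\<Sum>x\<in>V. f (v x)) - f a - f b + 2 * f ((a + b) / 2)"
proof -
  let ?x = "fst p" and ?y = "torus_shift \<epsilon> (snd p) (fst p)"
  have V: "?x \<in> V" "?y \<in> V" "?y \<noteq> ?x" using p by (auto simp: bonds_def shift_in_lattice shift_neq)
  have split: "(\<Sum>x\<in>V. g x) = g ?x + (g ?y + (\<Sum>x\<in>V - {?x} - {?y}. g x))" for g :: "real^'d \<Rightarrow> real"
  proof -
    have "(\<Sum>x\<in>V. g x) = g ?x + (\<Sum>x\<in>V - {?x}. g x)"
      using V by (intro sum.remove) auto
    also have "(\<Sum>x\<in>V - {?x}. g x) = g ?y + (\<Sum>x\<in>V - {?x} - {?y}. g x)"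
      using V by (intro sum.remove) auto
    finally show ?thesis .
  qed
  have "(\<Sum>x\<in>V - {?x} - {?y}. f (average_pair \<epsilon> p v x)) = (\<Sum>x\<in>V - {?x} - {?y}. f (v x))"
    by (rule sum.cong) (auto simp: average_pair_def split: prod.split)
  moreover have "average_pair \<epsilon> p v ?x = (a + b) / 2" "average_pair \<epsilon> p v ?y = (a + b) / 2"
    by (auto simp: average_pair_def a_def b_def split: prod.split)
  ultimately show ?thesis
    unfolding split[of "\<lambda>x. f (average_pair \<epsilon> p v x)"] split[of "\<lambda>x. f (v x)"]
    by (simp only: a_def b_def)
qed

text \<open>The identity a^2 + b^2 - 2 ((a + b) / 2)^2 = (a - b)^2 / 2. It makes
  \<open>energy\<close> the rate at which \<open>l2\<close> is dissipated.\<close>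

lemma l2_average_pair: "p \<in> bonds \<Longrightarrow> l2 (average_pair \<epsilon> p v) = l2 v - (bond_grad p v)\<^sup>2 / 2"
  unfolding l2_def sum_average_pair[where f = "\<lambda>x. x\<^sup>2"] bond_grad_def
  by (simp add: power2_eq_square field_simps)

lemma l1_average_pair: "p \<in> bonds \<Longrightarrow> l1 (average_pair \<epsilon> p v) \<le> l1 v"
  unfolding l1_def sum_average_pair[where f = "\<lambda>x. \<bar>x\<bar>"] by simp

lemma average_pair_bound:
  assumes p: "p \<in> bonds" and v: "\<And>x. x \<in> V \<Longrightarrow> \<bar>v x\<bar> \<le> W" and x: "x \<in> V"
  shows "\<bar>average_pair \<epsilon> p v x\<bar> \<le> W"
proof -
  have "\<bar>v (fst p)\<bar> \<le> W" "\<bar>v (torus_shift \<epsilon> (snd p) (fst p))\<bar> \<le> W"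
    using p by (auto simp: bonds_def shift_in_lattice intro!: v)
  then show ?thesis using v[OF x] by (auto simp: average_pair_def split: prod.split)
qed

text \<open>The perturbation caused by one extra update is a dipole.\<close>

lemma
  fixes v :: "real^'d \<Rightarrow> real"
  assumes p: "p \<in> bonds"
  defines "\<delta> \<equiv> (\<lambda>x. average_pair \<epsilon> p v x - v x)"
  shows l1_dipole: "l1 \<delta> = \<bar>bond_grad p v\<bar>" and l2_dipole: "l2 \<delta> = (bond_grad p v)\<^sup>2 / 2"
proof -
  let ?x = "fst p" and ?y = "torus_shift \<epsilon> (snd p) (fst p)"
  have V: "?x \<in> V" "?y \<in> V" "?y \<noteq> ?x" using p by (auto simp: bonds_def shift_in_lattice shift_neq)
  have \<delta>: "\<delta> x = (if x = ?x then bond_grad p v / 2 else if x = ?y then - bond_grad p v / 2 else 0)" for x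
    using V(3) by (auto simp: \<delta>_def average_pair_def bond_grad_def field_simps split: prod.split)
  have sum: "(\<Sum>x\<in>V. g x) = g ?x + g ?y" if "\<And>x. x \<noteq> ?x \<Longrightarrow> x \<noteq> ?y \<Longrightarrow> g x = 0" for g :: "real^'d \<Rightarrow> real"
  proof -
    have "(\<Sum>x\<in>V. g x) = (\<Sum>x\<in>{?x, ?y}. g x)"
      using V that by (intro sum.mono_neutral_right) auto
    then show ?thesis using V(3) by simp
  qed
  show "l1 \<delta> = \<bar>bond_grad p v\<bar>"
    unfolding l1_def by (subst sum) (use V(3) in \<open>auto simp: \<delta>\<close>)
  show "l2 \<delta> = (bond_grad p v)\<^sup>2 / 2"
    unfolding l2_def by (subst sum) (use V(3) in \<open>auto simp: \<delta> power_divide\<close>)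
qed

lemma l2_le_sup:
  assumes "\<And>x. x \<in> V \<Longrightarrow> \<bar>v x\<bar> \<le> W"
  shows "l2 v \<le> W\<^sup>2 * real (card V)"
proof -
  have "l2 v \<le> (\<Sum>x\<in>V. W\<^sup>2)"
    unfolding l2_def by (intro sum_mono) (metis assms abs_ge_zero power2_abs power_mono)
  then show ?thesis by (simp add: mult.commute)
qed

end

section \<open>Expectations over random updates\<close>

context torus_mesh
begin

text \<open>\<open>None\<close> stands for a grid slot to which no update is assigned.\<close>

definition update :: "((real^'d) \<times> 'd) option \<Rightarrow> (real^'d \<Rightarrow> real) \<Rightarrow> real^'d \<Rightarrow> real" where
  "update o' v = (case o' of None \<Rightarrow> v | Some p \<Rightarrow> average_pair \<epsilon> p v)"

definition updates :: "((real^'d) \<times> 'd) option set" where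
  "updates = insert None (Some ` bonds)"

definition run :: "((real^'d) \<times> 'd) option list \<Rightarrow> (real^'d \<Rightarrow> real) \<Rightarrow> real^'d \<Rightarrow> real" where
  "run w = fold update w"

lemma run_Nil [simp]: "run [] v = v"
  and run_Cons [simp]: "run (o' # w) v = run w (update o' v)"
  and run_append [simp]: "run (w1 @ w2) v = run w2 (run w1 v)"
  by (simp_all add: run_def)

lemma update_None [simp]: "update None v = v" and update_Some [simp]: "update (Some p) v = average_pair \<epsilon> p v"
  by (simp_all add: update_def)

lemma run_add: "run w (\<lambda>x. v x + u x) = (\<lambda>x. run w v x + run w u x)"
proof (induction w arbitrary: v u)
  case (Cons o' w)
  then show ?case by (cases o') (simp_all add: average_pair_add)
qed simp

lemma run_diff: "run w (\<lambda>x. v x - u x) = (\<lambda>x. run w v x - run w u x)"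
proof (induction w arbitrary: v u)
  case (Cons o' w)
  then show ?case by (cases o') (simp_all add: average_pair_diff)
qed simp

lemma update_l1: "o' \<in> updates \<Longrightarrow> l1 (update o' v) \<le> l1 v"
  by (auto simp: updates_def l1_average_pair)

lemma update_l2: "o' \<in> updates \<Longrightarrow> l2 (update o' v) \<le> l2 v"
  by (auto simp: updates_def l2_average_pair)

lemma run_l1: "set w \<subseteq> updates \<Longrightarrow> l1 (run w v) \<le> l1 v"
  by (induction w arbitrary: v) (auto intro: order_trans[OF _ update_l1])

lemma run_bound:
  assumes "set w \<subseteq> updates" "\<And>x. x \<in> V \<Longrightarrow> \<bar>v x\<bar> \<le> W" "x \<in> V"
  shows "\<bar>run w v x\<bar> \<le> W"
  using assms
proof (induction w arbitrary: v)
  case (Cons o' w)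
  have "\<bar>update o' v y\<bar> \<le> W" if "y \<in> V" for y
    using Cons.prems that by (cases o') (auto simp: updates_def intro!: average_pair_bound simp del: split_paired_All)
  then show ?case
    unfolding run_Cons using Cons.prems by (intro Cons.IH) auto
qed simp

end

section \<open>The chain of independent random updates\<close>

locale averaging_chain = torus_mesh \<epsilon> n V for \<epsilon> n and V :: "(real^'d::finite) set" +
  fixes q :: real
  assumes q_pos: "0 < q" and q_le: "q * real (card bonds) \<le> 1"
begin

definition expect1 :: "(((real^'d) \<times> 'd) option \<Rightarrow> real) \<Rightarrow> real" where
  "expect1 F = (1 - q * real (card bonds)) * F None + q * (\<Sum>p\<in>bonds. F (Some p))"

text \<open>Expectation over words of independent letters, with the first letter outermost:
  conditioning on the first letter is the defining equation, and the Markov property at a fixed step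
  is \<open>expect_append\<close>.\<close>

primrec expect :: "nat \<Rightarrow> (((real^'d) \<times> 'd) option list \<Rightarrow> real) \<Rightarrow> real" where
  "expect 0 F = F []"
| "expect (Suc m) F = expect1 (\<lambda>o'. expect m (\<lambda>w. F (o' # w)))"

lemma card_bonds_pos: "0 < card bonds"
  unfolding bonds_def using card_lattice_pos by simp

lemma q_le_1: "q \<le> 1"
proof -
  have "q * 1 \<le> q * real (card bonds)"
    using card_bonds_pos q_pos by (intro mult_left_mono) auto
  with q_le show ?thesis by simp
qed

lemma dim_ge_1: "1 \<le> real CARD('d)"
proof -
  have "0 < CARD('d)" by simp
  then show ?thesis by linarith
qed

lemma expect1_mono: "(\<And>o'. o' \<in> updates \<Longrightarrow> F o' \<le> G o') \<Longrightarrow> expect1 F \<le> expect1 G"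
  unfolding expect1_def using q_le q_pos
  by (intro add_mono mult_left_mono sum_mono) (auto simp: updates_def)

lemma expect1_const [simp]: "expect1 (\<lambda>_. c) = c"
  by (simp add: expect1_def algebra_simps)

lemma expect1_add: "expect1 (\<lambda>o'. F o' + G o') = expect1 F + expect1 G"
  by (simp add: expect1_def sum.distrib algebra_simps)

lemma expect1_cmult: "expect1 (\<lambda>o'. c * F o') = c * expect1 F"
  by (simp add: expect1_def sum_distrib_left[symmetric] algebra_simps)

lemma expect_mono:
  "(\<And>w. set w \<subseteq> updates \<Longrightarrow> length w = m \<Longrightarrow> F w \<le> G w) \<Longrightarrow> expect m F \<le> expect m G"
proof (induction m arbitrary: F G)
  case (Suc m)
  show ?case
    unfolding expect.simps
    by (rule expect1_mono, rule Suc.IH) (use Suc.prems in auto)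
qed simp

lemma expect_const [simp]: "expect m (\<lambda>_. c) = c"
  by (induction m) simp_all

lemma expect_add: "expect m (\<lambda>w. F w + G w) = expect m F + expect m G"
  by (induction m arbitrary: F G) (simp_all add: expect1_add)

lemma expect_cmult: "expect m (\<lambda>w. c * F w) = c * expect m F"
  by (induction m arbitrary: F) (simp_all add: expect1_cmult)

lemma expect_sum: "finite A \<Longrightarrow> expect m (\<lambda>w. \<Sum>a\<in>A. F a w) = (\<Sum>a\<in>A. expect m (F a))"
  by (induction A rule: finite_induct) (simp_all add: expect_add)

lemma expect_append: "expect (m + k) F = expect m (\<lambda>w1. expect k (\<lambda>w2. F (w1 @ w2)))"
  by (induction m arbitrary: F) simp_all

lemma expect1_l2: "expect1 (\<lambda>o'. l2 (update o' v)) = l2 v - q / 2 * energy v"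
  by (simp add: expect1_def l2_average_pair sum_subtractf energy_def sum_divide_distrib[symmetric] algebra_simps)

text \<open>An update never raises \<open>l2\<close>, so one of the two factors can be frozen at its
  old value; the other one dissipates as in \<open>expect1_l2\<close>.\<close>

lemma expect1_l2_sq: "expect1 (\<lambda>o'. (l2 (update o' v))\<^sup>2) \<le> (l2 v)\<^sup>2 - q / 2 * (l2 v * energy v)"
proof -
  have "expect1 (\<lambda>o'. (l2 (update o' v))\<^sup>2) \<le> expect1 (\<lambda>o'. l2 v * l2 (update o' v))"
    by (rule expect1_mono) (simp add: power2_eq_square mult_right_mono update_l2)
  also have "\<dots> = l2 v * (l2 v - q / 2 * energy v)"
    by (simp only: expect1_cmult expect1_l2)
  finally show ?thesis by (simp add: power2_eq_square algebra_simps)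
qed

section \<open>Moments of the accumulated energy\<close>

lemma sum_run_Suc:
  "(\<Sum>i\<le>Suc m. f (run (take i (o' # w)) v)) = f v + (\<Sum>i\<le>m. f (run (take i w) (update o' v)))"
  by (simp only: sum.atMost_Suc_shift) simp

text \<open>Each step dissipates on average \<open>q / 2\<close> times the energy, and the total
  dissipation cannot exceed the initial \<open>l2 v\<close>.\<close>

lemma expect_energy_sum_le:
  "(\<Sum>j<m. expect j (\<lambda>w. energy (run w v))) \<le> 2 / q * l2 v"
proof (induction m arbitrary: v)
  case 0
  then show ?case using q_pos by simp
next
  case (Suc m)
  have "(\<Sum>j<Suc m. expect j (\<lambda>w. energy (run w v)))
      = energy v + expect1 (\<lambda>o'. \<Sum>j<m. expect j (\<lambda>w. energy (run w (update o' v))))"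
  proof -
    have "expect1 (\<lambda>o'. \<Sum>j<m. G j o') = (\<Sum>j<m. expect1 (G j))" for G
      by (induction m) (simp_all add: expect1_add)
    then show ?thesis by (simp only: sum.lessThan_Suc_shift) simp
  qed
  also have "\<dots> \<le> energy v + expect1 (\<lambda>o'. 2 / q * l2 (update o' v))"
    using Suc.IH by (intro add_left_mono expect1_mono)
  also have "\<dots> = 2 / q * l2 v"
    using q_pos by (simp only: expect1_cmult expect1_l2) (simp add: field_simps)
  finally show ?case .
qed

text \<open>The last summand has no later step in which to dissipate, so \<open>energy_le\<close>
  has to cover it. The constant 6 d is large enough for that; in the induction step it releases 3 d
  times the energy, of which only one is spent.\<close>

lemma expect_path_energy:
  "expect m (\<lambda>w. \<Sum>i\<le>m. energy (run (take i w) v)) \<le> 6 * real CARD('d) / q * l2 v"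
proof (induction m arbitrary: v)
  case 0
  have "energy v \<le> 4 * real CARD('d) * l2 v" by (rule energy_le)
  also have "\<dots> \<le> 6 * real CARD('d) / q * l2 v"
    using q_pos q_le_1 by (intro mult_right_mono) (auto simp: field_simps mult_left_le intro: order_trans[of _ "real CARD('d) * 4"])
  finally show ?case by simp
next
  case (Suc m)
  have "expect (Suc m) (\<lambda>w. \<Sum>i\<le>Suc m. energy (run (take i w) v))
      = energy v + expect1 (\<lambda>o'. expect m (\<lambda>w. \<Sum>i\<le>m. energy (run (take i w) (update o' v))))"
    by (simp only: expect.simps sum_run_Suc[of energy] expect_add expect_const expect1_add expect1_const)
  also have "\<dots> \<le> energy v + expect1 (\<lambda>o'. 6 * real CARD('d) / q * l2 (update o' v))"
    using Suc.IH by (intro add_left_mono expect1_mono)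
  also have "\<dots> = 6 * real CARD('d) / q * l2 v - (3 * real CARD('d) - 1) * energy v"
    using q_pos by (simp only: expect1_cmult expect1_l2) (simp add: field_simps)
  also have "\<dots> \<le> 6 * real CARD('d) / q * l2 v"
    using mult_nonneg_nonneg[of "3 * real CARD('d) - 1" "energy v"] dim_ge_1 energy_nonneg[of v] by linarith
  finally show ?case .
qed

text \<open>Expand the square at the first step: the mixed term is controlled by
  \<open>expect_path_energy\<close>, the remaining square by induction. The dissipation of the
  squared \<open>l2\<close> norm releases 16 d^2 / q times \<open>l2 v * energy v\<close>, and the
  two new terms need 4 d + 12 d / q.\<close>

lemma expect_path_energy_sq:
  "expect m (\<lambda>w. (\<Sum>i\<le>m. energy (run (take i w) v))\<^sup>2) \<le> 32 * (real CARD('d))\<^sup>2 / q\<^sup>2 * (l2 v)\<^sup>2"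
proof (induction m arbitrary: v)
  case 0
  have "(energy v)\<^sup>2 \<le> (4 * real CARD('d) * l2 v)\<^sup>2" by (intro power_mono energy_le) simp
  also have "\<dots> = 16 * (real CARD('d))\<^sup>2 * 1 * (l2 v)\<^sup>2" by (simp add: power_mult_distrib)
  also have "\<dots> \<le> 16 * (real CARD('d))\<^sup>2 * (2 / q\<^sup>2) * (l2 v)\<^sup>2"
  proof (intro mult_right_mono mult_left_mono)
    have "q\<^sup>2 \<le> 1" using q_pos q_le_1 by (simp add: power_le_one)
    then show "1 \<le> 2 / q\<^sup>2" using q_pos by (simp add: field_simps)
  qed auto
  finally show ?case by simp
next
  case (Suc m)
  let ?S = "\<lambda>o' w. \<Sum>i\<le>m. energy (run (take i w) (update o' v))"
  let ?N = "l2 v" and ?G = "energy v" and ?K = "32 * (real CARD('d))\<^sup>2 / q\<^sup>2"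
  have eq: "(?G + s)\<^sup>2 = ?G\<^sup>2 + (2 * ?G * s + s\<^sup>2)" for s
    by (simp add: power2_sum)
  have "expect (Suc m) (\<lambda>w. (\<Sum>i\<le>Suc m. energy (run (take i w) v))\<^sup>2)
      = ?G\<^sup>2 + (2 * ?G * expect1 (\<lambda>o'. expect m (?S o')) + expect1 (\<lambda>o'. expect m (\<lambda>w. (?S o' w)\<^sup>2)))"
    by (simp only: expect.simps sum_run_Suc[of energy] eq expect_add expect_const expect_cmult
        expect1_add expect1_const expect1_cmult)
  also have "expect1 (\<lambda>o'. expect m (?S o')) \<le> expect1 (\<lambda>o'. 6 * real CARD('d) / q * l2 v)"
    by (intro expect1_mono order_trans[OF expect_path_energy] mult_left_mono update_l2)
      (use q_pos in auto)
  also have "\<dots> = 6 * real CARD('d) / q * ?N" by simp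
  also have "expect1 (\<lambda>o'. expect m (\<lambda>w. (?S o' w)\<^sup>2)) \<le> expect1 (\<lambda>o'. ?K * (l2 (update o' v))\<^sup>2)"
    using Suc.IH by (intro expect1_mono)
  also have "\<dots> = ?K * expect1 (\<lambda>o'. (l2 (update o' v))\<^sup>2)" by (rule expect1_cmult)
  also have "\<dots> \<le> ?K * (?N\<^sup>2 - q / 2 * (?N * ?G))"
    using q_pos by (intro mult_left_mono expect1_l2_sq) simp
  also have "?G\<^sup>2 \<le> (4 * real CARD('d) * ?N) * ?G"
    unfolding power2_eq_square by (intro mult_right_mono energy_le) simp
  also have "4 * real CARD('d) * ?N * ?G + (2 * ?G * (6 * real CARD('d) / q * ?N) + ?K * (?N\<^sup>2 - q / 2 * (?N * ?G)))
      \<le> ?K * ?N\<^sup>2"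
  proof -
    have "4 * real CARD('d) + 12 * real CARD('d) / q \<le> 16 * (real CARD('d))\<^sup>2 / q"
    proof -
      have "real CARD('d) * 1 \<le> real CARD('d) * real CARD('d)" using dim_ge_1 by (intro mult_left_mono) auto
      then have 1: "real CARD('d) \<le> (real CARD('d))\<^sup>2" by (simp add: power2_eq_square)
      have "4 * real CARD('d) * q + 12 * real CARD('d) \<le> 4 * real CARD('d) * 1 + 12 * real CARD('d)"
        using q_le_1 by (intro add_right_mono mult_left_mono) auto
      also have "\<dots> \<le> 16 * (real CARD('d))\<^sup>2" using 1 by linarith
      finally have "(4 * real CARD('d) * q + 12 * real CARD('d)) / q \<le> 16 * (real CARD('d))\<^sup>2 / q"
        using q_pos by (intro divide_right_mono) auto
      then show ?thesis using q_pos by (simp add: add_divide_distrib)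
    qed
    then have "(4 * real CARD('d) + 12 * real CARD('d) / q) * (?N * ?G) \<le> 16 * (real CARD('d))\<^sup>2 / q * (?N * ?G)"
      by (intro mult_right_mono) auto
    moreover have "4 * real CARD('d) * ?N * ?G + (2 * ?G * (6 * real CARD('d) / q * ?N) + ?K * (?N\<^sup>2 - q / 2 * (?N * ?G)))
        = (4 * real CARD('d) + 12 * real CARD('d) / q) * (?N * ?G) + (?K * ?N\<^sup>2 - 16 * (real CARD('d))\<^sup>2 / q * (?N * ?G))"
      using q_pos by (simp add: field_simps power2_eq_square)
    ultimately show ?thesis by linarith
  qed
  finally show ?case by (simp add: mult_left_mono)
qed

text \<open>Nash's inequality multiplied by \<open>l2 v\<close>, with half of the square absorbed.
  The result is linear in the squared \<open>l2\<close> norm and involves \<open>l1\<close> only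
  through its bound, so it can be inserted into a one-step expectation.\<close>

lemma l2_energy_lower_bound:
  assumes R: "1 \<le> R" "R \<le> n" and b: "l1 v \<le> b"
  shows "(l2 v)\<^sup>2 - 4 * (b\<^sup>2 / real R ^ CARD('d))\<^sup>2 \<le> 4 * (real CARD('d) * real R)\<^sup>2 * (l2 v * energy v)"
proof -
  define c where "c = b\<^sup>2 / real R ^ CARD('d)"
  have "(l1 v)\<^sup>2 \<le> b\<^sup>2" using b by (intro power_mono) auto
  then have "(l1 v)\<^sup>2 / real R ^ CARD('d) \<le> c" unfolding c_def by (intro divide_right_mono) auto
  with nash_inequality[OF R, of v] have "l2 v \<le> 2 * (real CARD('d) * real R)\<^sup>2 * energy v + 2 * c" by simp
  then have "l2 v * l2 v \<le> l2 v * (2 * (real CARD('d) * real R)\<^sup>2 * energy v + 2 * c)"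
    by (rule mult_left_mono) simp
  moreover have "4 * (l2 v * c) \<le> (l2 v)\<^sup>2 + 4 * c\<^sup>2"
    using zero_le_power2[of "l2 v - 2 * c"] by (simp add: power2_eq_square algebra_simps)
  ultimately show ?thesis unfolding c_def[symmetric] by (simp add: power2_eq_square algebra_simps)
qed

text \<open>The excess over the floor \<open>c\<close> shrinks by a fixed factor per step, and the
  floor is the same for all successors because updates do not raise \<open>l1\<close>. The rate
  \<rho> is \<open>q / 2\<close> from \<open>expect1_l2_sq\<close> divided by the factor 4 (d R)^2
  of \<open>l2_energy_lower_bound\<close>.\<close>

lemma expect_l2_sq_decay:
  assumes R: "1 \<le> R" "R \<le> n" and b: "l1 v \<le> b"
  defines "\<rho> \<equiv> q / (8 * (real CARD('d) * real R)\<^sup>2)"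
  defines "c \<equiv> 4 * (b\<^sup>2 / real R ^ CARD('d))\<^sup>2"
  shows "expect m (\<lambda>w. (l2 (run w v))\<^sup>2) - c \<le> (1 - \<rho>) ^ m * ((l2 v)\<^sup>2 - c)"
  using b
proof (induction m arbitrary: v)
  case (Suc m)
  have dR: "1 \<le> (real CARD('d) * real R)\<^sup>2"
  proof -
    have "1 * 1 \<le> real CARD('d) * real R" using dim_ge_1 R by (intro mult_mono) auto
    then show ?thesis by (simp add: one_le_power)
  qed
  have \<rho>: "0 \<le> 1 - \<rho>" using dR q_pos q_le_1 unfolding \<rho>_def by (simp add: field_simps)
  have "expect1 (\<lambda>o'. expect m (\<lambda>w. (l2 (run w (update o' v)))\<^sup>2))
      \<le> expect1 (\<lambda>o'. (1 - \<rho>) ^ m * ((l2 (update o' v))\<^sup>2 + - c) + c)"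
  proof (rule expect1_mono)
    fix o' assume "o' \<in> updates"
    then have "l1 (update o' v) \<le> b" using update_l1 Suc.prems order_trans by blast
    from Suc.IH[OF this] show "expect m (\<lambda>w. (l2 (run w (update o' v)))\<^sup>2)
        \<le> (1 - \<rho>) ^ m * ((l2 (update o' v))\<^sup>2 + - c) + c" by simp
  qed
  also have "\<dots> = (1 - \<rho>) ^ m * (expect1 (\<lambda>o'. (l2 (update o' v))\<^sup>2) + - c) + c"
    by (simp only: expect1_add expect1_const expect1_cmult)
  also have "expect1 (\<lambda>o'. (l2 (update o' v))\<^sup>2) + - c \<le> (1 - \<rho>) * ((l2 v)\<^sup>2 - c)"
  proof -
    have "\<rho> * ((l2 v)\<^sup>2 - c) \<le> \<rho> * (4 * (real CARD('d) * real R)\<^sup>2 * (l2 v * energy v))"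
      unfolding c_def using q_pos by (intro mult_left_mono l2_energy_lower_bound R Suc.prems) (simp add: \<rho>_def)
    also have "\<dots> = q / 2 * (l2 v * energy v)"
      using R unfolding \<rho>_def by (simp add: field_simps)
    finally show ?thesis using expect1_l2_sq[of v] by (simp add: algebra_simps)
  qed
  finally have "expect (Suc m) (\<lambda>w. (l2 (run w v))\<^sup>2) \<le> (1 - \<rho>) ^ m * ((1 - \<rho>) * ((l2 v)\<^sup>2 - c)) + c"
    using \<rho> by (simp add: mult_left_mono)
  moreover have "(1 - \<rho>) ^ Suc m * ((l2 v)\<^sup>2 - c) = (1 - \<rho>) ^ m * ((1 - \<rho>) * ((l2 v)\<^sup>2 - c))" by simp
  ultimately show ?case by linarith
qed simp

text \<open>The two evolutions are the difference and the sum of the perturbed and the unperturbed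
  process. During the first \<open>\<kappa>\<close> steps the uniform bound on \<open>w\<close> and the \<open>l1\<close> bound on \<open>\<delta>\<close>
  suffice; afterwards the decay of \<open>\<delta>\<close> in \<open>l2\<close> makes the remaining energy small.\<close>

lemma expect_cross_energy_sq_le:
  fixes \<kappa> :: nat
  assumes R: "1 \<le> R" "R \<le> n" and \<delta>: "l1 \<delta> \<le> a" "l2 \<delta> \<le> a\<^sup>2" and w: "\<And>x. x \<in> V \<Longrightarrow> \<bar>w x\<bar> \<le> W"
  defines "\<theta> \<equiv> 2 / real R ^ CARD('d) + exp (- real \<kappa> * q / (16 * (real CARD('d) * real R)\<^sup>2))"
  shows "expect L (\<lambda>u. (\<Sum>i\<le>L. cross_energy (run (take i u) \<delta>) (run (take i u) w))\<^sup>2)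
    \<le> 32 * (real CARD('d))\<^sup>2 * (a * W)\<^sup>2 * (real \<kappa>)\<^sup>2
      + 64 * (real CARD('d))\<^sup>2 * (a * W)\<^sup>2 * real (card V) * \<theta> / q\<^sup>2"
  (is "?lhs \<le> ?rhs1 + ?rhs2")
proof -
  let ?H = "\<lambda>u i. cross_energy (run (take i u) \<delta>) (run (take i u) w)"
  have W: "0 \<le> W" using w[OF zero_in_lattice] by linarith
  have a: "0 \<le> a" using \<delta>(1) l1_nonneg[of \<delta>] by linarith
  have \<theta>_pos: "0 < \<theta>" unfolding \<theta>_def using R by (intro add_pos_pos divide_pos_pos zero_less_power exp_gt_zero) simp_all
  have H: "?H u i \<le> 4 * real CARD('d) * W * a" if "set u \<subseteq> updates" for u i
  proof -
    have u: "set (take i u) \<subseteq> updates" by (rule order_trans[OF set_take_subset that])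
    have "?H u i \<le> 4 * real CARD('d) * W * l1 (run (take i u) \<delta>)"
      by (intro cross_energy_le run_bound[OF u] w)
    also have "\<dots> \<le> 4 * real CARD('d) * W * a"
      using W by (intro mult_left_mono order_trans[OF run_l1[OF u] \<delta>(1)]) simp
    finally show ?thesis .
  qed
  \<comment> \<open>The factor 2 comes from squaring the sum of an early and a late part.\<close>
  have rhs1: "(real \<kappa> * (4 * real CARD('d) * W * a))\<^sup>2 * 2 = ?rhs1"
    by (simp add: power_mult_distrib)
  have rhs2: "0 \<le> ?rhs2" using \<theta>_pos by simp
  \<comment> \<open>The weight \<open>c\<close> used in the third case is positive only if
    \<open>a\<close> and \<open>W\<close> are; if one of them vanishes, so does every
    summand.\<close>
  consider "a = 0 \<or> W = 0" | "L < \<kappa>" | "0 < a" "0 < W" "\<kappa> \<le> L" using a W by linarith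
  then show ?thesis
  proof cases
    case 1
    then have "?lhs \<le> expect L (\<lambda>_. 0)"
      by (intro expect_mono) (use H in \<open>auto simp: sum_nonneg_eq_0_iff intro: antisym\<close>)
    then have "?lhs \<le> 0" by simp
    moreover have "0 \<le> ?rhs1" by simp
    ultimately show ?thesis using rhs2 by linarith
  next
    case 2
    have "?lhs \<le> expect L (\<lambda>_. (real \<kappa> * (4 * real CARD('d) * W * a))\<^sup>2)"
    proof (rule expect_mono)
      fix u assume "set u \<subseteq> updates"
      then have "(\<Sum>i\<le>L. ?H u i) \<le> (\<Sum>i\<le>L. 4 * real CARD('d) * W * a)" by (intro sum_mono H)
      also have "\<dots> \<le> real \<kappa> * (4 * real CARD('d) * W * a)"
        using 2 W a by (auto simp del: of_nat_Suc intro!: mult_right_mono)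
      finally show "(\<Sum>i\<le>L. ?H u i)\<^sup>2 \<le> (real \<kappa> * (4 * real CARD('d) * W * a))\<^sup>2"
        by (intro power_mono) (auto intro: sum_nonneg)
    qed
    then have "?lhs \<le> (real \<kappa> * (4 * real CARD('d) * W * a))\<^sup>2" by simp
    also have "\<dots> \<le> ?rhs1" unfolding rhs1[symmetric] by simp
    finally show ?thesis using rhs2 by linarith
  next
    case 3
    obtain m where m: "L = \<kappa> + m" using 3(3) le_Suc_ex by blast
    \<comment> \<open>The weight that balances the two second moments: that of \<open>?X\<close> is
      at most \<open>?K\<close> times (W^2 card V)^2, that of \<open>?Y\<close> at most
      \<open>?K\<close> times (\<theta> a^2)^2. With this \<open>c\<close> both terms become
      \<open>?K\<close> times a^2 W^2 card V \<theta>.\<close>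
    define c where "c = a / W * sqrt (\<theta> / real (card V))"
    have c: "0 < c" using 3 \<theta>_pos card_lattice_pos by (simp add: c_def)
    have c2: "c\<^sup>2 = a\<^sup>2 / W\<^sup>2 * (\<theta> / real (card V))"
      using \<theta>_pos by (simp add: c_def power_mult_distrib power_divide)
    let ?X = "\<lambda>u. \<Sum>i\<le>L. energy (run (take i u) w)"
    let ?Y = "\<lambda>u. \<Sum>i\<le>m. energy (run (take (\<kappa> + i) u) \<delta>)"
    let ?K = "32 * (real CARD('d))\<^sup>2 / q\<^sup>2"
    have split: "(\<Sum>i\<le>L. f i) = (\<Sum>i<\<kappa>. f i) + (\<Sum>i\<le>m. f (\<kappa> + i))" for f :: "nat \<Rightarrow> real"
    proof -
      have "(\<Sum>i\<le>L. f i) = (\<Sum>i<\<kappa> + Suc m. f i)" unfolding m by (simp add: lessThan_Suc_atMost[symmetric])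
      also have "\<dots> = (\<Sum>i<\<kappa>. f i) + (\<Sum>i<Suc m. f (\<kappa> + i))"
      proof -
        have "(\<Sum>i<\<kappa> + k. f i) = (\<Sum>i<\<kappa>. f i) + (\<Sum>i<k. f (\<kappa> + i))" for k
          by (induction k) simp_all
        then show ?thesis .
      qed
      finally show ?thesis by (simp only: lessThan_Suc_atMost)
    qed
    have "?lhs \<le> expect L (\<lambda>u. ?rhs1 + (c\<^sup>2 * (?X u)\<^sup>2 + 1 / c\<^sup>2 * (?Y u)\<^sup>2))"
    proof (rule expect_mono)
      fix u assume u: "set u \<subseteq> updates"
      let ?A = "\<Sum>i<\<kappa>. ?H u i" and ?B = "\<Sum>i\<le>m. ?H u (\<kappa> + i)"
      have "?A \<le> (\<Sum>i<\<kappa>. 4 * real CARD('d) * W * a)" by (intro sum_mono H u)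
      then have A: "?A\<^sup>2 \<le> (real \<kappa> * (4 * real CARD('d) * W * a))\<^sup>2"
        by (intro power_mono) (auto intro: sum_nonneg)
      have "?B \<le> (\<Sum>i\<le>m. (c * energy (run (take (\<kappa> + i) u) w) + energy (run (take (\<kappa> + i) u) \<delta>) / c) / 2)"
        by (intro sum_mono cross_energy_le_weighted c)
      also have "\<dots> = (c * (\<Sum>i\<le>m. energy (run (take (\<kappa> + i) u) w)) + ?Y u / c) / 2"
        by (simp add: sum.distrib sum_distrib_left sum_divide_distrib add_divide_distrib)
      \<comment> \<open>For \<open>w\<close> nothing is gained by waiting, so its energy is counted
        from the start.\<close>
      also have "\<dots> \<le> (c * ?X u + ?Y u / c) / 2"
        unfolding split[of "\<lambda>i. energy (run (take i u) w)"]
        using c by (intro divide_right_mono add_right_mono mult_left_mono) (auto intro: sum_nonneg)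
      finally have "?B\<^sup>2 \<le> ((c * ?X u + ?Y u / c) / 2)\<^sup>2"
        by (intro power_mono) (auto intro: sum_nonneg)
      also have "\<dots> \<le> ((c * ?X u)\<^sup>2 + (?Y u / c)\<^sup>2) / 2"
      proof -
        have "((x + y) / 2)\<^sup>2 \<le> (x\<^sup>2 + y\<^sup>2) / 2" for x y :: real
          using zero_le_power2[of "x - y"] by (simp add: power2_eq_square field_simps)
        then show ?thesis .
      qed
      finally have B: "2 * ?B\<^sup>2 \<le> c\<^sup>2 * (?X u)\<^sup>2 + 1 / c\<^sup>2 * (?Y u)\<^sup>2"
        by (simp add: power_mult_distrib power_divide)
      have "(?A + ?B)\<^sup>2 \<le> 2 * ?A\<^sup>2 + 2 * ?B\<^sup>2"
        using zero_le_power2[of "?A - ?B"] by (simp only: power2_sum power2_diff)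
      then show "(\<Sum>i\<le>L. ?H u i)\<^sup>2 \<le> ?rhs1 + (c\<^sup>2 * (?X u)\<^sup>2 + 1 / c\<^sup>2 * (?Y u)\<^sup>2)"
        unfolding split[of "?H u"] rhs1[symmetric] using A B by linarith
    qed
    also have "\<dots> = ?rhs1 + (c\<^sup>2 * expect L (\<lambda>u. (?X u)\<^sup>2) + 1 / c\<^sup>2 * expect L (\<lambda>u. (?Y u)\<^sup>2))"
      by (simp only: expect_add expect_const expect_cmult)
    also have "expect L (\<lambda>u. (?X u)\<^sup>2) \<le> ?K * (W\<^sup>2 * real (card V))\<^sup>2"
      by (rule order_trans[OF expect_path_energy_sq]) (intro mult_left_mono power_mono l2_le_sup w, simp_all)
    also have "expect L (\<lambda>u. (?Y u)\<^sup>2) \<le> ?K * (\<theta> * a\<^sup>2)\<^sup>2"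
    proof -
      \<comment> \<open>Restart at step \<kappa>: given the first \<kappa> letters, the late energy
        is controlled by the \<open>l2\<close> norm reached by then.\<close>
      have "expect L (\<lambda>u. (?Y u)\<^sup>2)
          = expect \<kappa> (\<lambda>u1. expect m (\<lambda>u2. (\<Sum>i\<le>m. energy (run (take (\<kappa> + i) (u1 @ u2)) \<delta>))\<^sup>2))"
        unfolding m expect_append ..
      also have "\<dots> \<le> expect \<kappa> (\<lambda>u1. ?K * (l2 (run u1 \<delta>))\<^sup>2)"
      proof (rule expect_mono)
        fix u1 :: "((real^'d) \<times> 'd) option list" assume "length u1 = \<kappa>"
        then show "expect m (\<lambda>u2. (\<Sum>i\<le>m. energy (run (take (\<kappa> + i) (u1 @ u2)) \<delta>))\<^sup>2) \<le> ?K * (l2 (run u1 \<delta>))\<^sup>2"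
          using expect_path_energy_sq[of m "run u1 \<delta>"] by simp
      qed
      also have "\<dots> = ?K * expect \<kappa> (\<lambda>u1. (l2 (run u1 \<delta>))\<^sup>2)" by (rule expect_cmult)
      also have "expect \<kappa> (\<lambda>u1. (l2 (run u1 \<delta>))\<^sup>2) \<le> (\<theta> * a\<^sup>2)\<^sup>2"
      proof -
        let ?\<rho> = "q / (8 * (real CARD('d) * real R)\<^sup>2)"
        let ?c = "4 * (a\<^sup>2 / real R ^ CARD('d))\<^sup>2"
        let ?e = "exp (- real \<kappa> * q / (16 * (real CARD('d) * real R)\<^sup>2))"
        have "1 * 1 \<le> real CARD('d) * real R" using dim_ge_1 R by (intro mult_mono) auto
        then have dR: "1 \<le> (real CARD('d) * real R)\<^sup>2" by (simp add: one_le_power)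
        have \<rho>: "0 \<le> 1 - ?\<rho>" using dR q_pos q_le_1 R by (simp add: field_simps)
        \<comment> \<open>The exponent here is twice the one in \<theta>, since \<theta> measures
          \<open>l2\<close> and the decay concerns its square.\<close>
        have "(1 - ?\<rho>) ^ \<kappa> \<le> exp (- ?\<rho>) ^ \<kappa>"
          using \<rho> exp_ge_add_one_self[of "- ?\<rho>"] by (intro power_mono) auto
        also have "\<dots> = ?e\<^sup>2"
          by (simp add: exp_of_nat_mult[symmetric] power2_eq_square exp_add[symmetric] ac_simps)
        finally have e: "(1 - ?\<rho>) ^ \<kappa> \<le> ?e\<^sup>2" .
        have "expect \<kappa> (\<lambda>u1. (l2 (run u1 \<delta>))\<^sup>2) \<le> (1 - ?\<rho>) ^ \<kappa> * ((l2 \<delta>)\<^sup>2 - ?c) + ?c"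
          using expect_l2_sq_decay[OF R \<delta>(1), of \<kappa>] by simp
        also have "\<dots> \<le> (1 - ?\<rho>) ^ \<kappa> * (l2 \<delta>)\<^sup>2 + ?c"
          using \<rho> by (intro add_right_mono mult_left_mono) auto
        also have "\<dots> \<le> ?e\<^sup>2 * (a\<^sup>2)\<^sup>2 + ?c"
          using \<rho> \<delta>(2) by (intro add_right_mono mult_mono e power_mono) auto
        also have "\<dots> \<le> (\<theta> * a\<^sup>2)\<^sup>2"
        proof -
          have "?e\<^sup>2 + (2 / real R ^ CARD('d))\<^sup>2 \<le> \<theta>\<^sup>2"
            unfolding \<theta>_def power2_sum by simp
          then have "(?e\<^sup>2 + (2 / real R ^ CARD('d))\<^sup>2) * (a\<^sup>2)\<^sup>2 \<le> \<theta>\<^sup>2 * (a\<^sup>2)\<^sup>2"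
            by (rule mult_right_mono) simp
          then show ?thesis by (simp add: power_mult_distrib power_divide distrib_right)
        qed
        finally show ?thesis .
      qed
      finally show ?thesis by (simp add: mult_left_mono divide_right_mono)
    qed
    also have "?rhs1 + (c\<^sup>2 * (?K * (W\<^sup>2 * real (card V))\<^sup>2) + 1 / c\<^sup>2 * (?K * (\<theta> * a\<^sup>2)\<^sup>2)) = ?rhs1 + ?rhs2"
      unfolding c2 using 3 \<theta>_pos card_lattice_pos q_pos
      by (simp add: field_simps power2_eq_square)
    finally show ?thesis using c by (simp add: mult_left_mono divide_right_mono)
  qed
qed

end

section \<open>The process along a time grid\<close>

text \<open>Inside a slot the process takes only its values at the two ends, so each late slot is
  charged with both; every grid value is then counted at most twice.\<close>

lemma sum_lessThan_consecutive_le: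
  fixes h :: "nat \<Rightarrow> real"
  assumes h: "\<And>i. 0 \<le> h i" and c: "\<And>k. k < j \<Longrightarrow> c k = 0" "c j = h 0" "\<And>l. c (Suc (j + l)) = h l + h (Suc l)"
  shows "(\<Sum>k<Suc (j + L). c k) \<le> 2 * (\<Sum>i\<le>L. h i)"
proof -
  have "(\<Sum>k<Suc (j + L). c k) = h L + 2 * (\<Sum>i<L. h i)"
  proof (induction L)
    case 0
    then show ?case using c by simp
  next
    case (Suc L)
    then show ?case using c(3)[of L] by simp
  qed
  also have "\<dots> \<le> 2 * (\<Sum>i\<le>L. h i)"
    using h[of L] by (simp add: lessThan_Suc_atMost[symmetric])
  finally show ?thesis .
qed

lemma averaging_cong:
  assumes "{p \<in> \<eta>. fst p \<le> r} = {p \<in> \<eta>'. fst p \<le> r}"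
  shows "averaging \<epsilon> u \<eta> r = averaging \<epsilon> u \<eta>' r"
proof -
  have mem: "(s, p) \<in> \<eta> \<longleftrightarrow> (s, p) \<in> \<eta>'" if "s \<le> r" for s p
    using eqset_imp_iff[OF assms, of "(s, p)"] that by auto
  have times: "{s \<in> fst ` \<eta>. s \<le> r} = {s \<in> fst ` \<eta>'. s \<le> r}"
    using mem by (auto simp: image_iff)
  have "fold (\<lambda>s. average_pair \<epsilon> (SOME p. (s, p) \<in> \<eta>)) (sorted_list_of_set {s \<in> fst ` \<eta>'. s \<le> r}) u
      = fold (\<lambda>s. average_pair \<epsilon> (SOME p. (s, p) \<in> \<eta>')) (sorted_list_of_set {s \<in> fst ` \<eta>'. s \<le> r}) u"
  proof (rule fold_cong[OF refl refl])
    fix s assume "s \<in> set (sorted_list_of_set {s \<in> fst ` \<eta>'. s \<le> r})"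
    \<comment> \<open>\<open>sorted_list_of_set\<close> sends an infinite set to the empty list, so
      membership excludes that case.\<close>
    then have "s \<le> r"
      by (cases "finite {s \<in> fst ` \<eta>'. s \<le> r}") auto
    then show "average_pair \<epsilon> (SOME p. (s, p) \<in> \<eta>) = average_pair \<epsilon> (SOME p. (s, p) \<in> \<eta>')"
      by (simp add: mem)
  qed
  then show ?thesis unfolding averaging_def times .
qed

section \<open>Grid slots and the updates they carry\<close>

context torus_mesh
begin

text \<open>Slots are open on the left and closed on the right, as are the increments of the
  counting processes.\<close>

definition slot_points :: "'d config \<Rightarrow> real \<Rightarrow> real \<Rightarrow> 'd config" where
  "slot_points \<eta> a b = {z \<in> \<eta>. a < fst z \<and> fst z \<le> b}"

definition slot_count :: "'d config \<Rightarrow> real \<Rightarrow> real \<Rightarrow> (real^'d) \<times> 'd \<Rightarrow> nat" where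
  "slot_count \<eta> a b p = arrival_count (fst p) (snd p) b \<eta> - arrival_count (fst p) (snd p) a \<eta>"

text \<open>A function of the counts alone, so that its law follows from that of the clocks. Slots
  with several arrivals also yield \<open>None\<close>; they are part of the exceptional
  event.\<close>

definition update_of_counts :: "((real^'d) \<times> 'd \<Rightarrow> nat) \<Rightarrow> ((real^'d) \<times> 'd) option" where
  "update_of_counts c =
     (if \<exists>p\<in>bonds. c p = 1 \<and> (\<forall>p'\<in>bonds - {p}. c p' = 0) then Some (THE p. p \<in> bonds \<and> c p = 1) else None)"

lemma update_of_counts_Some:
  assumes "p \<in> bonds" "c p = 1" "\<And>p'. p' \<in> bonds \<Longrightarrow> p' \<noteq> p \<Longrightarrow> c p' = 0"
  shows "update_of_counts c = Some p"
proof -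
  have "(THE p. p \<in> bonds \<and> c p = 1) = p"
  proof (rule the_equality)
    show "p' = p" if "p' \<in> bonds \<and> c p' = 1" for p'
      using assms(3)[of p'] that by auto
  qed (use assms in blast)
  moreover have "\<exists>p\<in>bonds. c p = 1 \<and> (\<forall>p'\<in>bonds - {p}. c p' = 0)"
    using assms by (intro bexI[of _ p]) auto
  ultimately show ?thesis by (simp add: update_of_counts_def)
qed

lemma update_of_counts_Some_iff:
  "p \<in> bonds \<Longrightarrow> update_of_counts c = Some p \<longleftrightarrow> c p = 1 \<and> (\<forall>p'\<in>bonds - {p}. c p' = 0)"
proof
  assume p: "p \<in> bonds" and eq: "update_of_counts c = Some p"
  from eq obtain p0 where p0: "p0 \<in> bonds" "c p0 = 1" "\<forall>p'\<in>bonds - {p0}. c p' = 0"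
    by (auto simp: update_of_counts_def split: if_splits)
  then have "update_of_counts c = Some p0" by (intro update_of_counts_Some) auto
  with eq p0 show "c p = 1 \<and> (\<forall>p'\<in>bonds - {p}. c p' = 0)" by simp
qed (auto intro: update_of_counts_Some)

lemma update_of_counts_updates: "update_of_counts c \<in> updates"
proof (cases "\<exists>p\<in>bonds. c p = 1 \<and> (\<forall>p'\<in>bonds - {p}. c p' = 0)")
  case True
  then obtain p where p: "p \<in> bonds" "c p = 1" "\<forall>p'\<in>bonds - {p}. c p' = 0" by blast
  then have "update_of_counts c = Some p" by (intro update_of_counts_Some) auto
  with p show ?thesis by (simp add: updates_def)
next
  case False
  then have "update_of_counts c = None" unfolding update_of_counts_def by (rule if_not_P)
  then show ?thesis by (simp add: updates_def)
qed

lemma config_bonds: "locally_finite_config \<epsilon> \<eta> \<Longrightarrow> (s, p) \<in> \<eta> \<Longrightarrow> p \<in> bonds \<and> 0 \<le> s"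
  unfolding locally_finite_config_def bonds_def unfolding V_def by auto

lemma finite_slot_points: "locally_finite_config \<epsilon> \<eta> \<Longrightarrow> finite (slot_points \<eta> a b)"
  unfolding locally_finite_config_def slot_points_def
  by (auto intro: finite_subset[of _ "{p \<in> \<eta>. fst p \<le> b}"])

lemma slot_count_eq:
  assumes lf: "locally_finite_config \<epsilon> \<eta>" and ab: "a \<le> b" "0 \<le> a"
  shows "slot_count \<eta> a b p = card {s. (s, p) \<in> slot_points \<eta> a b}"
proof -
  obtain x i where p: "p = (x, i)" by (cases p)
  let ?T = "\<lambda>t. {s. 0 \<le> s \<and> s \<le> t \<and> (s, x, i) \<in> \<eta>}"
  have fin: "finite (?T t)" for t
  proof (rule finite_subset)
    show "?T t \<subseteq> fst ` {p \<in> \<eta>. fst p \<le> t}" by (auto simp: image_iff) (metis fst_conv)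
    show "finite (fst ` {p \<in> \<eta>. fst p \<le> t})" using lf by (simp add: locally_finite_config_def)
  qed
  have "card (?T b) - card (?T a) = card (?T b - ?T a)"
    using ab by (intro card_Diff_subset[symmetric] fin) auto
  also have "?T b - ?T a = {s. (s, p) \<in> slot_points \<eta> a b}"
    using ab by (auto simp: slot_points_def p)
  finally show ?thesis by (simp add: slot_count_def arrival_count_def p)
qed

text \<open>Probability controls counts, while the dynamics depends on points. The counts are
  cardinalities of sets of times, so a total of at most one leaves at most one point.\<close>

lemma slot_cases:
  assumes lf: "locally_finite_config \<epsilon> \<eta>" and ab: "a \<le> b" "0 \<le> a"
    and le: "(\<Sum>p\<in>bonds. slot_count \<eta> a b p) \<le> 1"
  obtains (empty) "slot_points \<eta> a b = {}" "update_of_counts (slot_count \<eta> a b) = None"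
  | (single) r p where "slot_points \<eta> a b = {(r, p)}" "update_of_counts (slot_count \<eta> a b) = Some p"
proof (cases "slot_points \<eta> a b = {}")
  case True
  then have "update_of_counts (slot_count \<eta> a b) = None"
    by (simp add: update_of_counts_def slot_count_eq[OF lf ab])
  with True show ?thesis by (rule empty)
next
  case False
  then obtain r p where rp: "(r, p) \<in> slot_points \<eta> a b" by (metis all_not_in_conv surj_pair)
  have mem: "p' \<in> bonds" if "(r', p') \<in> slot_points \<eta> a b" for r' p'
    using config_bonds[OF lf, of r' p'] that by (simp add: slot_points_def)
  have fin: "finite {s. (s, p') \<in> slot_points \<eta> a b}" for p'
  proof (rule finite_subset)
    show "{s. (s, p') \<in> slot_points \<eta> a b} \<subseteq> fst ` slot_points \<eta> a b" by (auto simp: image_iff) (metis fst_conv)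
  qed (simp add: finite_slot_points lf)
  have split: "(\<Sum>p\<in>bonds. slot_count \<eta> a b p) = slot_count \<eta> a b p + (\<Sum>p\<in>bonds - {p}. slot_count \<eta> a b p)"
    using mem[OF rp] by (intro sum.remove) auto
  have "0 < slot_count \<eta> a b p"
    unfolding slot_count_eq[OF lf ab] card_gt_0_iff using rp fin by blast
  with le split have one: "slot_count \<eta> a b p = 1" and "(\<Sum>p\<in>bonds - {p}. slot_count \<eta> a b p) = 0" by linarith+
  then have zero: "slot_count \<eta> a b p' = 0" if "p' \<in> bonds" "p' \<noteq> p" for p' using that by simp
  have "slot_points \<eta> a b \<subseteq> {(r, p)}"
  proof (rule subrelI)
    fix r' p' assume z: "(r', p') \<in> slot_points \<eta> a b"
    have "0 < slot_count \<eta> a b p'"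
      unfolding slot_count_eq[OF lf ab] card_gt_0_iff using z fin by blast
    then have p': "p' = p" using zero[OF mem[OF z]] by auto
    obtain c where "{s. (s, p) \<in> slot_points \<eta> a b} = {c}"
      using one unfolding slot_count_eq[OF lf ab] by (rule card_1_singletonE)
    then have "s = c" if "(s, p) \<in> slot_points \<eta> a b" for s using that by blast
    then have "r' = c" "r = c" using z rp unfolding p' by blast+
    then show "(r', p') \<in> {(r, p)}" using p' by simp
  qed
  then have "slot_points \<eta> a b = {(r, p)}" using rp by blast
  moreover have "update_of_counts (slot_count \<eta> a b) = Some p"
    using mem[OF rp] one zero by (rule update_of_counts_Some)
  ultimately show ?thesis by (rule single)
qed

lemma averaging_slot_empty:
  assumes "slot_points \<eta> a b = {}" "a \<le> r" "r \<le> b"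
  shows "averaging \<epsilon> u \<eta> r = averaging \<epsilon> u \<eta> a"
  using assms by (intro averaging_constant) (auto simp: slot_points_def)

lemma averaging_slot_single:
  assumes lf: "locally_finite_config \<epsilon> \<eta>" and S: "slot_points \<eta> a b = {(r0, p)}" and r: "a \<le> r" "r \<le> b"
  shows "averaging \<epsilon> u \<eta> r = (if r0 \<le> r then average_pair \<epsilon> p (averaging \<epsilon> u \<eta> a) else averaging \<epsilon> u \<eta> a)"
proof -
  have "(r0, p) \<in> slot_points \<eta> a b" using S by simp
  then have r0: "(r0, p) \<in> \<eta>" "a < r0" "r0 \<le> b" by (simp_all add: slot_points_def)
  have un: "r' = r0 \<and> p' = p" if "(r', p') \<in> \<eta>" "a < r'" "r' \<le> b" for r' p'
  proof -
    have "(r', p') \<in> slot_points \<eta> a b" using that by (simp add: slot_points_def)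
    then show ?thesis using S by simp
  qed
  show ?thesis
  proof (cases "r0 \<le> r")
    case True
    obtain x i where p: "p = (x, i)" by (cases p)
    have "averaging \<epsilon> u \<eta> r = averaging \<epsilon> u \<eta> r0"
    proof (rule averaging_constant[OF True])
      show "\<not> (r0 < r' \<and> r' \<le> r)" if "(r', p') \<in> \<eta>" for r' p'
        using un[OF that] r0 r by fastforce
    qed
    also have "\<dots> = average_pair \<epsilon> (x, i) (averaging \<epsilon> u \<eta> a)"
    proof (rule averaging_update[OF lf])
      show "(r0, x, i) \<in> \<eta>" using r0 p by simp
      show "p' = (x, i)" if "(r0, p') \<in> \<eta>" for p' using un[OF that] r0 p by simp
      show "a < r0" by fact
      show "\<not> (a < r' \<and> r' < r0)" if "(r', p') \<in> \<eta>" for r' p'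
        using un[OF that] r0 by fastforce
    qed
    finally show ?thesis using True p by simp
  next
    case False
    then have "averaging \<epsilon> u \<eta> r = averaging \<epsilon> u \<eta> a"
    proof (intro averaging_constant[OF r(1)])
      show "\<not> (a < r' \<and> r' \<le> r)" if "(r', p') \<in> \<eta>" for r' p'
        using un[OF that] False r by fastforce
    qed
    then show ?thesis using False by simp
  qed
qed

text \<open>The configurations may differ outside the slot: this lets the letters of the unperturbed
  configuration also drive the process with the inserted update. In the middle of a slot the letter
  has either acted already or not yet.\<close>

lemma averaging_slot:
  assumes lf: "locally_finite_config \<epsilon> \<eta>" and ab: "a \<le> b" "0 \<le> a"
    and le: "(\<Sum>p\<in>bonds. slot_count \<eta> a b p) \<le> 1" and r: "a \<le> r" "r \<le> b"
    and lf': "locally_finite_config \<epsilon> \<eta>'" and eq: "slot_points \<eta>' a b = slot_points \<eta> a b"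
  shows "averaging \<epsilon> u \<eta>' r =
    update (if \<exists>z\<in>slot_points \<eta> a b. fst z \<le> r then update_of_counts (slot_count \<eta> a b) else None) (averaging \<epsilon> u \<eta>' a)"
  using lf ab le
proof (cases rule: slot_cases)
  case empty
  then show ?thesis using averaging_slot_empty[of \<eta>' a b r u] r eq by simp
next
  case (single r0 p)
  have "slot_points \<eta>' a b = {(r0, p)}" using single eq by simp
  from averaging_slot_single[OF lf' this r, of u] single show ?thesis by simp
qed

lemma averaging_slot_end:
  assumes lf: "locally_finite_config \<epsilon> \<eta>" and ab: "a \<le> b" "0 \<le> a"
    and le: "(\<Sum>p\<in>bonds. slot_count \<eta> a b p) \<le> 1"
    and lf': "locally_finite_config \<epsilon> \<eta>'" and eq: "slot_points \<eta>' a b = slot_points \<eta> a b"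
  shows "averaging \<epsilon> u \<eta>' b = update (update_of_counts (slot_count \<eta> a b)) (averaging \<epsilon> u \<eta>' a)"
  using lf ab le
proof (cases rule: slot_cases)
  case empty
  then show ?thesis using averaging_slot_empty[of \<eta>' a b b u] ab eq by simp
next
  case (single r0 p)
  then have "(r0, p) \<in> slot_points \<eta> a b" by simp
  then have "r0 \<le> b" by (simp add: slot_points_def)
  have "slot_points \<eta>' a b = {(r0, p)}" using single eq by simp
  from averaging_slot_single[OF lf' this ab(1) order_refl, of u] \<open>r0 \<le> b\<close> single(2)
  show ?thesis by simp
qed

text \<open>This word lists the actual arrivals instead of the grid slots, so the sup bound for
  \<open>run\<close> holds at every time and for every locally finite configuration.\<close>

lemma averaging_eq_run:
  "averaging \<epsilon> u \<eta> r = run (map (\<lambda>s. Some (SOME p. (s, p) \<in> \<eta>)) (sorted_list_of_set {s \<in> fst ` \<eta>. s \<le> r})) u"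
proof -
  have "update (Some p) = average_pair \<epsilon> p" for p by (rule ext) simp
  then show ?thesis unfolding averaging_def run_def fold_map by (simp add: comp_def)
qed

lemma finite_times: "locally_finite_config \<epsilon> \<eta> \<Longrightarrow> finite {s \<in> fst ` \<eta>. s \<le> r}"
proof -
  assume "locally_finite_config \<epsilon> \<eta>"
  then have "finite (fst ` {p \<in> \<eta>. fst p \<le> r})" by (simp add: locally_finite_config_def)
  moreover have "fst ` {p \<in> \<eta>. fst p \<le> r} = {s \<in> fst ` \<eta>. s \<le> r}" by auto
  ultimately show ?thesis by simp
qed

lemma averaging_bound:
  assumes lf: "locally_finite_config \<epsilon> \<eta>" and u: "\<And>x. x \<in> V \<Longrightarrow> \<bar>u x\<bar> \<le> U" and x: "x \<in> V"
  shows "\<bar>averaging \<epsilon> u \<eta> r x\<bar> \<le> U"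
  unfolding averaging_eq_run
proof (rule run_bound[OF _ u x])
  show "set (map (\<lambda>s. Some (SOME p. (s, p) \<in> \<eta>)) (sorted_list_of_set {s \<in> fst ` \<eta>. s \<le> r})) \<subseteq> updates"
  proof
    fix o' assume "o' \<in> set (map (\<lambda>s. Some (SOME p. (s, p) \<in> \<eta>)) (sorted_list_of_set {s \<in> fst ` \<eta>. s \<le> r}))"
    then obtain s where s: "s \<in> fst ` \<eta>" "o' = Some (SOME p. (s, p) \<in> \<eta>)"
      using finite_times[OF lf, of r] by auto
    then have "\<exists>p. (s, p) \<in> \<eta>" by (metis imageE prod.collapse)
    then have "(s, SOME p. (s, p) \<in> \<eta>) \<in> \<eta>" by (rule someI_ex)
    then show "o' \<in> updates" using s config_bonds[OF lf] by (auto simp: updates_def)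
  qed
qed

text \<open>Only finitely many arrivals precede \<open>t\<close>, and the value at time
  \<open>r\<close> depends only on which of them have occurred. The cut-off path is thus a finite
  combination of indicators.\<close>

lemma measurable_averaging:
  assumes lf: "locally_finite_config \<epsilon> \<eta>"
  shows "(\<lambda>r. indicator {0..t} r *\<^sub>R averaging \<epsilon> u \<eta> r x) \<in> borel_measurable borel"
proof -
  let ?T = "\<lambda>r. {s \<in> fst ` \<eta>. s \<le> r}"
  let ?f = "\<lambda>B. fold (\<lambda>s. average_pair \<epsilon> (SOME p. (s, p) \<in> \<eta>)) (sorted_list_of_set B) u x"
  \<comment> \<open>For \<open>B\<close> among the arrival times up to \<open>t\<close>, the times
    in [0, t] at which exactly the arrivals in \<open>B\<close> have occurred; as an intersection of
    half-lines it is a Borel set.\<close>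
  let ?E = "\<lambda>B. {0..t} \<inter> (\<Inter>s\<in>?T t. if s \<in> B then {s..} else {..<s})"
  have fin: "finite (?T t)" by (rule finite_times[OF lf])
  have E: "r \<in> ?E B \<longleftrightarrow> r \<in> {0..t} \<and> ?T r = B" if "B \<subseteq> ?T t" for r B
  proof
    assume r: "r \<in> ?E B"
    have "s \<in> ?T r \<longleftrightarrow> s \<in> B" for s
    proof (cases "s \<in> ?T t")
      case True
      then have "r \<in> (if s \<in> B then {s..} else {..<s})" using r by blast
      then show ?thesis using True by (cases "s \<in> B") auto
    next
      case False
      then show ?thesis using r that by auto
    qed
    then have "?T r = B" by blast
    then show "r \<in> {0..t} \<and> ?T r = B" using r by blast
  next
    assume r: "r \<in> {0..t} \<and> ?T r = B"
    have "r \<in> (if s \<in> B then {s..} else {..<s})" if "s \<in> ?T t" for s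
      using r that by (cases "s \<in> B") auto
    then show "r \<in> ?E B" using r by blast
  qed
  have "indicator {0..t} r *\<^sub>R averaging \<epsilon> u \<eta> r x = (\<Sum>B\<in>Pow (?T t). ?f B * indicator (?E B) r)" for r
  proof (cases "r \<in> {0..t}")
    case True
    then have sub: "?T r \<in> Pow (?T t)" by auto
    have "(\<Sum>B\<in>Pow (?T t). ?f B * indicator (?E B) r) = (\<Sum>B\<in>Pow (?T t). if B = ?T r then ?f B else 0)"
      by (rule sum.cong) (use True E in \<open>auto simp del: Int_iff INT_iff simp: indicator_def\<close>)
    also have "\<dots> = ?f (?T r)" using sub fin by simp
    finally show ?thesis using True by (simp add: averaging_def)
  next
    case False
    then have "indicator (?E B) r = (0::real)" for B
      by (intro indicator_simps(2)) blast
    then have "(\<Sum>B\<in>Pow (?T t). ?f B * indicator (?E B) r) = 0"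
      by (intro sum.neutral ballI) (simp only: mult_zero_right)
    with False show ?thesis by simp
  qed
  moreover have "(\<lambda>r. \<Sum>B\<in>Pow (?T t). ?f B * indicator (?E B) r) \<in> borel_measurable borel"
  proof (intro borel_measurable_sum borel_measurable_times borel_measurable_const borel_measurable_indicator)
    fix B assume "B \<in> Pow (?T t)"
    have "(\<Inter>s\<in>?T t. if s \<in> B then {s..} else {..<s}) \<in> sets borel"
    proof (cases "?T t = {}")
      case True
      show ?thesis by (subst True) simp
    next
      case False
      then show ?thesis using fin by (intro sets.finite_INT) auto
    qed
    then show "?E B \<in> sets borel" by auto
  qed
  ultimately show ?thesis by simp
qed

end

section \<open>The effect of an extra update on the functional\<close>

lemma exists_slot:
  fixes r \<Delta> :: real
  assumes "0 < r" "r \<le> real m * \<Delta>"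
  shows "\<exists>k<m. real k * \<Delta> < r \<and> r \<le> real (Suc k) * \<Delta>"
  using assms
proof (induction m)
  case (Suc m)
  show ?case
  proof (cases "r \<le> real m * \<Delta>")
    case True
    with Suc show ?thesis using less_SucI by blast
  next
    case False
    with Suc.prems show ?thesis by (intro exI[of _ m]) auto
  qed
qed simp

lemma time_torus_continuous_section:
  assumes "time_torus_continuous f"
  shows "continuous_on {0..t} (\<lambda>r. f r x)"
proof -
  have "continuous_on ({0..} \<times> UNIV) (\<lambda>(s, x). f s x)"
    using assms by (simp add: time_torus_continuous_def)
  then have "continuous_on {0..t} (\<lambda>r. (\<lambda>(s, x). f s x) (r, x))"
    by (rule continuous_on_compose2) (auto intro: continuous_intros)
  then show ?thesis by simp
qed

context torus_mesh
begin

definition weighted_energy :: "('d \<Rightarrow> real \<Rightarrow> real^'d \<Rightarrow> real) \<Rightarrow> real \<Rightarrow> (real^'d \<Rightarrow> real) \<Rightarrow> real" where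
  "weighted_energy g r v = (\<Sum>i\<in>UNIV. \<epsilon> ^ CARD('d) * (\<Sum>x\<in>V. (discrete_grad \<epsilon> i v x)\<^sup>2 * g i r x))"

lemma weighted_energy_eq:
  "weighted_energy g r v = \<epsilon> ^ CARD('d) / \<epsilon>\<^sup>2 * (\<Sum>p\<in>bonds. (bond_grad p v)\<^sup>2 * g (snd p) r (fst p))"
  unfolding weighted_energy_def sum_bonds
  by (simp add: sum_distrib_left discrete_grad_def bond_grad_def power_divide)

lemma weighted_energy_bound:
  assumes g: "\<And>i x. x \<in> V \<Longrightarrow> \<bar>g i r x\<bar> \<le> B" and v: "\<And>x. x \<in> V \<Longrightarrow> \<bar>v x\<bar> \<le> U"
  shows "\<bar>weighted_energy g r v\<bar> \<le> \<epsilon> ^ CARD('d) / \<epsilon>\<^sup>2 * (real (card bonds) * ((2 * U)\<^sup>2 * B))"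
proof -
  have "\<bar>\<Sum>p\<in>bonds. (bond_grad p v)\<^sup>2 * g (snd p) r (fst p)\<bar> \<le> (\<Sum>p\<in>bonds. (2 * U)\<^sup>2 * B)"
  proof (rule order_trans[OF sum_abs sum_mono])
    fix p assume p: "p \<in> bonds"
    then have V: "fst p \<in> V" "torus_shift \<epsilon> (snd p) (fst p) \<in> V"
      by (auto simp: bonds_def shift_in_lattice)
    have "\<bar>bond_grad p v\<bar> \<le> 2 * U"
      using v[OF V(1)] v[OF V(2)] unfolding bond_grad_def by linarith
    then have "\<bar>bond_grad p v\<bar>\<^sup>2 \<le> (2 * U)\<^sup>2" by (intro power_mono) auto
    then show "\<bar>(bond_grad p v)\<^sup>2 * g (snd p) r (fst p)\<bar> \<le> (2 * U)\<^sup>2 * B"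
      unfolding abs_mult using g[OF V(1)] by (intro mult_mono) auto
  qed
  then show ?thesis
    unfolding weighted_energy_eq abs_mult using eps_pos by (simp add: mult_left_mono divide_right_mono)
qed

text \<open>The factorisation a^2 - b^2 = (a - b) (a + b), applied to the gradients, replaces a
  difference of energies by a product of two linear evolutions.\<close>

lemma weighted_energy_diff_le:
  assumes g: "\<And>i x. x \<in> V \<Longrightarrow> \<bar>g i r x\<bar> \<le> B"
  shows "\<bar>weighted_energy g r v' - weighted_energy g r v\<bar>
    \<le> \<epsilon> ^ CARD('d) / \<epsilon>\<^sup>2 * (B * cross_energy (\<lambda>x. v' x - v x) (\<lambda>x. v' x + v x))"
proof -
  have "\<bar>\<Sum>p\<in>bonds. ((bond_grad p v')\<^sup>2 - (bond_grad p v)\<^sup>2) * g (snd p) r (fst p)\<bar>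
      \<le> (\<Sum>p\<in>bonds. B * (\<bar>bond_grad p (\<lambda>x. v' x - v x)\<bar> * \<bar>bond_grad p (\<lambda>x. v' x + v x)\<bar>))"
  proof (rule order_trans[OF sum_abs sum_mono])
    fix p assume "p \<in> bonds"
    then have "fst p \<in> V" by (auto simp: bonds_def)
    from g[OF this] have B: "\<bar>g (snd p) r (fst p)\<bar> \<le> B" .
    have "(bond_grad p v')\<^sup>2 - (bond_grad p v)\<^sup>2 = bond_grad p (\<lambda>x. v' x - v x) * bond_grad p (\<lambda>x. v' x + v x)"
      by (simp add: bond_grad_def power2_eq_square algebra_simps)
    then have "\<bar>((bond_grad p v')\<^sup>2 - (bond_grad p v)\<^sup>2) * g (snd p) r (fst p)\<bar>
        = \<bar>g (snd p) r (fst p)\<bar> * (\<bar>bond_grad p (\<lambda>x. v' x - v x)\<bar> * \<bar>bond_grad p (\<lambda>x. v' x + v x)\<bar>)"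
      by (simp add: abs_mult mult.commute)
    also have "\<dots> \<le> B * (\<bar>bond_grad p (\<lambda>x. v' x - v x)\<bar> * \<bar>bond_grad p (\<lambda>x. v' x + v x)\<bar>)"
      using B by (rule mult_right_mono) simp
    finally show "\<bar>((bond_grad p v')\<^sup>2 - (bond_grad p v)\<^sup>2) * g (snd p) r (fst p)\<bar>
        \<le> B * (\<bar>bond_grad p (\<lambda>x. v' x - v x)\<bar> * \<bar>bond_grad p (\<lambda>x. v' x + v x)\<bar>)" .
  qed
  then have *: "\<bar>(\<Sum>p\<in>bonds. (bond_grad p v')\<^sup>2 * g (snd p) r (fst p)) - (\<Sum>p\<in>bonds. (bond_grad p v)\<^sup>2 * g (snd p) r (fst p))\<bar>
      \<le> B * cross_energy (\<lambda>x. v' x - v x) (\<lambda>x. v' x + v x)"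
    by (simp add: cross_energy_def sum_distrib_left sum_subtractf left_diff_distrib)
  have "0 \<le> \<epsilon> ^ CARD('d) / \<epsilon>\<^sup>2" using eps_pos by simp
  from mult_left_mono[OF * this] this show ?thesis
    unfolding weighted_energy_eq right_diff_distrib[symmetric] by (simp only: abs_mult abs_of_nonneg)
qed

lemma set_integrable_grad_sq:
  assumes lf: "locally_finite_config \<epsilon> \<eta>" and u: "\<And>x. x \<in> V \<Longrightarrow> \<bar>u x\<bar> \<le> U"
    and g: "continuous_on {0..t} (\<lambda>r. f r x)" and x: "x \<in> V"
  shows "integrable lborel (\<lambda>r. indicator {0..t} r *\<^sub>R ((discrete_grad \<epsilon> i (averaging \<epsilon> u \<eta> r) x)\<^sup>2 * f r x))"
proof -
  let ?ind = "\<lambda>r. indicator {0..t} r :: real"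
  let ?x' = "torus_shift \<epsilon> i x"
  let ?F = "\<lambda>r. (discrete_grad \<epsilon> i (averaging \<epsilon> u \<eta> r) x)\<^sup>2 * f r x"
  have "bounded ((\<lambda>r. f r x) ` {0..t})"
    by (intro compact_imp_bounded compact_continuous_image g) simp
  then obtain B where B: "\<And>r. r \<in> {0..t} \<Longrightarrow> \<bar>f r x\<bar> \<le> B"
    unfolding bounded_iff by (metis imageI real_norm_def)
  have "(\<lambda>r. ((?ind r *\<^sub>R averaging \<epsilon> u \<eta> r ?x' - ?ind r *\<^sub>R averaging \<epsilon> u \<eta> r x) / \<epsilon>)\<^sup>2 * (?ind r *\<^sub>R f r x))
      \<in> borel_measurable borel"
    by (intro borel_measurable_times borel_measurable_power borel_measurable_divide borel_measurable_diff
        measurable_averaging[OF lf] borel_measurable_continuous_on_indicator g) auto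
  also have "(\<lambda>r. ((?ind r *\<^sub>R averaging \<epsilon> u \<eta> r ?x' - ?ind r *\<^sub>R averaging \<epsilon> u \<eta> r x) / \<epsilon>)\<^sup>2 * (?ind r *\<^sub>R f r x))
      = (\<lambda>r. ?ind r *\<^sub>R ?F r)"
    by (rule ext) (simp add: discrete_grad_def indicator_def)
  finally have meas: "(\<lambda>r. ?ind r *\<^sub>R ?F r) \<in> borel_measurable lborel" by simp
  \<comment> \<open>The indicator appears twice because measurability is available for the integrand
    only after it has been cut off to [0, t].\<close>
  have "integrable lborel (\<lambda>r. ?ind r *\<^sub>R (?ind r *\<^sub>R ?F r))"
  proof (rule integrableI_bounded_set_indicator[where B = "(2 * U / \<epsilon>)\<^sup>2 * B"])
    show "AE r in lborel. r \<in> {0..t} \<longrightarrow> norm (?ind r *\<^sub>R ?F r) \<le> (2 * U / \<epsilon>)\<^sup>2 * B"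
    proof (intro AE_I2 impI)
      fix r assume r: "r \<in> {0..t}"
      have "\<bar>averaging \<epsilon> u \<eta> r ?x' - averaging \<epsilon> u \<eta> r x\<bar> \<le> 2 * U"
      proof -
        have "\<bar>averaging \<epsilon> u \<eta> r x\<bar> \<le> U" by (rule averaging_bound[OF lf u x])
        moreover have "\<bar>averaging \<epsilon> u \<eta> r ?x'\<bar> \<le> U"
          by (rule averaging_bound[OF lf u shift_in_lattice[OF x]])
        ultimately show ?thesis by linarith
      qed
      then have "\<bar>discrete_grad \<epsilon> i (averaging \<epsilon> u \<eta> r) x\<bar> \<le> 2 * U / \<epsilon>"
        unfolding discrete_grad_def using eps_pos by (simp add: abs_divide divide_right_mono)
      then have "\<bar>discrete_grad \<epsilon> i (averaging \<epsilon> u \<eta> r) x\<bar>\<^sup>2 \<le> (2 * U / \<epsilon>)\<^sup>2" by (intro power_mono) auto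
      then show "norm (?ind r *\<^sub>R ?F r) \<le> (2 * U / \<epsilon>)\<^sup>2 * B"
        using r B[OF r] by (auto simp: abs_mult intro!: mult_mono)
    qed
  qed (use meas in \<open>auto simp: emeasure_lborel_Icc_eq\<close>)
  moreover have "?ind r *\<^sub>R (?ind r *\<^sub>R ?F r) = ?ind r *\<^sub>R ?F r" for r
    by (simp add: indicator_def)
  ultimately show ?thesis by (simp only:)
qed

lemma
  assumes lf: "locally_finite_config \<epsilon> \<eta>" and u: "\<And>x. x \<in> V \<Longrightarrow> \<bar>u0 x\<bar> \<le> U"
    and g: "\<And>i. time_torus_continuous (g i)"
  shows integrable_weighted_energy:
      "integrable lborel (\<lambda>r. indicator {0..t} r *\<^sub>R weighted_energy g r (averaging \<epsilon> (restrict u0 V) \<eta> r))"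
    and carre_du_champ_eq:
      "carre_du_champ \<epsilon> u0 g t \<eta> = (LINT r|lborel. indicator {0..t} r *\<^sub>R weighted_energy g r (averaging \<epsilon> (restrict u0 V) \<eta> r))"
proof -
  let ?F = "\<lambda>i r. indicator {0..t} r *\<^sub>R (\<epsilon> ^ CARD('d) *
      (\<Sum>x\<in>V. (discrete_grad \<epsilon> i (averaging \<epsilon> (restrict u0 V) \<eta> r) x)\<^sup>2 * g i r x))"
  have eq: "?F i = (\<lambda>r. \<epsilon> ^ CARD('d) * (\<Sum>x\<in>V. indicator {0..t} r *\<^sub>R
      ((discrete_grad \<epsilon> i (averaging \<epsilon> (restrict u0 V) \<eta> r) x)\<^sup>2 * g i r x)))" for i
    by (rule ext) (simp add: sum_distrib_left ac_simps)
  have int: "integrable lborel (?F i)" for i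
    unfolding eq
    by (intro integrable_mult_right Bochner_Integration.integrable_sum set_integrable_grad_sq[OF lf, of _ U]
        time_torus_continuous_section g) (use u in auto)
  have sum: "indicator {0..t} r *\<^sub>R weighted_energy g r (averaging \<epsilon> (restrict u0 V) \<eta> r) = (\<Sum>i\<in>UNIV. ?F i r)" for r
    by (simp add: weighted_energy_def sum_distrib_left)
  show "integrable lborel (\<lambda>r. indicator {0..t} r *\<^sub>R weighted_energy g r (averaging \<epsilon> (restrict u0 V) \<eta> r))"
    unfolding sum by (intro Bochner_Integration.integrable_sum int)
  have "(LINT r|lborel. (\<Sum>i\<in>UNIV. ?F i r)) = (\<Sum>i\<in>UNIV. (LINT r|lborel. ?F i r))"
    by (intro Bochner_Integration.integral_sum int)
  then show "carre_du_champ \<epsilon> u0 g t \<eta> = (LINT r|lborel. indicator {0..t} r *\<^sub>R weighted_energy g r (averaging \<epsilon> (restrict u0 V) \<eta> r))"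
    unfolding sum carre_du_champ_def set_lebesgue_integral_def V_def[symmetric] by simp
qed

lemma locally_finite_insert:
  assumes "locally_finite_config \<epsilon> \<eta>" "p \<in> bonds" "0 \<le> s"
  shows "locally_finite_config \<epsilon> (insert (s, p) \<eta>)"
proof -
  have "finite {z \<in> insert (s, p) \<eta>. fst z \<le> t}" for t
    by (rule finite_subset[of _ "insert (s, p) {z \<in> \<eta>. fst z \<le> t}"])
      (use assms in \<open>auto simp: locally_finite_config_def\<close>)
  moreover have "p \<in> torus_lattice \<epsilon> \<times> UNIV" using assms(2) unfolding bonds_def unfolding V_def .
  ultimately show ?thesis using assms by (auto simp: locally_finite_config_def)
qed

text \<open>A crude deterministic bound. It is multiplied by the probability of the exceptional
  event, so its growth in \<open>t\<close> and \<open>1 / \<epsilon>\<close> is harmless.\<close>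

lemma carre_du_champ_bound:
  assumes lf: "locally_finite_config \<epsilon> \<eta>" and u: "\<And>x. x \<in> V \<Longrightarrow> \<bar>u0 x\<bar> \<le> U"
    and g: "\<And>i. time_torus_continuous (g i)" and t: "0 \<le> t"
    and B: "\<And>i r x. 0 \<le> r \<Longrightarrow> r \<le> t \<Longrightarrow> x \<in> V \<Longrightarrow> \<bar>g i r x\<bar> \<le> B"
  shows "\<bar>carre_du_champ \<epsilon> u0 g t \<eta>\<bar> \<le> t * (\<epsilon> ^ CARD('d) / \<epsilon>\<^sup>2 * (real (card bonds) * ((2 * U)\<^sup>2 * B)))"
  (is "_ \<le> t * ?K")
proof -
  have carre: "carre_du_champ \<epsilon> u0 g t \<eta> = (LINT r|lborel. indicator {0..t} r *\<^sub>R weighted_energy g r (averaging \<epsilon> (restrict u0 V) \<eta> r))"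
    by (rule carre_du_champ_eq[OF lf u g])
  have "\<bar>carre_du_champ \<epsilon> u0 g t \<eta>\<bar> \<le> (LINT r|lborel. indicator {0..t} r *\<^sub>R ?K)"
    unfolding carre
  proof (rule integral_abs_bound_integral[OF integrable_weighted_energy[OF lf u g]])
    show "integrable lborel (\<lambda>r. indicator {0..t} r *\<^sub>R ?K)"
      using t by simp
    show "\<bar>indicator {0..t} r *\<^sub>R weighted_energy g r (averaging \<epsilon> (restrict u0 V) \<eta> r)\<bar> \<le> indicator {0..t} r *\<^sub>R ?K" for r
    proof (cases "r \<in> {0..t}")
      case True
      have "\<bar>weighted_energy g r (averaging \<epsilon> (restrict u0 V) \<eta> r)\<bar> \<le> ?K"
        using True by (intro weighted_energy_bound B averaging_bound[OF lf]) (auto intro: u)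
      then show ?thesis using True by simp
    qed simp
  qed
  also have "\<dots> = t * ?K" using t by simp
  finally show ?thesis .
qed

text \<open>An update after the horizon is invisible, which reduces the integral over all insertion
  times to [0, t].\<close>

lemma add_one_cost_late:
  fixes u0 :: "real^'d \<Rightarrow> real"
  assumes "t < s"
  shows "add_one_cost (s, x, i) (carre_du_champ \<epsilon> u0 g t) \<eta> = 0"
proof -
  have "averaging \<epsilon> (restrict u0 V) (insert (s, x, i) \<eta>) r = averaging \<epsilon> (restrict u0 V) \<eta> r" if "r \<le> t" for r
    using that assms by (intro averaging_cong) auto
  then have "carre_du_champ \<epsilon> u0 g t (insert (s, x, i) \<eta>) = carre_du_champ \<epsilon> u0 g t \<eta>"
    unfolding carre_du_champ_def V_def[symmetric]
    by (intro sum.cong refl set_lebesgue_integral_cong) auto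
  then show ?thesis by (simp add: add_one_cost_def)
qed

section \<open>The add-one cost of a configuration with few arrivals per slot\<close>

definition slot_word :: "real \<Rightarrow> nat \<Rightarrow> 'd config \<Rightarrow> ((real^'d) \<times> 'd) option list" where
  "slot_word \<Delta> m \<eta> = map (\<lambda>k. update_of_counts (slot_count \<eta> (real k * \<Delta>) (real (Suc k) * \<Delta>))) [0..<m]"

text \<open>The bound for the add-one cost in lattice units: \<open>v\<close> is the configuration
  before the insertion at \<open>p\<close>, and \<open>w\<close> holds the letters after the
  insertion slot. It depends on the clocks only through letters and not on the exact insertion
  time.\<close>

definition response :: "(real^'d \<Rightarrow> real) \<Rightarrow> (real^'d) \<times> 'd \<Rightarrow> nat \<Rightarrow> ((real^'d) \<times> 'd) option list \<Rightarrow> real" where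
  "response v p L w = (\<Sum>i\<le>L. cross_energy (run (take i w) (\<lambda>x. average_pair \<epsilon> p v x - v x))
     (run (take i w) (\<lambda>x. average_pair \<epsilon> p v x + v x)))"

text \<open>Of the m = j + 1 + L slots, \<open>j\<close> precede the insertion and \<open>L\<close>
  follow it. The insertion slot has no other arrival, so the two processes leave it at
  \<open>average_pair\<close> of \<open>v\<close> and at \<open>v\<close>; afterwards they read the
  same letters. Integration in time contributes \<Delta> per slot, and the factor 2 is that of
  \<open>sum_lessThan_consecutive_le\<close>.\<close>

lemma abs_add_one_cost_le:
  assumes lf: "locally_finite_config \<epsilon> \<eta>" and u: "\<And>x. x \<in> V \<Longrightarrow> \<bar>u0 x\<bar> \<le> U"
    and g: "\<And>i. time_torus_continuous (g i)"
    and B: "\<And>i r x. 0 \<le> r \<Longrightarrow> r \<le> t \<Longrightarrow> x \<in> V \<Longrightarrow> \<bar>g i r x\<bar> \<le> B"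
    and \<Delta>: "0 < \<Delta>" and m: "m = Suc (j + L)" and t: "t = real m * \<Delta>"
    and start: "\<And>p. (0, p) \<notin> \<eta>"
    and good: "\<And>k. k < m \<Longrightarrow> (\<Sum>p\<in>bonds. slot_count \<eta> (real k * \<Delta>) (real (Suc k) * \<Delta>) p) \<le> 1"
    and empty: "(\<Sum>p\<in>bonds. slot_count \<eta> (real j * \<Delta>) (real (Suc j) * \<Delta>) p) = 0"
    and s: "real j * \<Delta> < s" "s \<le> real (Suc j) * \<Delta>" and p: "(x, i) \<in> bonds"
  shows "\<bar>add_one_cost (s, x, i) (carre_du_champ \<epsilon> u0 g t) \<eta>\<bar>
    \<le> \<epsilon> ^ CARD('d) / \<epsilon>\<^sup>2 * B * (2 * \<Delta>) *
       response (run (take j (slot_word \<Delta> m \<eta>)) (restrict u0 V)) (x, i) L (drop (Suc j) (slot_word \<Delta> m \<eta>))"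
proof -
  let ?p = "(x, i)"
  define \<tau> where "\<tau> k = real k * \<Delta>" for k
  define U' where "U' k = update_of_counts (slot_count \<eta> (\<tau> k) (\<tau> (Suc k)))" for k
  define \<eta>' where "\<eta>' = insert (s, ?p) \<eta>"
  define a where "a r = averaging \<epsilon> (restrict u0 V) \<eta> r" for r
  define a' where "a' r = averaging \<epsilon> (restrict u0 V) \<eta>' r" for r
  define v where "v = run (map U' [0..<j]) (restrict u0 V)"
  define h where "h l = cross_energy (run (take l (drop (Suc j) (slot_word \<Delta> m \<eta>))) (\<lambda>x. average_pair \<epsilon> ?p v x - v x))
     (run (take l (drop (Suc j) (slot_word \<Delta> m \<eta>))) (\<lambda>x. average_pair \<epsilon> ?p v x + v x))" for l
  define D where "D r = cross_energy (\<lambda>x. a' r x - a r x) (\<lambda>x. a' r x + a r x)" for r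
  have \<tau>_mono: "\<tau> k \<le> \<tau> l \<longleftrightarrow> k \<le> l" for k l using \<Delta> by (simp add: \<tau>_def)
  have \<tau>_nonneg: "0 \<le> \<tau> k" for k using \<Delta> by (simp add: \<tau>_def)
  have \<tau>_Suc: "\<tau> k \<le> \<tau> (Suc k)" for k by (simp add: \<tau>_mono)
  have s': "\<tau> j < s" "s \<le> \<tau> (Suc j)" using s by (simp_all add: \<tau>_def)
  have s_pos: "0 < s" using s' \<tau>_nonneg[of j] by linarith
  have t_eq: "t = \<tau> m" by (simp add: t \<tau>_def)
  have good': "(\<Sum>p\<in>bonds. slot_count \<eta> (\<tau> k) (\<tau> (Suc k)) p) \<le> 1" if "k < m" for k
    using good[OF that] by (simp add: \<tau>_def)
  have lf': "locally_finite_config \<epsilon> \<eta>'"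
    unfolding \<eta>'_def using s_pos by (intro locally_finite_insert lf p) simp
  have word: "slot_word \<Delta> m \<eta> = map U' [0..<m]"
    by (simp add: slot_word_def U'_def \<tau>_def)
  have take_drop: "take l (drop (Suc j) (slot_word \<Delta> m \<eta>)) = map U' [Suc j..<Suc j + l]" if "l \<le> L" for l
  proof -
    have "Suc j + l \<le> m" using that m by simp
    then show ?thesis by (simp only: word drop_map take_map drop_upt take_upt add_0)
  qed
  have take_word: "take j (slot_word \<Delta> m \<eta>) = map U' [0..<j]"
  proof -
    have "0 + j \<le> m" using m by simp
    then show ?thesis by (simp only: word take_map take_upt add_0)
  qed
  have a_\<tau>: "a (\<tau> k) = run (map U' [0..<k]) (restrict u0 V)" if "k \<le> m" for k
    using that
  proof (induction k)
    case 0
    \<comment> \<open>A point at time 0 lies in no slot and would be missed by the word;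
      \<open>start\<close> excludes it.\<close>
    have none: "{s \<in> fst ` \<eta>. s \<le> 0} = {}"
      using config_bonds[OF lf] start by force
    have "averaging \<epsilon> (restrict u0 V) \<eta> 0 = restrict u0 V"
      unfolding averaging_def none by simp
    then show ?case by (simp add: a_def \<tau>_def)
  next
    case (Suc k)
    then show ?case
      using averaging_slot_end[OF lf \<tau>_Suc \<tau>_nonneg good' lf refl, of k "restrict u0 V"]
      by (simp add: a_def[symmetric] U'_def)
  qed
  have v_eq: "a (\<tau> j) = v" unfolding v_def using a_\<tau>[of j] m by simp
  have early: "a' r = a r" if "r < s" for r
    unfolding a_def a'_def \<eta>'_def using that by (intro averaging_cong) auto
  have D_early: "D r = 0" if "r < s" for r
    by (simp add: D_def early[OF that] cross_energy_def bond_grad_def)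
  have slot_j: "slot_points \<eta> (\<tau> j) (\<tau> (Suc j)) = {}"
  proof -
    have "update_of_counts (slot_count \<eta> (\<tau> j) (\<tau> (Suc j))) = None"
      using empty by (simp add: update_of_counts_def \<tau>_def)
    with good'[of j] m show ?thesis
      by (cases rule: slot_cases[OF lf \<tau>_Suc \<tau>_nonneg, of j]) auto
  qed
  have a_j: "a r = v" if "\<tau> j \<le> r" "r \<le> \<tau> (Suc j)" for r
    using averaging_slot_empty[OF slot_j that] v_eq by (simp add: a_def)
  have a'_j: "a' r = average_pair \<epsilon> ?p v" if "s \<le> r" "r \<le> \<tau> (Suc j)" for r
  proof -
    have "slot_points \<eta>' (\<tau> j) (\<tau> (Suc j)) = {(s, ?p)}"
      using slot_j s' by (auto simp: slot_points_def \<eta>'_def)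
    from averaging_slot_single[OF lf' this _ that(2)] that s' early[OF s'(1)] v_eq
    show ?thesis by (simp add: a_def a'_def)
  qed
  have slot_late: "slot_points \<eta>' (\<tau> (Suc j + l)) (\<tau> (Suc (Suc j + l))) = slot_points \<eta> (\<tau> (Suc j + l)) (\<tau> (Suc (Suc j + l)))" for l
  proof -
    have "s \<le> \<tau> (Suc j + l)" using s'(2) \<tau>_mono[of "Suc j" "Suc j + l"] by simp
    then show ?thesis by (auto simp: slot_points_def \<eta>'_def)
  qed
  have late: "a (\<tau> (Suc j + l)) = run (map U' [Suc j..<Suc j + l]) v \<and>
      a' (\<tau> (Suc j + l)) = run (map U' [Suc j..<Suc j + l]) (average_pair \<epsilon> ?p v)" if "l \<le> L" for l
    using that
  proof (induction l)
    case 0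
    then show ?case using a_j[of "\<tau> (Suc j)"] a'_j[of "\<tau> (Suc j)"] s' \<tau>_Suc[of j] by simp
  next
    case (Suc l)
    have k: "Suc j + l < m" using Suc.prems m by simp
    have "a (\<tau> (Suc (Suc j + l))) = update (U' (Suc j + l)) (a (\<tau> (Suc j + l)))"
      using averaging_slot_end[OF lf \<tau>_Suc \<tau>_nonneg good'[OF k] lf refl]
      unfolding a_def U'_def .
    moreover have "a' (\<tau> (Suc (Suc j + l))) = update (U' (Suc j + l)) (a' (\<tau> (Suc j + l)))"
      using averaging_slot_end[OF lf \<tau>_Suc \<tau>_nonneg good'[OF k] lf' slot_late]
      unfolding a'_def U'_def .
    ultimately show ?case using Suc by simp
  qed
  \<comment> \<open>By linearity of \<open>run\<close>, the evolved dipole and the evolved sum are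
    the difference and the sum of the two processes at the grid times.\<close>
  have h_eq: "h l = D (\<tau> (Suc j + l))" if "l \<le> L" for l
    using late[OF that] by (simp only: h_def D_def take_drop[OF that] run_add run_diff)
  have D_j: "D r \<le> h 0" if "\<tau> j < r" "r \<le> \<tau> (Suc j)" for r
  proof (cases "r < s")
    case True
    then show ?thesis by (simp add: D_early h_def)
  next
    case False
    then have "D r = D (\<tau> (Suc j))"
      using a_j[of r] a_j[of "\<tau> (Suc j)"] a'_j[of r] a'_j[of "\<tau> (Suc j)"] that s' \<tau>_Suc[of j]
      by (simp add: D_def)
    then show ?thesis using h_eq[of 0] by simp
  qed
  have D_late: "D r \<le> h l + h (Suc l)"
    if "l < L" "\<tau> (Suc j + l) < r" "r \<le> \<tau> (Suc (Suc j + l))" for l r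
  proof -
    let ?k = "Suc j + l"
    have k: "?k < m" using that m by simp
    define o' where "o' = (if \<exists>z\<in>slot_points \<eta> (\<tau> ?k) (\<tau> (Suc ?k)). fst z \<le> r then U' ?k else None)"
    have ar: "a r = update o' (a (\<tau> ?k))"
      using averaging_slot[OF lf \<tau>_Suc \<tau>_nonneg good'[OF k] _ that(3) lf refl] that
      unfolding a_def o'_def U'_def by simp
    have ar': "a' r = update o' (a' (\<tau> ?k))"
      using averaging_slot[OF lf \<tau>_Suc \<tau>_nonneg good'[OF k] _ that(3) lf' slot_late] that
      unfolding a'_def o'_def U'_def by simp
    have h_nonneg: "0 \<le> h i" for i by (simp add: h_def)
    consider "o' = None" | "o' = U' ?k" unfolding o'_def by presburger
    then show ?thesis
    proof cases
      case 1
      then have "D r = h l"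
        using ar ar' h_eq[of l] that by (simp add: D_def)
      then show ?thesis using h_nonneg[of "Suc l"] by simp
    next
      case 2
      have "a (\<tau> (Suc ?k)) = update (U' ?k) (a (\<tau> ?k))" "a' (\<tau> (Suc ?k)) = update (U' ?k) (a' (\<tau> ?k))"
        using late[of l] late[of "Suc l"] that by simp_all
      then have "D r = D (\<tau> (Suc ?k))"
        using ar ar' 2 by (simp add: D_def)
      then have "D r = h (Suc l)" using h_eq[of "Suc l"] that by simp
      then show ?thesis using h_nonneg[of l] by simp
    qed
  qed
  \<comment> \<open>Grid values of \<open>h\<close> are indexed from the end of slot
    \<open>j\<close>, so the ends of a later slot \<open>k\<close> have indices
    \<open>k - Suc j\<close> and \<open>k - j\<close>. In slot \<open>j\<close> itself the
    difference is zero before \<open>s\<close> and has its final value afterwards.\<close>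
  define c where "c k = (if k < j then 0 else if k = j then h 0 else h (k - Suc j) + h (k - j))" for k
  have c_nonneg: "0 \<le> c k" for k by (simp add: c_def h_def)
  have D_le: "D r \<le> (\<Sum>k<m. c k * indicator {\<tau> k<..\<tau> (Suc k)} r)" if r: "r \<le> t" for r
  proof (cases "0 < r")
    case False
    then have "D r = 0" using s_pos by (intro D_early) simp
    then show ?thesis using c_nonneg by (auto intro: sum_nonneg)
  next
    case True
    obtain k where k: "k < m" "\<tau> k < r" "r \<le> \<tau> (Suc k)"
      using exists_slot[OF True, of m \<Delta>] r t_eq unfolding \<tau>_def by blast
    have "D r \<le> c k"
    proof -
      consider "k < j" | "k = j" | l where "k = Suc j + l" "l < L"
        using k(1) m by (metis add_less_cancel_left linorder_neqE_nat less_imp_Suc_add add_Suc)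
      then show ?thesis
      proof cases
        case 1
        then have "r < s" using k \<tau>_mono[of "Suc k" j] s' by simp
        then show ?thesis using 1 by (simp add: D_early c_def)
      next
        case 2
        then show ?thesis using D_j k by (simp add: c_def)
      next
        case 3
        then show ?thesis using D_late[of l r] k by (simp add: c_def)
      qed
    qed
    also have "\<dots> = c k * indicator {\<tau> k<..\<tau> (Suc k)} r" using k by simp
    also have "\<dots> \<le> (\<Sum>k<m. c k * indicator {\<tau> k<..\<tau> (Suc k)} r)"
      using k c_nonneg by (intro member_le_sum) auto
    finally show ?thesis .
  qed
  let ?E = "\<epsilon> ^ CARD('d) / \<epsilon>\<^sup>2"
  have B0: "0 \<le> B"
  proof -
    have "\<bar>g i 0 0\<bar> \<le> B" using t_eq \<tau>_nonneg by (intro B zero_in_lattice) auto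
    then show ?thesis by linarith
  qed
  have E0: "0 \<le> ?E * B" using eps_pos B0 by simp
  have ind: "integrable lborel (indicator {\<tau> k<..\<tau> (Suc k)} :: real \<Rightarrow> real)" for k
    using \<tau>_Suc[of k] by (intro integrable_real_indicator) auto
  let ?I = "\<lambda>r. \<Sum>k<m. (?E * B * c k) *\<^sub>R (indicator {\<tau> k<..\<tau> (Suc k)} r :: real)"
  have carre: "carre_du_champ \<epsilon> u0 g t \<eta> = (LINT r|lborel. indicator {0..t} r *\<^sub>R weighted_energy g r (a r))"
    unfolding a_def by (rule carre_du_champ_eq[OF lf u g])
  have carre': "carre_du_champ \<epsilon> u0 g t \<eta>' = (LINT r|lborel. indicator {0..t} r *\<^sub>R weighted_energy g r (a' r))"
    unfolding a'_def by (rule carre_du_champ_eq[OF lf' u g])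
  have cost: "add_one_cost (s, ?p) (carre_du_champ \<epsilon> u0 g t) \<eta>
      = (LINT r|lborel. indicator {0..t} r *\<^sub>R weighted_energy g r (a' r) - indicator {0..t} r *\<^sub>R weighted_energy g r (a r))"
    unfolding add_one_cost_def \<eta>'_def[symmetric] carre carre' unfolding a_def a'_def
    by (intro Bochner_Integration.integral_diff[symmetric] integrable_weighted_energy[OF lf u g] integrable_weighted_energy[OF lf' u g])
  have "\<bar>add_one_cost (s, ?p) (carre_du_champ \<epsilon> u0 g t) \<eta>\<bar> \<le> (LINT r|lborel. ?I r)"
    unfolding cost
  proof (rule integral_abs_bound_integral)
    show "integrable lborel (\<lambda>r. indicator {0..t} r *\<^sub>R weighted_energy g r (a' r) - indicator {0..t} r *\<^sub>R weighted_energy g r (a r))"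
      unfolding a_def a'_def
      by (intro Bochner_Integration.integrable_diff integrable_weighted_energy[OF lf u g] integrable_weighted_energy[OF lf' u g])
    show "integrable lborel ?I"
      by (intro Bochner_Integration.integrable_sum integrable_scaleR_right ind)
    show "\<bar>indicator {0..t} r *\<^sub>R weighted_energy g r (a' r) - indicator {0..t} r *\<^sub>R weighted_energy g r (a r)\<bar> \<le> ?I r" for r
    proof (cases "r \<in> {0..t}")
      case True
      have "\<bar>weighted_energy g r (a' r) - weighted_energy g r (a r)\<bar> \<le> ?E * (B * D r)"
        unfolding D_def using True by (intro weighted_energy_diff_le B) auto
      also have "\<dots> \<le> ?E * B * (\<Sum>k<m. c k * indicator {\<tau> k<..\<tau> (Suc k)} r)"
        using D_le[of r] True mult_left_mono[OF _ E0] by (simp add: mult.assoc)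
      also have "\<dots> = ?I r"
        unfolding sum_distrib_left by (simp only: real_scaleR_def mult.assoc)
      finally show ?thesis using True by simp
    next
      case False
      have "0 \<le> ?I r"
        by (intro sum_nonneg scaleR_nonneg_nonneg mult_nonneg_nonneg[OF E0 c_nonneg]) simp
      moreover have "indicator {0..t} r = (0::real)" using False by (rule indicator_simps(2))
      ultimately show ?thesis by (simp only: scaleR_zero_left diff_zero abs_zero)
    qed
  qed
  also have "\<dots> = (\<Sum>k<m. ?E * B * c k * \<Delta>)"
  proof -
    have "(LINT r|lborel. ?I r) = (\<Sum>k<m. (LINT r|lborel. (?E * B * c k) *\<^sub>R (indicator {\<tau> k<..\<tau> (Suc k)} r :: real)))"
      by (intro Bochner_Integration.integral_sum integrable_scaleR_right ind)
    also have "\<dots> = (\<Sum>k<m. ?E * B * c k * \<Delta>)"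
    proof (rule sum.cong[OF refl])
      fix k
      have "\<tau> (Suc k) - \<tau> k = \<Delta>" by (simp add: \<tau>_def algebra_simps)
      then show "(LINT r|lborel. (?E * B * c k) *\<^sub>R (indicator {\<tau> k<..\<tau> (Suc k)} r :: real)) = ?E * B * c k * \<Delta>"
        using \<tau>_Suc[of k] by simp
    qed
    finally show ?thesis .
  qed
  also have "\<dots> = ?E * B * \<Delta> * (\<Sum>k<m. c k)"
    unfolding sum_distrib_left by (rule sum.cong) (simp_all only: ac_simps)
  also have "\<dots> \<le> ?E * B * \<Delta> * (2 * (\<Sum>l\<le>L. h l))"
  proof (rule mult_left_mono)
    show "(\<Sum>k<m. c k) \<le> 2 * (\<Sum>l\<le>L. h l)"
      unfolding m by (rule sum_lessThan_consecutive_le) (auto simp: c_def h_def)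
    show "0 \<le> ?E * B * \<Delta>" using mult_nonneg_nonneg[OF E0, of \<Delta>] \<Delta> by simp
  qed
  also have "\<dots> = ?E * B * (2 * \<Delta>) * (\<Sum>l\<le>L. h l)" by simp
  finally show ?thesis
    by (simp only: response_def h_def v_def take_word)
qed

end

section \<open>The law of the updates on a time grid\<close>

locale poisson_mesh = torus_mesh \<epsilon> n V for \<epsilon> n and V :: "(real^'d::finite) set" +
  fixes P :: "'d config measure" and \<Delta> :: real and m :: nat
  assumes clocks: "poisson_clocks \<epsilon> P" and \<Delta>_pos: "0 < \<Delta>" and m_pos: "0 < m"
begin

sublocale prob_space P
  using clocks by (simp add: poisson_clocks_def)

text \<open>Indexed by slot and bond together, so that all counts form one independent
  family.\<close>

definition count :: "nat \<times> ((real^'d) \<times> 'd) \<Rightarrow> 'd config \<Rightarrow> nat" where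
  "count kp \<eta> = slot_count \<eta> (real (fst kp) * \<Delta>) (real (Suc (fst kp)) * \<Delta>) (snd kp)"

definition intensity :: real where
  "intensity = \<Delta> / \<epsilon>\<^sup>2"

definition total_intensity :: real where
  "total_intensity = real (card bonds) * intensity"

lemma intensity_pos: "0 < intensity"
  using \<Delta>_pos eps_pos by (simp add: intensity_def)

lemma total_intensity_nonneg: "0 \<le> total_intensity"
  using intensity_pos by (simp add: total_intensity_def)

lemma AE_locally_finite: "AE \<eta> in P. locally_finite_config \<epsilon> \<eta>"
  using clocks by (simp add: poisson_clocks_def)

lemma clock:
  "p \<in> bonds \<Longrightarrow> poisson_process P (1 / \<epsilon>\<^sup>2) (arrival_count (fst p) (snd p))"
  using clocks by (auto simp: poisson_clocks_def bonds_def V_def[symmetric])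

lemma indep_counts_bond:
  assumes "p \<in> bonds"
  shows "indep_vars (\<lambda>_. count_space UNIV) (\<lambda>k. count (k, p)) {..<m}"
proof -
  have mono: "strict_mono_on {..m} (\<lambda>k. real k * \<Delta>)"
    using \<Delta>_pos by (auto simp: strict_mono_on_def)
  have "\<forall>n \<tau>. 0 \<le> \<tau> 0 \<longrightarrow> strict_mono_on {..n} \<tau> \<longrightarrow> indep_vars (\<lambda>_. count_space UNIV)
      (\<lambda>k \<eta>. arrival_count (fst p) (snd p) (\<tau> (Suc k)) \<eta> - arrival_count (fst p) (snd p) (\<tau> k) \<eta>) {..<n}"
    using clock[OF assms] by (simp add: poisson_process_def)
  from this[rule_format, of "\<lambda>k. real k * \<Delta>", OF _ mono]
  show ?thesis by (simp add: count_def[abs_def] slot_count_def)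
qed

lemma measurable_count [measurable]:
  "k < m \<Longrightarrow> p \<in> bonds \<Longrightarrow> count (k, p) \<in> measurable P (count_space UNIV)"
  using indep_counts_bond[of p] by (auto simp: indep_vars_def)

lemma prob_count:
  assumes k: "k < m" and p: "p \<in> bonds"
  shows "prob (count (k, p) -` {c} \<inter> space P) = intensity ^ c / fact c * exp (- intensity)"
proof -
  have "distr P (count_space UNIV) (count (k, p)) = measure_pmf (poisson_pmf (1 / \<epsilon>\<^sup>2 * (real (Suc k) * \<Delta> - real k * \<Delta>)))"
    using clock[OF p] \<Delta>_pos unfolding poisson_process_def count_def[abs_def] slot_count_def by simp
  also have "1 / \<epsilon>\<^sup>2 * (real (Suc k) * \<Delta> - real k * \<Delta>) = intensity"
    by (simp add: intensity_def algebra_simps)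
  finally have "measure (distr P (count_space UNIV) (count (k, p))) {c} = pmf (poisson_pmf intensity) c"
    by (simp add: pmf.rep_eq)
  then show ?thesis
    using measurable_count[OF k p] intensity_pos by (simp add: measure_distr)
qed

text \<open>The clocks provide independence of whole paths for different bonds and independence of
  increments for a single bond. An event on all counts is an intersection over bonds of events of
  one path; it factors first over bonds and then over slots.\<close>

lemma indep_counts: "indep_vars (\<lambda>_. count_space UNIV) count ({..<m} \<times> bonds)"
proof (subst indep_vars_finite[where E = "\<lambda>_. UNIV"])
  have "(0, p) \<in> {..<m} \<times> bonds" if "p \<in> bonds" for p using that m_pos by simp
  moreover have "bonds \<noteq> {}" using zero_in_lattice by (auto simp: bonds_def)
  ultimately show "{..<m} \<times> bonds \<noteq> {}" by blast
  show "\<forall>A\<in>{..<m} \<times> bonds \<rightarrow> UNIV. prob (\<Inter>kp\<in>{..<m} \<times> bonds. count kp -` A kp \<inter> space P) =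
      (\<Prod>kp\<in>{..<m} \<times> bonds. prob (count kp -` A kp \<inter> space P))"
  proof
    fix A :: "nat \<times> (real^'d) \<times> 'd \<Rightarrow> nat set"
    define path where "path p \<eta> = (\<lambda>t\<in>{0..}. arrival_count (fst p) (snd p) t \<eta>)" for p :: "(real^'d) \<times> 'd" and \<eta> :: "'d config"
    let ?M = "\<Pi>\<^sub>M t\<in>{0::real..}. count_space (UNIV::nat set)"
    \<comment> \<open>The condition on the counts of \<open>p\<close>, expressed as an event in the
      path space of its clock.\<close>
    define E where "E p = {\<omega> \<in> space ?M. \<forall>k<m. \<omega> (real (Suc k) * \<Delta>) - \<omega> (real k * \<Delta>) \<in> A (k, p)}" for p
    have indep: "indep_vars (\<lambda>_. ?M) path bonds"
      using clocks unfolding poisson_clocks_def bonds_def V_def[symmetric] path_def[abs_def]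
      by (simp add: case_prod_beta')
    have E: "E p \<in> sets ?M" for p
    proof -
      have comp: "(\<lambda>\<omega>. \<omega> t) \<in> measurable ?M (count_space UNIV)" if "0 \<le> t" for t
        using that by (intro measurable_component_singleton) auto
      have "(\<lambda>\<omega>. \<omega> (real (Suc k) * \<Delta>) - \<omega> (real k * \<Delta>)) \<in> measurable ?M (count_space UNIV)" for k
      proof -
        have "(\<lambda>\<omega>. (\<omega> (real (Suc k) * \<Delta>), \<omega> (real k * \<Delta>))) \<in> measurable ?M (count_space UNIV \<Otimes>\<^sub>M count_space UNIV)"
          using \<Delta>_pos by (intro measurable_Pair comp) auto
        then have "(\<lambda>\<omega>. (\<omega> (real (Suc k) * \<Delta>), \<omega> (real k * \<Delta>))) \<in> measurable ?M (count_space UNIV)"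
          by (simp add: pair_measure_countable)
        from measurable_compose[OF this, of "\<lambda>(a, b). a - b" "count_space UNIV"]
        show ?thesis by simp
      qed
      then have "(\<lambda>\<omega>. \<omega> (real (Suc k) * \<Delta>) - \<omega> (real k * \<Delta>)) -` A (k, p) \<inter> space ?M \<in> sets ?M" for k
        by (rule measurable_sets) simp
      then have "(\<Inter>k\<in>{..<m}. (\<lambda>\<omega>. \<omega> (real (Suc k) * \<Delta>) - \<omega> (real k * \<Delta>)) -` A (k, p) \<inter> space ?M) \<in> sets ?M"
        using m_pos by (intro sets.finite_INT) auto
      also have "(\<Inter>k\<in>{..<m}. (\<lambda>\<omega>. \<omega> (real (Suc k) * \<Delta>) - \<omega> (real k * \<Delta>)) -` A (k, p) \<inter> space ?M) = E p"
        using m_pos by (auto simp: E_def)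
      finally show ?thesis .
    qed
    have vim: "path p -` E p \<inter> space P = (\<Inter>k\<in>{..<m}. count (k, p) -` A (k, p) \<inter> space P)" for p
    proof -
      have "path p \<eta> \<in> space ?M" for \<eta> by (simp add: path_def space_PiM)
      moreover have "path p \<eta> (real k * \<Delta>) = arrival_count (fst p) (snd p) (real k * \<Delta>) \<eta>" for \<eta> k
        using \<Delta>_pos by (simp add: path_def)
      moreover have "path p \<eta> (real (Suc k) * \<Delta>) = arrival_count (fst p) (snd p) (real (Suc k) * \<Delta>) \<eta>" for \<eta> k
        using \<Delta>_pos by (simp add: path_def)
      ultimately show ?thesis
        using m_pos by (auto simp: E_def count_def slot_count_def simp del: of_nat_Suc)
    qed
    have "(\<Inter>kp\<in>{..<m} \<times> bonds. count kp -` A kp \<inter> space P) = (\<Inter>p\<in>bonds. path p -` E p \<inter> space P)"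
      unfolding vim by blast
    also have "prob \<dots> = (\<Prod>p\<in>bonds. prob (path p -` E p \<inter> space P))"
      using E \<open>bonds \<noteq> {}\<close> by (intro indep_varsD_finite[OF indep]) auto
    also have "\<dots> = (\<Prod>p\<in>bonds. \<Prod>k<m. prob (count (k, p) -` A (k, p) \<inter> space P))"
    proof (rule prod.cong[OF refl])
      fix p assume "p \<in> bonds"
      then show "prob (path p -` E p \<inter> space P) = (\<Prod>k<m. prob (count (k, p) -` A (k, p) \<inter> space P))"
        unfolding vim using m_pos by (intro indep_varsD_finite[OF indep_counts_bond]) auto
    qed
    also have "\<dots> = (\<Prod>kp\<in>{..<m} \<times> bonds. prob (count kp -` A kp \<inter> space P))"
      by (subst prod.swap) (simp add: prod.cartesian_product case_prod_beta)
    finally show "prob (\<Inter>kp\<in>{..<m} \<times> bonds. count kp -` A kp \<inter> space P) =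
      (\<Prod>kp\<in>{..<m} \<times> bonds. prob (count kp -` A kp \<inter> space P))" .
  qed
qed (auto simp: Int_stable_def sigma_sets_into_sp intro: measurable_count)

section \<open>The law of a single letter\<close>

definition step :: "nat \<Rightarrow> 'd config \<Rightarrow> ((real^'d) \<times> 'd) option" where
  "step k \<eta> = update_of_counts (slot_count \<eta> (real k * \<Delta>) (real (Suc k) * \<Delta>))"

lemma step_updates: "step k \<eta> \<in> updates"
  by (simp add: step_def update_of_counts_updates)

lemma slot_word_eq: "slot_word \<Delta> m \<eta> = map (\<lambda>k. step k \<eta>) [0..<m]"
  by (simp add: slot_word_def step_def)

text \<open>Product spaces over \<open>bonds\<close> deliver restricted functions, whose values
  elsewhere are \<open>undefined\<close>; these do not influence the letter.\<close>

lemma update_of_counts_restrict: "update_of_counts (restrict c bonds) = update_of_counts c"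
proof -
  have "update_of_counts c' = Some p \<longleftrightarrow> update_of_counts c = Some p" if "p \<in> bonds" "c' = restrict c bonds" for p c'
    unfolding update_of_counts_Some_iff[OF that(1)] using that by auto
  then have "\<And>p. p \<in> bonds \<Longrightarrow> update_of_counts (restrict c bonds) = Some p \<longleftrightarrow> update_of_counts c = Some p" by blast
  with update_of_counts_updates[of c] update_of_counts_updates[of "restrict c bonds"] show ?thesis
    unfolding updates_def by (metis imageE insertE)
qed

text \<open>The letter of slot \<open>k\<close> is a function of the block of counts with first
  index \<open>k\<close>, and different blocks are disjoint. A finite product of discrete spaces is
  discrete, so every such function is measurable.\<close>

lemma indep_steps: "indep_vars (\<lambda>_. count_space UNIV) step {..<m}"
proof -
  have "indep_vars (\<lambda>k. PiM ({k} \<times> bonds) (\<lambda>_. count_space UNIV)) (\<lambda>k \<eta>. restrict (\<lambda>kp. count kp \<eta>) ({k} \<times> bonds)) {..<m}"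
    by (rule indep_vars_restrict[OF indep_counts]) (auto simp: disjoint_family_on_def)
  then have "indep_vars (\<lambda>_. count_space UNIV)
      (\<lambda>k \<eta>. update_of_counts (\<lambda>p. restrict (\<lambda>kp. count kp \<eta>) ({k} \<times> bonds) (k, p))) {..<m}"
  proof (rule indep_vars_compose2[where Y = "\<lambda>k f. update_of_counts (\<lambda>p. f (k, p))"])
    fix k
    have "PiM ({k} \<times> bonds) (\<lambda>_. count_space (UNIV::nat set)) = count_space (PiE ({k} \<times> bonds) (\<lambda>_. UNIV))"
      by (intro count_space_PiM_finite) auto
    then show "(\<lambda>f. update_of_counts (\<lambda>p. f (k, p))) \<in> measurable (PiM ({k} \<times> bonds) (\<lambda>_. count_space (UNIV::nat set))) (count_space UNIV)"
      by simp
  qed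
  moreover have "update_of_counts (\<lambda>p. restrict (\<lambda>kp. count kp \<eta>) ({k} \<times> bonds) (k, p)) = step k \<eta>" for k \<eta>
  proof -
    have "restrict (\<lambda>p. restrict (\<lambda>kp. count kp \<eta>) ({k} \<times> bonds) (k, p)) bonds
        = restrict (slot_count \<eta> (real k * \<Delta>) (real (Suc k) * \<Delta>)) bonds"
      by (auto simp: count_def restrict_def)
    then show ?thesis
      unfolding step_def by (metis update_of_counts_restrict)
  qed
  ultimately show ?thesis by simp
qed

lemma measurable_step: "k < m \<Longrightarrow> step k \<in> measurable P (count_space UNIV)"
  using indep_steps by (auto simp: indep_vars_def)

lemma prob_counts:
  assumes k: "k < m"
  shows "prob {\<eta> \<in> space P. \<forall>p\<in>bonds. count (k, p) \<eta> = c p}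
    = (\<Prod>p\<in>bonds. intensity ^ c p / fact (c p) * exp (- intensity))"
proof -
  have ne: "{k} \<times> bonds \<noteq> {}" using zero_in_lattice by (auto simp: bonds_def)
  have "{\<eta> \<in> space P. \<forall>p\<in>bonds. count (k, p) \<eta> = c p}
      = (\<Inter>kp\<in>{k} \<times> bonds. count kp -` {c (snd kp)} \<inter> space P)"
    using ne by auto
  also have "prob \<dots> = (\<Prod>kp\<in>{k} \<times> bonds. prob (count kp -` {c (snd kp)} \<inter> space P))"
    using ne k by (intro indep_varsD[OF indep_counts]) auto
  also have "\<dots> = (\<Prod>p\<in>bonds. prob (count (k, p) -` {c p} \<inter> space P))"
    by (rule prod.reindex_bij_witness[of _ "\<lambda>p. (k, p)" snd]) auto
  also have "\<dots> = (\<Prod>p\<in>bonds. intensity ^ c p / fact (c p) * exp (- intensity))"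
    by (intro prod.cong refl prob_count k)
  finally show ?thesis .
qed

text \<open>The probability that a given bond rings exactly once in a slot while all others stay
  silent; it is the \<open>q\<close> of the abstract chain.\<close>

definition rate :: real where
  "rate = intensity * exp (- total_intensity)"

lemma exp_total: "(\<Prod>p\<in>bonds. exp (- intensity)) = exp (- total_intensity)"
  by (simp add: total_intensity_def exp_of_nat_mult[symmetric])

lemma prob_no_arrival:
  assumes "k < m"
  shows "prob {\<eta> \<in> space P. \<forall>p\<in>bonds. count (k, p) \<eta> = 0} = exp (- total_intensity)"
  using prob_counts[OF assms, of "\<lambda>_. 0"] by (simp add: exp_total[symmetric])

lemma prob_step_Some:
  assumes k: "k < m" and p: "p \<in> bonds"
  shows "prob {\<eta> \<in> space P. step k \<eta> = Some p} = rate"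
proof -
  let ?c = "\<lambda>p'. if p' = p then 1 else 0"
  have "{\<eta> \<in> space P. step k \<eta> = Some p} = {\<eta> \<in> space P. \<forall>p'\<in>bonds. count (k, p') \<eta> = ?c p'}"
    unfolding step_def update_of_counts_Some_iff[OF p] using p by (auto simp: count_def)
  also have "prob \<dots> = (\<Prod>p'\<in>bonds. intensity ^ ?c p' / fact (?c p') * exp (- intensity))"
    by (rule prob_counts[OF k])
  also have "\<dots> = (\<Prod>p'\<in>bonds. (if p' = p then intensity else 1) * exp (- intensity))"
    by (rule prod.cong) auto
  also have "\<dots> = rate"
    unfolding prod.distrib exp_total using p by (simp add: rate_def)
  finally show ?thesis .
qed

text \<open>Computed as a complement, so that slots with several arrivals are included.\<close>

lemma prob_step_None:
  assumes k: "k < m"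
  shows "prob {\<eta> \<in> space P. step k \<eta> = None} = 1 - rate * real (card bonds)"
proof -
  let ?E = "\<lambda>o'. {\<eta> \<in> space P. step k \<eta> = o'}"
  have E: "?E o' \<in> events" for o'
    using measurable_sets[OF measurable_step[OF k], of "{o'}"] by (simp add: vimage_def Int_def conj_commute)
  have "space P = (\<Union>o'\<in>updates. ?E o')" using step_updates by auto
  then have "1 = prob (\<Union>o'\<in>updates. ?E o')" using prob_space by simp
  also have "\<dots> = (\<Sum>o'\<in>updates. prob (?E o'))"
    using E by (intro finite_measure_finite_Union) (auto simp: updates_def disjoint_family_on_def)
  also have "\<dots> = prob (?E None) + (\<Sum>p\<in>bonds. prob (?E (Some p)))"
    unfolding updates_def by (subst sum.insert) (auto simp: sum.reindex)
  also have "(\<Sum>p\<in>bonds. prob (?E (Some p))) = rate * real (card bonds)"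
    using prob_step_Some[OF k] by (simp add: mult.commute)
  finally show ?thesis by simp
qed

sublocale averaging_chain \<epsilon> n V rate
proof
  show "0 < rate" using intensity_pos by (simp add: rate_def)
  have "total_intensity \<le> exp total_intensity" using exp_ge_add_one_self[of total_intensity] by linarith
  then have "total_intensity * exp (- total_intensity) \<le> exp total_intensity * exp (- total_intensity)"
    by (rule mult_right_mono) simp
  then show "rate * real (card bonds) \<le> 1"
    by (simp add: rate_def total_intensity_def exp_add[symmetric] ac_simps)
qed

end

section \<open>Moments of the response\<close>

context averaging_chain
begin

text \<open>The law of one letter, through which the iterated sum \<open>expect\<close> is compared
  with the law of the grid word.\<close>

definition weight :: "((real^'d) \<times> 'd) option \<Rightarrow> real" where
  "weight o' = (case o' of None \<Rightarrow> 1 - q * real (card bonds) | Some p \<Rightarrow> q)"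

definition words :: "nat \<Rightarrow> ((real^'d) \<times> 'd) option list set" where
  "words m = {w. set w \<subseteq> updates \<and> length w = m}"

lemma finite_updates [simp]: "finite updates"
  by (simp add: updates_def)

lemma finite_words [simp]: "finite (words m)"
  unfolding words_def by (rule finite_lists_length_eq) simp

lemma weight_nonneg: "0 \<le> weight o'"
  using q_pos q_le by (auto simp: weight_def split: option.split)

lemma expect1_eq_sum: "expect1 F = (\<Sum>o'\<in>updates. weight o' * F o')"
  unfolding updates_def expect1_def
  by (subst sum.insert) (auto simp: sum.reindex weight_def sum_distrib_left)

lemma expect_eq_sum: "expect m F = (\<Sum>w\<in>words m. prod_list (map weight w) * F w)"
proof (induction m arbitrary: F)
  case 0
  have "words 0 = {[]}" by (auto simp: words_def)
  then show ?case by simp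
next
  case (Suc m)
  have "words (Suc m) = (\<lambda>(w, o'). o' # w) ` (words m \<times> updates)"
    unfolding words_def by (rule lists_length_Suc_eq)
  moreover have "inj_on (\<lambda>x. snd x # fst x) (words m \<times> updates)" by (auto simp: inj_on_def)
  ultimately have "(\<Sum>w\<in>words (Suc m). prod_list (map weight w) * F w)
      = (\<Sum>(w, o')\<in>words m \<times> updates. weight o' * prod_list (map weight w) * F (o' # w))"
    by (simp add: sum.reindex case_prod_beta comp_def)
  also have "\<dots> = (\<Sum>w\<in>words m. \<Sum>o'\<in>updates. weight o' * prod_list (map weight w) * F (o' # w))"
    by (simp add: sum.cartesian_product)
  also have "\<dots> = (\<Sum>o'\<in>updates. \<Sum>w\<in>words m. weight o' * prod_list (map weight w) * F (o' # w))"
    by (rule sum.swap)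
  also have "\<dots> = expect (Suc m) F"
    by (simp add: Suc.IH expect1_eq_sum sum_distrib_left mult.assoc)
  finally show ?case ..
qed

text \<open>Integrates out the letter of the insertion slot. Off the exceptional event that letter
  is \<open>None\<close>, and dropping it avoids conditioning on this.\<close>

lemma expect_ignore: "expect (Suc L) (\<lambda>w. F (drop (Suc 0) w)) = expect L F"
  by simp

text \<open>Given the first \<open>j\<close> letters, the response starts from a dipole of strength
  \<open>bond_grad p\<close> and from a sum of two configurations bounded by \<open>U\<close>,
  whence \<open>2 * U\<close>. The bound is quadratic in the strength, so summing over all bonds
  produces the energy before the insertion.\<close>

lemma sum_expect_response_sq_le:
  fixes \<kappa> :: nat
  assumes R: "1 \<le> R" "R \<le> n" and u: "\<And>x. x \<in> V \<Longrightarrow> \<bar>u x\<bar> \<le> U"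
  defines "\<theta> \<equiv> 2 / real R ^ CARD('d) + exp (- real \<kappa> * q / (16 * (real CARD('d) * real R)\<^sup>2))"
  shows "(\<Sum>p\<in>bonds. expect (Suc (j + L)) (\<lambda>w. (response (run (take j w) u) p L (drop (Suc j) w))\<^sup>2))
    \<le> (32 * (real CARD('d))\<^sup>2 * (real \<kappa>)\<^sup>2 + 64 * (real CARD('d))\<^sup>2 * real (card V) * \<theta> / q\<^sup>2) * (2 * U)\<^sup>2
       * expect j (\<lambda>w. energy (run w u))"
  (is "_ \<le> ?C * (2 * U)\<^sup>2 * _")
proof -
  have step: "expect (Suc (j + L)) (\<lambda>w. (response (run (take j w) u) p L (drop (Suc j) w))\<^sup>2)
      \<le> expect j (\<lambda>w. ?C * (2 * U)\<^sup>2 * (bond_grad p (run w u))\<^sup>2)" if p: "p \<in> bonds" for p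
  proof -
    have "expect (Suc (j + L)) (\<lambda>w. (response (run (take j w) u) p L (drop (Suc j) w))\<^sup>2)
        = expect j (\<lambda>w1. expect (Suc L) (\<lambda>w2. (response (run (take j (w1 @ w2)) u) p L (drop (Suc j) (w1 @ w2)))\<^sup>2))"
      unfolding add_Suc_right[symmetric] by (rule expect_append)
    also have "\<dots> \<le> expect j (\<lambda>w. ?C * (2 * U)\<^sup>2 * (bond_grad p (run w u))\<^sup>2)"
    proof (rule expect_mono)
      fix w1 :: "((real^'d) \<times> 'd) option list"
      assume w1: "set w1 \<subseteq> updates" "length w1 = j"
      let ?v = "run w1 u"
      let ?\<delta> = "\<lambda>x. average_pair \<epsilon> p ?v x - ?v x" and ?w = "\<lambda>x. average_pair \<epsilon> p ?v x + ?v x"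
      have v: "\<bar>?v x\<bar> \<le> U" if "x \<in> V" for x by (rule run_bound[OF w1(1) u that])
      have "expect (Suc L) (\<lambda>w2. (response (run (take j (w1 @ w2)) u) p L (drop (Suc j) (w1 @ w2)))\<^sup>2)
          = expect (Suc L) (\<lambda>w2. (response ?v p L (drop (Suc 0) w2))\<^sup>2)"
        using w1(2) by simp
      also have "\<dots> = expect L (\<lambda>w2. (response ?v p L w2)\<^sup>2)"
        by (rule expect_ignore)
      also have "\<dots> \<le> 32 * (real CARD('d))\<^sup>2 * (\<bar>bond_grad p ?v\<bar> * (2 * U))\<^sup>2 * (real \<kappa>)\<^sup>2
          + 64 * (real CARD('d))\<^sup>2 * (\<bar>bond_grad p ?v\<bar> * (2 * U))\<^sup>2 * real (card V) * \<theta> / q\<^sup>2"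
        unfolding response_def \<theta>_def
      proof (rule expect_cross_energy_sq_le[OF R])
        show "l1 ?\<delta> \<le> \<bar>bond_grad p ?v\<bar>" by (simp add: l1_dipole[OF p])
        show "l2 ?\<delta> \<le> \<bar>bond_grad p ?v\<bar>\<^sup>2" by (simp add: l2_dipole[OF p])
        show "\<bar>?w x\<bar> \<le> 2 * U" if "x \<in> V" for x
        proof -
          have "\<bar>average_pair \<epsilon> p ?v x\<bar> \<le> U" by (rule average_pair_bound[OF p _ that]) (rule v)
          with v[OF that] show ?thesis by linarith
        qed
      qed
      also have "\<dots> = ?C * (2 * U)\<^sup>2 * (bond_grad p ?v)\<^sup>2"
        by (simp add: power_mult_distrib algebra_simps add_divide_distrib)
      finally show "expect (Suc L) (\<lambda>w2. (response (run (take j (w1 @ w2)) u) p L (drop (Suc j) (w1 @ w2)))\<^sup>2)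
          \<le> ?C * (2 * U)\<^sup>2 * (bond_grad p (run w1 u))\<^sup>2" .
    qed
    finally show ?thesis .
  qed
  have "(\<Sum>p\<in>bonds. expect (Suc (j + L)) (\<lambda>w. (response (run (take j w) u) p L (drop (Suc j) w))\<^sup>2))
      \<le> (\<Sum>p\<in>bonds. expect j (\<lambda>w. ?C * (2 * U)\<^sup>2 * (bond_grad p (run w u))\<^sup>2))"
    by (intro sum_mono step)
  also have "\<dots> = expect j (\<lambda>w. \<Sum>p\<in>bonds. ?C * (2 * U)\<^sup>2 * (bond_grad p (run w u))\<^sup>2)"
    by (rule expect_sum[symmetric]) simp
  also have "\<dots> = expect j (\<lambda>w. ?C * (2 * U)\<^sup>2 * energy (run w u))"
    by (simp only: energy_def sum_distrib_left)
  also have "\<dots> = ?C * (2 * U)\<^sup>2 * expect j (\<lambda>w. energy (run w u))"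
    by (rule expect_cmult)
  finally show ?thesis .
qed

end

section \<open>Transfer of the chain estimates to the Poisson clocks\<close>

context poisson_mesh
begin

lemma events_step: "k < m \<Longrightarrow> {\<eta> \<in> space P. step k \<eta> = o'} \<in> events"
  using measurable_sets[OF measurable_step, of k "{o'}"] by (simp add: vimage_def Int_def conj_commute)

lemma prob_slot_word:
  assumes w: "w \<in> words m"
  shows "{\<eta> \<in> space P. slot_word \<Delta> m \<eta> = w} \<in> events" (is "?E \<in> _")
    and "prob {\<eta> \<in> space P. slot_word \<Delta> m \<eta> = w} = prod_list (map weight w)"
proof -
  have len: "length w = m" and up: "set w \<subseteq> updates" using w by (auto simp: words_def)
  have eq: "?E = (\<Inter>k\<in>{..<m}. step k -` {w ! k} \<inter> space P)"
    using m_pos len by (auto simp: slot_word_eq list_eq_iff_nth_eq)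
  have ev: "step k -` {w ! k} \<inter> space P = {\<eta> \<in> space P. step k \<eta> = w ! k}" for k by auto
  show "?E \<in> events"
    unfolding eq ev using m_pos by (intro sets.finite_INT events_step) auto
  have "prob ?E = (\<Prod>k<m. prob (step k -` {w ! k} \<inter> space P))"
    unfolding eq using m_pos by (intro indep_varsD_finite[OF indep_steps]) auto
  also have "\<dots> = (\<Prod>k<m. weight (w ! k))"
  proof (rule prod.cong[OF refl])
    fix k assume "k \<in> {..<m}"
    then have k: "k < m" "w ! k \<in> updates" using up len by (auto simp: subset_iff)
    then consider "w ! k = None" | p where "p \<in> bonds" "w ! k = Some p" by (auto simp: updates_def)
    then show "prob (step k -` {w ! k} \<inter> space P) = weight (w ! k)"
      unfolding ev using k(1) by cases (simp_all add: prob_step_None prob_step_Some weight_def)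
  qed
  also have "\<dots> = prod_list (map weight w)"
    using len by (simp add: prod.list_conv_set_nth atLeast0LessThan)
  finally show "prob ?E = prod_list (map weight w)" .
qed

lemma slot_word_in_words: "slot_word \<Delta> m \<eta> \<in> words m"
  using step_updates by (auto simp: words_def slot_word_eq)

lemma nn_integral_slot_word:
  assumes F: "\<And>w. 0 \<le> F w"
  shows "(\<lambda>\<eta>. ennreal (F (slot_word \<Delta> m \<eta>))) \<in> borel_measurable P"
    and "(\<integral>\<^sup>+ \<eta>. ennreal (F (slot_word \<Delta> m \<eta>)) \<partial>P) = ennreal (expect m F)"
proof -
  let ?E = "\<lambda>w. {\<eta> \<in> space P. slot_word \<Delta> m \<eta> = w}"
  have eq: "ennreal (F (slot_word \<Delta> m \<eta>)) = (\<Sum>w\<in>words m. ennreal (F w) * indicator (?E w) \<eta>)" if "\<eta> \<in> space P" for \<eta>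
  proof -
    have "(\<Sum>w\<in>words m. ennreal (F w) * indicator (?E w) \<eta>)
        = (\<Sum>w\<in>words m. if w = slot_word \<Delta> m \<eta> then ennreal (F w) else 0)"
      using that by (intro sum.cong) (auto simp: indicator_def)
    then show ?thesis using slot_word_in_words[of \<eta>] by simp
  qed
  have meas: "(\<lambda>\<eta>. \<Sum>w\<in>words m. ennreal (F w) * indicator (?E w) \<eta>) \<in> borel_measurable P"
    using prob_slot_word(1) by (intro borel_measurable_sum borel_measurable_times_ennreal borel_measurable_const borel_measurable_indicator)
  then show "(\<lambda>\<eta>. ennreal (F (slot_word \<Delta> m \<eta>))) \<in> borel_measurable P"
    by (rule measurable_cong[THEN iffD2, rotated]) (rule eq)
  have "(\<integral>\<^sup>+ \<eta>. ennreal (F (slot_word \<Delta> m \<eta>)) \<partial>P) = (\<integral>\<^sup>+ \<eta>. (\<Sum>w\<in>words m. ennreal (F w) * indicator (?E w) \<eta>) \<partial>P)"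
    by (rule nn_integral_cong) (rule eq)
  also have "\<dots> = (\<Sum>w\<in>words m. \<integral>\<^sup>+ \<eta>. ennreal (F w) * indicator (?E w) \<eta> \<partial>P)"
    using prob_slot_word(1)
    by (intro nn_integral_sum borel_measurable_times_ennreal borel_measurable_const borel_measurable_indicator)
  also have "\<dots> = (\<Sum>w\<in>words m. ennreal (prod_list (map weight w) * F w))"
  proof (rule sum.cong[OF refl])
    fix w assume w: "w \<in> words m"
    show "(\<integral>\<^sup>+ \<eta>. ennreal (F w) * indicator (?E w) \<eta> \<partial>P) = ennreal (prod_list (map weight w) * F w)"
      using prob_slot_word[OF w] F[of w]
      by (simp add: nn_integral_cmult_indicator emeasure_eq_measure ennreal_mult'[symmetric] mult.commute)
  qed
  also have "\<dots> = ennreal (\<Sum>w\<in>words m. prod_list (map weight w) * F w)"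
    using F by (intro sum_ennreal mult_nonneg_nonneg prod_list_nonneg) (auto simp: weight_nonneg)
  finally show "(\<integral>\<^sup>+ \<eta>. ennreal (F (slot_word \<Delta> m \<eta>)) \<partial>P) = ennreal (expect m F)"
    by (simp add: expect_eq_sum)
qed

section \<open>The exceptional event\<close>

definition arrivals :: "nat \<Rightarrow> 'd config \<Rightarrow> nat" where
  "arrivals k \<eta> = (\<Sum>p\<in>bonds. slot_count \<eta> (real k * \<Delta>) (real (Suc k) * \<Delta>) p)"

lemma arrivals_0_iff: "arrivals k \<eta> = 0 \<longleftrightarrow> (\<forall>p\<in>bonds. count (k, p) \<eta> = 0)"
  by (simp add: arrivals_def count_def)

lemma measurable_arrivals:
  assumes "k < m" shows "arrivals k \<in> measurable P (count_space UNIV)"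
proof -
  have "(\<lambda>\<eta>. \<Sum>p\<in>bonds. real (count (k, p) \<eta>)) \<in> borel_measurable P"
    using measurable_compose[OF measurable_count[OF assms], of _ real borel] by (intro borel_measurable_sum) auto
  then have "(\<lambda>\<eta>. nat \<lfloor>\<Sum>p\<in>bonds. real (count (k, p) \<eta>)\<rfloor>) \<in> measurable P (count_space UNIV)"
    by measurable
  moreover have "nat \<lfloor>\<Sum>p\<in>bonds. real (count (k, p) \<eta>)\<rfloor> = arrivals k \<eta>" for \<eta>
    by (simp add: arrivals_def count_def of_nat_sum[symmetric] del: of_nat_sum)
  ultimately show ?thesis by simp
qed

lemma events_arrivals: "k < m \<Longrightarrow> {\<eta> \<in> space P. arrivals k \<eta> \<in> A} \<in> events"
  using measurable_sets[OF measurable_arrivals, of k A] by (simp add: vimage_def Int_def conj_commute)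

text \<open>Several arrivals force the letter \<open>None\<close> without the slot being empty, and
  both probabilities are explicit. With \<tau> the total intensity, their difference 1 - (1 +
  \<tau>) exp (-\<tau>) is at most \<tau>^2 because exp (-\<tau>) \<ge> 1 - \<tau>.\<close>

lemma prob_multiple_arrivals:
  assumes k: "k < m"
  shows "prob {\<eta> \<in> space P. arrivals k \<eta> \<in> {1<..}} \<le> total_intensity\<^sup>2"
proof -
  let ?N = "{\<eta> \<in> space P. step k \<eta> = None}" and ?Z = "{\<eta> \<in> space P. arrivals k \<eta> \<in> {0}}"
  have Z_N: "?Z \<subseteq> ?N"
    by (auto simp: arrivals_def step_def update_of_counts_def)
  have "{\<eta> \<in> space P. arrivals k \<eta> \<in> {1<..}} \<subseteq> ?N - ?Z"
  proof safe
    fix \<eta> assume a: "1 < arrivals k \<eta>"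
    show "step k \<eta> = None"
    proof (rule ccontr)
      assume "step k \<eta> \<noteq> None"
      then obtain p where p: "p \<in> bonds" "step k \<eta> = Some p"
        using step_updates[of k \<eta>] by (auto simp: updates_def)
      let ?c = "slot_count \<eta> (real k * \<Delta>) (real (Suc k) * \<Delta>)"
      have "?c p = 1" "\<forall>p'\<in>bonds - {p}. ?c p' = 0"
        using p unfolding step_def update_of_counts_Some_iff[OF p(1)] by auto
      moreover have "arrivals k \<eta> = ?c p + (\<Sum>p'\<in>bonds - {p}. ?c p')"
        unfolding arrivals_def using p by (intro sum.remove) auto
      ultimately show False using a by simp
    qed
  qed simp_all
  then have "prob {\<eta> \<in> space P. arrivals k \<eta> \<in> {1<..}} \<le> prob (?N - ?Z)"
    by (intro finite_measure_mono sets.Diff events_step events_arrivals k)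
  also have "\<dots> = prob ?N - prob ?Z"
    by (intro finite_measure_Diff events_step events_arrivals k Z_N)
  also have "prob ?Z = exp (- total_intensity)"
    using prob_no_arrival[OF k] by (simp add: arrivals_0_iff)
  also have "prob ?N = 1 - total_intensity * exp (- total_intensity)"
    using prob_step_None[OF k] by (simp add: rate_def total_intensity_def ac_simps)
  also have "1 - total_intensity * exp (- total_intensity) - exp (- total_intensity) \<le> total_intensity\<^sup>2"
  proof -
    have "(1 - total_intensity) * (1 + total_intensity) \<le> exp (- total_intensity) * (1 + total_intensity)"
      using exp_ge_add_one_self[of "- total_intensity"] total_intensity_nonneg by (intro mult_right_mono) auto
    then show ?thesis by (simp add: power2_eq_square algebra_simps)
  qed
  finally show ?thesis .
qed

lemma prob_some_arrival:
  assumes k: "k < m"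
  shows "prob {\<eta> \<in> space P. arrivals k \<eta> \<in> {0<..}} \<le> total_intensity"
proof -
  let ?Z = "{\<eta> \<in> space P. arrivals k \<eta> \<in> {0}}"
  have "{\<eta> \<in> space P. arrivals k \<eta> \<in> {0<..}} = space P - ?Z" by auto
  then have "prob {\<eta> \<in> space P. arrivals k \<eta> \<in> {0<..}} = 1 - prob ?Z"
    using prob_compl[OF events_arrivals[OF k, of "{0}"]] by simp
  also have "prob ?Z = exp (- total_intensity)"
    using prob_no_arrival[OF k] by (simp add: arrivals_0_iff)
  finally show ?thesis using exp_ge_add_one_self[of "- total_intensity"] by simp
qed

text \<open>Outside this event every slot follows its letter and the inserted update is alone in
  slot \<open>j\<close>. The total intensity is of order 1/m, so even \<open>m\<close> slots with
  squared intensity contribute only O(1/m).\<close>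

definition bad :: "nat \<Rightarrow> 'd config set" where
  "bad j = (\<Union>k\<in>{..<m}. {\<eta> \<in> space P. arrivals k \<eta> \<in> {1<..}}) \<union> {\<eta> \<in> space P. arrivals j \<eta> \<in> {0<..}}"

lemma events_bad: "j < m \<Longrightarrow> bad j \<in> events"
  unfolding bad_def by (intro sets.Un sets.finite_UN events_arrivals) auto

lemma prob_bad:
  assumes j: "j < m"
  shows "prob (bad j) \<le> real m * total_intensity\<^sup>2 + total_intensity"
proof -
  have "prob (bad j) \<le> prob (\<Union>k\<in>{..<m}. {\<eta> \<in> space P. arrivals k \<eta> \<in> {1<..}}) + prob {\<eta> \<in> space P. arrivals j \<eta> \<in> {0<..}}"
    unfolding bad_def using j by (intro measure_Un_le sets.finite_UN events_arrivals) auto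
  also have "\<dots> \<le> (\<Sum>k<m. total_intensity\<^sup>2) + total_intensity"
  proof (intro add_mono prob_some_arrival[OF j] order_trans[OF finite_measure_subadditive_finite])
    show "(\<Sum>k<m. prob {\<eta> \<in> space P. arrivals k \<eta> \<in> {1<..}}) \<le> (\<Sum>k<m. total_intensity\<^sup>2)"
      by (intro sum_mono prob_multiple_arrivals) simp
  qed (auto intro: events_arrivals simp del: greaterThan_iff)
  finally show ?thesis by simp
qed

lemma AE_start: "AE \<eta> in P. \<forall>p. (0, p) \<notin> \<eta>"
proof -
  have "AE \<eta> in P. \<forall>p\<in>bonds. arrival_count (fst p) (snd p) 0 \<eta> = 0"
    using clock by (intro AE_finite_allI) (auto simp: poisson_process_def)
  with AE_locally_finite show ?thesis
  proof eventually_elim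
    case (elim \<eta>)
    show ?case
    proof (intro allI notI)
      fix p assume p: "(0, p) \<in> \<eta>"
      then have "p \<in> bonds" using config_bonds[OF elim(1)] by blast
      with elim(2) have "card {s. 0 \<le> s \<and> s \<le> 0 \<and> (s, fst p, snd p) \<in> \<eta>} = 0"
        by (simp add: arrival_count_def)
      moreover have "{s. 0 \<le> s \<and> s \<le> 0 \<and> (s, fst p, snd p) \<in> \<eta>} = {0 :: real}" using p by auto
      ultimately show False by simp
    qed
  qed
qed

lemma nn_integral_add_one_cost_le:
  assumes u: "\<And>x. x \<in> V \<Longrightarrow> \<bar>u0 x\<bar> \<le> U" and g: "\<And>i. time_torus_continuous (g i)"
    and B: "\<And>i r x. 0 \<le> r \<Longrightarrow> r \<le> t \<Longrightarrow> x \<in> V \<Longrightarrow> \<bar>g i r x\<bar> \<le> B"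
    and m: "m = Suc (j + L)" and t: "t = real m * \<Delta>"
    and s: "real j * \<Delta> < s" "s \<le> real (Suc j) * \<Delta>" and p: "(x, i) \<in> bonds"
  defines "a \<equiv> \<epsilon> ^ CARD('d) / \<epsilon>\<^sup>2 * B * (2 * \<Delta>)"
  defines "K \<equiv> 2 * (t * (\<epsilon> ^ CARD('d) / \<epsilon>\<^sup>2 * (real (card bonds) * ((2 * U)\<^sup>2 * B))))"
  shows "(\<integral>\<^sup>+ \<eta>. ennreal ((add_one_cost (s, x, i) (carre_du_champ \<epsilon> u0 g t) \<eta>)\<^sup>2) \<partial>P)
    \<le> ennreal (a\<^sup>2 * expect m (\<lambda>w. (response (run (take j w) (restrict u0 V)) (x, i) L (drop (Suc j) w))\<^sup>2)
        + K\<^sup>2 * (real m * total_intensity\<^sup>2 + total_intensity))"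
proof -
  let ?F = "\<lambda>w. (response (run (take j w) (restrict u0 V)) (x, i) L (drop (Suc j) w))\<^sup>2"
  let ?c = "\<lambda>\<eta>. add_one_cost (s, x, i) (carre_du_champ \<epsilon> u0 g t) \<eta>"
  have j: "j < m" using m by simp
  have s0: "0 \<le> s" using s(1) \<Delta>_pos by (meson less_imp_le mult_nonneg_nonneg of_nat_0_le_iff order_trans)
  \<comment> \<open>The nonnegative integral is monotone for arbitrary functions, so only the
    dominating side has to be measurable. The word term serves good configurations, the crude bound
    \<open>K\<close> the bad ones.\<close>
  have "AE \<eta> in P. ennreal ((?c \<eta>)\<^sup>2) \<le> ennreal (a\<^sup>2 * ?F (slot_word \<Delta> m \<eta>)) + ennreal (K\<^sup>2) * indicator (bad j) \<eta>"
    using AE_locally_finite AE_start AE_space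
  proof eventually_elim
    case (elim \<eta>)
    show ?case
    proof (cases "\<eta> \<in> bad j")
      case True
      have lf': "locally_finite_config \<epsilon> (insert (s, x, i) \<eta>)"
        by (intro locally_finite_insert elim p s0)
      have t0: "0 \<le> t" using t \<Delta>_pos by simp
      have bound: "\<bar>carre_du_champ \<epsilon> u0 g t \<eta>'\<bar> \<le> K / 2" if "locally_finite_config \<epsilon> \<eta>'" for \<eta>'
      proof -
        have "\<bar>carre_du_champ \<epsilon> u0 g t \<eta>'\<bar> \<le> t * (\<epsilon> ^ CARD('d) / \<epsilon>\<^sup>2 * (real (card bonds) * ((2 * U)\<^sup>2 * B)))"
          by (rule carre_du_champ_bound[OF that]) (use u g t0 B in blast)+
        moreover have "K / 2 = t * (\<epsilon> ^ CARD('d) / \<epsilon>\<^sup>2 * (real (card bonds) * ((2 * U)\<^sup>2 * B)))"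
          unfolding K_def by (rule nonzero_mult_div_cancel_left) simp
        ultimately show ?thesis by (simp only:)
      qed
      from bound[OF elim(1)] bound[OF lf']
      have "\<bar>?c \<eta>\<bar> \<le> K" unfolding add_one_cost_def by linarith
      then have "\<bar>?c \<eta>\<bar>\<^sup>2 \<le> K\<^sup>2" by (intro power_mono) auto
      then have "ennreal ((?c \<eta>)\<^sup>2) \<le> ennreal (K\<^sup>2) * indicator (bad j) \<eta>"
        using True by (simp add: ennreal_leI)
      then show ?thesis by (rule order_trans) simp
    next
      case False
      have "arrivals k \<eta> \<le> 1" if "k < m" for k
      proof (rule ccontr)
        assume "\<not> arrivals k \<eta> \<le> 1"
        then have "\<eta> \<in> bad j" using that elim(3) unfolding bad_def by (intro UnI1 UN_I[of k]) auto
        with False show False ..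
      qed
      moreover have "arrivals j \<eta> = 0"
        using False elim(3) by (auto simp: bad_def)
      ultimately have "\<bar>?c \<eta>\<bar> \<le> a * response (run (take j (slot_word \<Delta> m \<eta>)) (restrict u0 V)) (x, i) L (drop (Suc j) (slot_word \<Delta> m \<eta>))"
        unfolding a_def arrivals_def
        by (intro abs_add_one_cost_le[OF elim(1) u g B \<Delta>_pos m t] s p) (use elim(2) in blast)+
      then have "\<bar>?c \<eta>\<bar>\<^sup>2 \<le> (a * response (run (take j (slot_word \<Delta> m \<eta>)) (restrict u0 V)) (x, i) L (drop (Suc j) (slot_word \<Delta> m \<eta>)))\<^sup>2"
        by (intro power_mono) auto
      then have "ennreal ((?c \<eta>)\<^sup>2) \<le> ennreal (a\<^sup>2 * ?F (slot_word \<Delta> m \<eta>))"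
        by (intro ennreal_leI) (simp add: power_mult_distrib)
      then show ?thesis by (rule order_trans) simp
    qed
  qed
  then have "(\<integral>\<^sup>+ \<eta>. ennreal ((?c \<eta>)\<^sup>2) \<partial>P)
      \<le> (\<integral>\<^sup>+ \<eta>. ennreal (a\<^sup>2 * ?F (slot_word \<Delta> m \<eta>)) + ennreal (K\<^sup>2) * indicator (bad j) \<eta> \<partial>P)"
    by (rule nn_integral_mono_AE)
  also have "\<dots> = (\<integral>\<^sup>+ \<eta>. ennreal (a\<^sup>2 * ?F (slot_word \<Delta> m \<eta>)) \<partial>P) + (\<integral>\<^sup>+ \<eta>. ennreal (K\<^sup>2) * indicator (bad j) \<eta> \<partial>P)"
    using nn_integral_slot_word(1)[of "\<lambda>w. a\<^sup>2 * ?F w"] events_bad[OF j]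
    by (intro nn_integral_add borel_measurable_times_ennreal borel_measurable_const borel_measurable_indicator) auto
  also have "(\<integral>\<^sup>+ \<eta>. ennreal (a\<^sup>2 * ?F (slot_word \<Delta> m \<eta>)) \<partial>P) = ennreal (a\<^sup>2 * expect m ?F)"
    using nn_integral_slot_word(2)[of "\<lambda>w. a\<^sup>2 * ?F w"] by (simp add: expect_cmult)
  also have "(\<integral>\<^sup>+ \<eta>. ennreal (K\<^sup>2) * indicator (bad j) \<eta> \<partial>P) = ennreal (K\<^sup>2 * prob (bad j))"
    using events_bad[OF j] by (simp add: nn_integral_cmult_indicator emeasure_eq_measure ennreal_mult''[symmetric])
  also have "\<dots> \<le> ennreal (K\<^sup>2 * (real m * total_intensity\<^sup>2 + total_intensity))"
    by (intro ennreal_leI mult_left_mono prob_bad j) simp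
  also have "ennreal (a\<^sup>2 * expect m ?F) + ennreal (K\<^sup>2 * (real m * total_intensity\<^sup>2 + total_intensity))
      = ennreal (a\<^sup>2 * expect m ?F + K\<^sup>2 * (real m * total_intensity\<^sup>2 + total_intensity))"
  proof (rule ennreal_plus[symmetric])
    have "expect m (\<lambda>_. 0) \<le> expect m ?F" by (rule expect_mono) simp
    then show "0 \<le> a\<^sup>2 * expect m ?F" by simp
    show "0 \<le> K\<^sup>2 * (real m * total_intensity\<^sup>2 + total_intensity)"
      using total_intensity_nonneg by simp
  qed
  finally show ?thesis by (simp add: add_mono)
qed

end

section \<open>Conclusion\<close>

context poisson_mesh
begin

text \<open>\<open>C\<close> abstracts the moment bound of the response, uniformly in the insertion
  slot. Summed over the slots, the energies of the unperturbed process are at most 2 / rate times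
  its initial \<open>l2\<close> norm, whatever the horizon \<open>t\<close> is.\<close>

lemma nn_integral_cost_le:
  assumes u: "\<And>x. x \<in> V \<Longrightarrow> \<bar>u0 x\<bar> \<le> U" and g: "\<And>i. time_torus_continuous (g i)"
    and B: "\<And>i r x. 0 \<le> r \<Longrightarrow> r \<le> t \<Longrightarrow> x \<in> V \<Longrightarrow> \<bar>g i r x\<bar> \<le> B"
    and t: "t = real m * \<Delta>"
    and C0: "0 \<le> C"
    and C: "\<And>j L. m = Suc (j + L) \<Longrightarrow>
      (\<Sum>p\<in>bonds. expect m (\<lambda>w. (response (run (take j w) (restrict u0 V)) p L (drop (Suc j) w))\<^sup>2))
        \<le> C * expect j (\<lambda>w. energy (run w (restrict u0 V)))"
  defines "a \<equiv> \<epsilon> ^ CARD('d) / \<epsilon>\<^sup>2 * B * (2 * \<Delta>)"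
  defines "K \<equiv> 2 * (t * (\<epsilon> ^ CARD('d) / \<epsilon>\<^sup>2 * (real (card bonds) * ((2 * U)\<^sup>2 * B))))"
  defines "b \<equiv> K\<^sup>2 * (real m * total_intensity\<^sup>2 + total_intensity)"
  shows "(\<integral>\<^sup>+ s\<in>{0..}. ennreal (\<epsilon> ^ CARD('d)) * (\<Sum>x\<in>V. \<Sum>i\<in>UNIV.
        \<integral>\<^sup>+ \<eta>. ennreal ((add_one_cost (s, x, i) (carre_du_champ \<epsilon> u0 g t) \<eta>)\<^sup>2) \<partial>P) \<partial>lborel)
    \<le> ennreal (\<epsilon> ^ CARD('d) * (\<Delta> * (a\<^sup>2 * C * (2 / rate * (U\<^sup>2 * real (card V)))) + t * (real (card bonds) * b)))"
proof -
  let ?u = "restrict u0 V"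
  let ?I = "\<lambda>s p. \<integral>\<^sup>+ \<eta>. ennreal ((add_one_cost (s, p) (carre_du_champ \<epsilon> u0 g t) \<eta>)\<^sup>2) \<partial>P"
  let ?f = "\<lambda>s. ennreal (\<epsilon> ^ CARD('d)) * (\<Sum>x\<in>V. \<Sum>i\<in>UNIV. ?I s (x, i))"
  define e where "e j = expect j (\<lambda>w. energy (run w ?u))" for j
  define c where "c j = \<epsilon> ^ CARD('d) * (a\<^sup>2 * (C * e j) + real (card bonds) * b)" for j
  let ?slot = "\<lambda>j. {real j * \<Delta><..real (Suc j) * \<Delta>}"
  have u': "\<bar>?u x\<bar> \<le> U" if "x \<in> V" for x using u[OF that] that by simp
  have b0: "0 \<le> b" unfolding b_def using total_intensity_nonneg by simp
  have e0: "0 \<le> e j" for j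
  proof -
    have "expect j (\<lambda>_. 0) \<le> e j" unfolding e_def by (rule expect_mono) simp
    then show ?thesis by simp
  qed
  have c0: "0 \<le> c j" for j using b0 e0 C0 eps_pos by (simp add: c_def)
  have slot_bound: "?f s \<le> ennreal (c j)" if j: "j < m" and s: "s \<in> ?slot j" for s j
  proof -
    obtain L where m: "m = Suc (j + L)" using j less_imp_Suc_add by blast
    let ?E = "\<lambda>p. expect m (\<lambda>w. (response (run (take j w) ?u) p L (drop (Suc j) w))\<^sup>2)"
    have E0: "0 \<le> ?E p" for p
    proof -
      have "expect m (\<lambda>_. 0) \<le> ?E p" by (rule expect_mono) simp
      then show ?thesis by simp
    qed
    have "?I s p \<le> ennreal (a\<^sup>2 * ?E p + b)" if "p \<in> bonds" for p
    proof -
      obtain x i where p: "p = (x, i)" by (cases p)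
      show ?thesis
        unfolding p a_def b_def K_def
        by (rule nn_integral_add_one_cost_le[OF _ g _ m t]) (use u B s that p in auto)
    qed
    then have "(\<Sum>p\<in>bonds. ?I s p) \<le> (\<Sum>p\<in>bonds. ennreal (a\<^sup>2 * ?E p + b))" by (rule sum_mono)
    also have "\<dots> = ennreal (\<Sum>p\<in>bonds. a\<^sup>2 * ?E p + b)"
      using E0 b0 by (intro sum_ennreal) simp
    also have "(\<Sum>p\<in>bonds. a\<^sup>2 * ?E p + b) = a\<^sup>2 * (\<Sum>p\<in>bonds. ?E p) + real (card bonds) * b"
      by (simp add: sum.distrib sum_distrib_left)
    also have "ennreal \<dots> \<le> ennreal (a\<^sup>2 * (C * e j) + real (card bonds) * b)"
      unfolding e_def by (intro ennreal_leI add_right_mono mult_left_mono C m) simp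
    finally have "(\<Sum>x\<in>V. \<Sum>i\<in>UNIV. ?I s (x, i)) \<le> ennreal (a\<^sup>2 * (C * e j) + real (card bonds) * b)"
      unfolding bonds_def by (simp add: sum.cartesian_product case_prod_beta)
    then have "?f s \<le> ennreal (\<epsilon> ^ CARD('d)) * ennreal (a\<^sup>2 * (C * e j) + real (card bonds) * b)"
      by (rule mult_left_mono) simp
    also have "\<dots> = ennreal (c j)"
      unfolding c_def using eps_pos by (subst ennreal_mult') auto
    finally show ?thesis .
  qed
  \<comment> \<open>The time 0 lies in no slot, but it is a null set.\<close>
  have "AE s in lborel. ?f s * indicator {0..} s \<le> (\<Sum>j<m. ennreal (c j) * indicator (?slot j) s)"
    using AE_lborel_singleton[of "0::real"]
  proof eventually_elim
    case (elim s)
    consider "s < 0" | "0 < s" "s \<le> t" | "t < s" using elim by linarith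
    then show ?case
    proof cases
      case 1
      then show ?thesis by simp
    next
      case 2
      then obtain j where j: "j < m" "s \<in> ?slot j"
        using exists_slot[of s m \<Delta>] t by auto
      have "?f s * indicator {0..} s \<le> ennreal (c j) * indicator (?slot j) s"
        using slot_bound[OF j] j 2 by (simp del: of_nat_Suc)
      also have "\<dots> \<le> (\<Sum>j<m. ennreal (c j) * indicator (?slot j) s)"
        using j by (intro member_le_sum) auto
      finally show ?thesis .
    next
      case 3
      then show ?thesis by (simp add: add_one_cost_late)
    qed
  qed
  then have "(\<integral>\<^sup>+ s\<in>{0..}. ?f s \<partial>lborel) \<le> (\<integral>\<^sup>+ s. (\<Sum>j<m. ennreal (c j) * indicator (?slot j) s) \<partial>lborel)"
    by (rule nn_integral_mono_AE)
  also have "\<dots> = (\<Sum>j<m. \<integral>\<^sup>+ s. ennreal (c j) * indicator (?slot j) s \<partial>lborel)"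
    by (rule nn_integral_sum) simp
  also have "\<dots> = (\<Sum>j<m. ennreal (c j * \<Delta>))"
  proof (rule sum.cong[OF refl])
    fix j
    have "emeasure lborel (?slot j) = ennreal \<Delta>"
      using \<Delta>_pos by (subst emeasure_lborel_Ioc) (auto simp: algebra_simps)
    then show "(\<integral>\<^sup>+ s. ennreal (c j) * indicator (?slot j) s \<partial>lborel) = ennreal (c j * \<Delta>)"
      using c0[of j] by (simp add: nn_integral_cmult_indicator ennreal_mult')
  qed
  also have "\<dots> = ennreal (\<Sum>j<m. c j * \<Delta>)"
    using c0 \<Delta>_pos by (intro sum_ennreal) simp
  also have "\<dots> \<le> ennreal (\<epsilon> ^ CARD('d) * (\<Delta> * (a\<^sup>2 * C * (2 / rate * (U\<^sup>2 * real (card V)))) + t * (real (card bonds) * b)))"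
  proof (rule ennreal_leI)
    have "(\<Sum>j<m. e j) \<le> 2 / rate * l2 ?u"
      unfolding e_def by (rule expect_energy_sum_le)
    also have "\<dots> \<le> 2 / rate * (U\<^sup>2 * real (card V))"
      using q_pos by (intro mult_left_mono l2_le_sup u') auto
    finally have sum_e: "(\<Sum>j<m. e j) \<le> 2 / rate * (U\<^sup>2 * real (card V))" .
    have "(\<Sum>j<m. c j * \<Delta>) = (\<Sum>j<m. \<epsilon> ^ CARD('d) * \<Delta> * a\<^sup>2 * C * e j + \<epsilon> ^ CARD('d) * \<Delta> * real (card bonds) * b)"
      by (rule sum.cong) (auto simp: c_def algebra_simps)
    also have "\<dots> = \<epsilon> ^ CARD('d) * \<Delta> * a\<^sup>2 * C * (\<Sum>j<m. e j) + real m * (\<epsilon> ^ CARD('d) * \<Delta> * real (card bonds) * b)"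
      by (simp add: sum.distrib sum_distrib_left)
    also have "\<dots> \<le> \<epsilon> ^ CARD('d) * \<Delta> * a\<^sup>2 * C * (2 / rate * (U\<^sup>2 * real (card V))) + real m * (\<epsilon> ^ CARD('d) * \<Delta> * real (card bonds) * b)"
      using eps_pos \<Delta>_pos C0 by (intro add_right_mono mult_left_mono sum_e) simp
    also have "\<dots> = \<epsilon> ^ CARD('d) * (\<Delta> * (a\<^sup>2 * C * (2 / rate * (U\<^sup>2 * real (card V)))) + t * (real (card bonds) * b))"
      unfolding t by (simp add: algebra_simps)
    finally show "(\<Sum>j<m. c j * \<Delta>) \<le> \<epsilon> ^ CARD('d) * (\<Delta> * (a\<^sup>2 * C * (2 / rate * (U\<^sup>2 * real (card V)))) + t * (real (card bonds) * b))" .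
  qed
  finally show ?thesis .
qed

text \<open>The three factors \<open>1 / rate\<close>, two from \<open>C\<close> and one from the
  summed energy, meet exactly three factors \<Delta>. Each quotient is at most 2 \<epsilon>^2, and
  against the \<epsilon>^(-4) of the squared prefactor this leaves \<epsilon>^2 and a bound that
  does not deteriorate as the grid is refined.\<close>

lemma nn_integral_cost_le_mesh:
  assumes u: "\<And>x. x \<in> V \<Longrightarrow> \<bar>u0 x\<bar> \<le> U" and g: "\<And>i. time_torus_continuous (g i)"
    and B: "\<And>i r x. 0 \<le> r \<Longrightarrow> r \<le> t \<Longrightarrow> x \<in> V \<Longrightarrow> \<bar>g i r x\<bar> \<le> B"
    and t: "t = real m * \<Delta>" and R: "1 \<le> R" "R \<le> n" and k: "1 \<le> k"
    and fine: "exp total_intensity \<le> 2"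
  defines "\<theta> \<equiv> 2 / real R ^ CARD('d) + exp (- k / (16 * (real CARD('d) * real R)\<^sup>2))"
  defines "K \<equiv> 2 * (t * (\<epsilon> ^ CARD('d) / \<epsilon>\<^sup>2 * (real (card bonds) * ((2 * U)\<^sup>2 * B))))"
  defines "I \<equiv> real (card bonds) * t / \<epsilon>\<^sup>2"
  shows "(\<integral>\<^sup>+ s\<in>{0..}. ennreal (\<epsilon> ^ CARD('d)) * (\<Sum>x\<in>V. \<Sum>i\<in>UNIV.
        \<integral>\<^sup>+ \<eta>. ennreal ((add_one_cost (s, x, i) (carre_du_champ \<epsilon> u0 g t) \<eta>)\<^sup>2) \<partial>P) \<partial>lborel)
    \<le> ennreal (\<epsilon> ^ (CARD('d) + 2) * (32768 * (real CARD('d))\<^sup>2 * B\<^sup>2 * U ^ 4 * (\<epsilon> ^ CARD('d) * k\<^sup>2 + \<theta>))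
         + \<epsilon> ^ CARD('d) * t * real (card bonds) * K\<^sup>2 * (I\<^sup>2 + I) / real m)"
proof -
  let ?d = "real CARD('d)"
  let ?N = "real (card V)"
  let ?E = "\<epsilon> ^ CARD('d)"
  \<comment> \<open>\<open>k\<close> counts expected updates per bond, and one step contributes
    \<open>rate\<close> of them. Rounding up at most doubles the number of steps because k / rate
    \<ge> 1.\<close>
  define \<kappa> where "\<kappa> = nat \<lceil>k / rate\<rceil>"
  define \<theta>' where "\<theta>' = 2 / real R ^ CARD('d) + exp (- real \<kappa> * rate / (16 * (?d * real R)\<^sup>2))"
  define C where "C = (32 * ?d\<^sup>2 * (real \<kappa>)\<^sup>2 + 64 * ?d\<^sup>2 * ?N * \<theta>' / rate\<^sup>2) * (2 * U)\<^sup>2"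
  have kr: "k / rate \<le> real \<kappa>" unfolding \<kappa>_def by linarith
  have "real \<kappa> \<le> k / rate + 1" unfolding \<kappa>_def using k q_pos by (simp add: of_nat_nat)
  moreover have "1 \<le> k / rate" using k q_pos q_le_1 by (simp add: field_simps)
  ultimately have \<kappa>_le: "real \<kappa> \<le> 2 * k / rate" by simp
  have dim: "1 \<le> ?d" by (rule dim_ge_1)
  have \<theta>'_le: "\<theta>' \<le> \<theta>"
  proof -
    have "k \<le> real \<kappa> * rate" using kr q_pos by (simp add: field_simps)
    then show ?thesis unfolding \<theta>_def \<theta>'_def by (simp add: divide_right_mono)
  qed
  have \<theta>'_nonneg: "0 \<le> \<theta>'" unfolding \<theta>'_def by (intro add_nonneg_nonneg divide_nonneg_nonneg zero_le_power exp_ge_zero) simp_all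
  have \<theta>_nonneg: "0 \<le> \<theta>" using \<theta>'_nonneg \<theta>'_le by linarith
  have C_nonneg: "0 \<le> C" unfolding C_def using \<theta>'_nonneg by (intro mult_nonneg_nonneg add_nonneg_nonneg) auto
  have C_le: "C \<le> 512 * ?d\<^sup>2 * U\<^sup>2 * (k\<^sup>2 + ?N * \<theta>) / rate\<^sup>2"
  proof -
    have "(real \<kappa>)\<^sup>2 \<le> (2 * k / rate)\<^sup>2" using \<kappa>_le by (intro power_mono) auto
    also have "\<dots> = 4 * k\<^sup>2 / rate\<^sup>2" by (simp add: power_mult_distrib power_divide)
    finally have "32 * ?d\<^sup>2 * (real \<kappa>)\<^sup>2 \<le> 32 * ?d\<^sup>2 * (4 * k\<^sup>2 / rate\<^sup>2)"
      by (rule mult_left_mono) simp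
    moreover have "64 * ?d\<^sup>2 * ?N * \<theta>' / rate\<^sup>2 \<le> 128 * ?d\<^sup>2 * ?N * \<theta> / rate\<^sup>2"
      using \<theta>'_le \<theta>'_nonneg by (intro divide_right_mono mult_mono) auto
    ultimately have "C \<le> (32 * ?d\<^sup>2 * (4 * k\<^sup>2 / rate\<^sup>2) + 128 * ?d\<^sup>2 * ?N * \<theta> / rate\<^sup>2) * (2 * U)\<^sup>2"
      unfolding C_def by (intro mult_right_mono add_mono) auto
    also have "\<dots> = 512 * ?d\<^sup>2 * U\<^sup>2 * (k\<^sup>2 + ?N * \<theta>) / rate\<^sup>2"
      by (simp add: power_mult_distrib algebra_simps add_divide_distrib)
    finally show ?thesis .
  qed
  have C: "(\<Sum>p\<in>bonds. expect m (\<lambda>w. (response (run (take j w) (restrict u0 V)) p L (drop (Suc j) w))\<^sup>2))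
        \<le> C * expect j (\<lambda>w. energy (run w (restrict u0 V)))" if "m = Suc (j + L)" for j L
    unfolding C_def \<theta>'_def that by (rule sum_expect_response_sq_le[OF R]) (use u in auto)
  \<comment> \<open>\<open>rate\<close> is \<Delta> / \<epsilon>^2 times exp (-total_intensity), a
    factor which \<open>fine\<close> keeps at 1/2 or above.\<close>
  have ratio: "\<Delta> / rate \<le> 2 * \<epsilon>\<^sup>2"
  proof -
    have "\<Delta> / rate = \<epsilon>\<^sup>2 * exp total_intensity"
      using \<Delta>_pos eps_pos by (simp add: rate_def intensity_def exp_minus field_simps)
    also have "\<dots> \<le> \<epsilon>\<^sup>2 * 2" using fine by (intro mult_left_mono) auto
    finally show ?thesis by simp
  qed
  have I_eq: "total_intensity = I / real m"
    using m_pos by (simp add: I_def t total_intensity_def intensity_def)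
  have EN: "?E * ?N \<le> 1"
  proof -
    have "?N \<le> real n ^ CARD('d)" using card_lattice_le by (metis of_nat_le_iff of_nat_power)
    then have "?E * ?N \<le> ?E * real n ^ CARD('d)" using eps_pos by (intro mult_left_mono) auto
    also have "\<dots> = 1" by (simp add: power_mult_distrib[symmetric] eps_n)
    finally show ?thesis .
  qed
  have first: "\<Delta> * ((?E / \<epsilon>\<^sup>2 * B * (2 * \<Delta>))\<^sup>2 * C * (2 / rate * (U\<^sup>2 * ?N)))
      \<le> \<epsilon>\<^sup>2 * (32768 * ?d\<^sup>2 * B\<^sup>2 * U ^ 4 * (?E * k\<^sup>2 + \<theta>))"
  proof -
    have "\<Delta> * ((?E / \<epsilon>\<^sup>2 * B * (2 * \<Delta>))\<^sup>2 * C * (2 / rate * (U\<^sup>2 * ?N)))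
        \<le> \<Delta> * ((?E / \<epsilon>\<^sup>2 * B * (2 * \<Delta>))\<^sup>2 * (512 * ?d\<^sup>2 * U\<^sup>2 * (k\<^sup>2 + ?N * \<theta>) / rate\<^sup>2) * (2 / rate * (U\<^sup>2 * ?N)))"
      using \<Delta>_pos q_pos by (intro mult_left_mono mult_right_mono C_le) auto
    also have "\<dots> = 4096 * ?d\<^sup>2 * B\<^sup>2 * U ^ 4 * (?E\<^sup>2 / \<epsilon> ^ 4 * ?N * (k\<^sup>2 + ?N * \<theta>)) * (\<Delta> / rate) ^ 3"
      using q_pos eps_pos by (simp add: field_simps power2_eq_square power3_eq_cube power4_eq_xxxx)
    also have "\<dots> \<le> 4096 * ?d\<^sup>2 * B\<^sup>2 * U ^ 4 * (?E\<^sup>2 / \<epsilon> ^ 4 * ?N * (k\<^sup>2 + ?N * \<theta>)) * (2 * \<epsilon>\<^sup>2) ^ 3"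
      using \<Delta>_pos q_pos \<theta>_nonneg eps_pos by (intro mult_left_mono power_mono ratio) auto
    also have "\<dots> = \<epsilon>\<^sup>2 * (32768 * ?d\<^sup>2 * B\<^sup>2 * U ^ 4) * ((?E * ?N) * (?E * k\<^sup>2 + (?E * ?N) * \<theta>))"
      using eps_pos by (simp add: field_simps power2_eq_square power3_eq_cube power4_eq_xxxx)
    also have "\<dots> \<le> \<epsilon>\<^sup>2 * (32768 * ?d\<^sup>2 * B\<^sup>2 * U ^ 4) * (1 * (?E * k\<^sup>2 + 1 * \<theta>))"
      using eps_pos \<theta>_nonneg by (intro mult_left_mono mult_mono add_left_mono EN mult_right_mono) auto
    finally show ?thesis by (simp add: ac_simps)
  qed
  have "(\<integral>\<^sup>+ s\<in>{0..}. ennreal ?E * (\<Sum>x\<in>V. \<Sum>i\<in>UNIV.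
        \<integral>\<^sup>+ \<eta>. ennreal ((add_one_cost (s, x, i) (carre_du_champ \<epsilon> u0 g t) \<eta>)\<^sup>2) \<partial>P) \<partial>lborel)
    \<le> ennreal (?E * (\<Delta> * ((?E / \<epsilon>\<^sup>2 * B * (2 * \<Delta>))\<^sup>2 * C * (2 / rate * (U\<^sup>2 * ?N)))
      + t * (real (card bonds) * (K\<^sup>2 * (real m * total_intensity\<^sup>2 + total_intensity)))))"
    unfolding K_def by (rule nn_integral_cost_le[OF _ g _ t C_nonneg C]) (use u B in auto)
  also have "\<dots> \<le> ennreal (?E * (\<epsilon>\<^sup>2 * (32768 * ?d\<^sup>2 * B\<^sup>2 * U ^ 4 * (?E * k\<^sup>2 + \<theta>)))
      + ?E * (t * (real (card bonds) * (K\<^sup>2 * (real m * total_intensity\<^sup>2 + total_intensity)))))"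
    unfolding distrib_left[of ?E] using first eps_pos
    by (intro ennreal_leI add_right_mono mult_left_mono) auto
  also have "real m * total_intensity\<^sup>2 + total_intensity = (I\<^sup>2 + I) / real m"
    unfolding I_eq using m_pos by (simp add: power2_eq_square field_simps)
  also have "?E * (\<epsilon>\<^sup>2 * (32768 * ?d\<^sup>2 * B\<^sup>2 * U ^ 4 * (?E * k\<^sup>2 + \<theta>)))
      + ?E * (t * (real (card bonds) * (K\<^sup>2 * ((I\<^sup>2 + I) / real m))))
    = \<epsilon> ^ (CARD('d) + 2) * (32768 * ?d\<^sup>2 * B\<^sup>2 * U ^ 4 * (?E * k\<^sup>2 + \<theta>))
         + ?E * t * real (card bonds) * K\<^sup>2 * (I\<^sup>2 + I) / real m"
    by (simp add: power_add power2_eq_square mult.assoc)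
  finally show ?thesis .
qed

end

text \<open>The left-hand side does not involve the grid. With \<Delta> = t / m the error is a
  constant \<open>D\<close> over \<open>m\<close>, so m may tend to infinity with \<epsilon> and
  \<open>t\<close> fixed.\<close>

lemma (in torus_mesh) malliavin_energy_le:
  assumes clocks: "poisson_clocks \<epsilon> P"
    and u: "\<And>x. x \<in> V \<Longrightarrow> \<bar>u0 x\<bar> \<le> U" and g: "\<And>i. time_torus_continuous (g i)"
    and B: "\<And>i r x. 0 \<le> r \<Longrightarrow> r \<le> t \<Longrightarrow> x \<in> V \<Longrightarrow> \<bar>g i r x\<bar> \<le> B"
    and t: "0 < t" and R: "1 \<le> R" "R \<le> n" and k: "1 \<le> k"
  defines "\<theta> \<equiv> 2 / real R ^ CARD('d) + exp (- k / (16 * (real CARD('d) * real R)\<^sup>2))"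
  shows "ennreal (1 / \<epsilon> ^ (CARD('d) + 2)) * (\<integral>\<^sup>+ s\<in>{0..}. ennreal (\<epsilon> ^ CARD('d)) * (\<Sum>x\<in>V. \<Sum>i\<in>UNIV.
        \<integral>\<^sup>+ \<eta>. ennreal ((add_one_cost (s, x, i) (carre_du_champ \<epsilon> u0 g t) \<eta>)\<^sup>2) \<partial>P) \<partial>lborel)
    \<le> ennreal (32768 * (real CARD('d))\<^sup>2 * B\<^sup>2 * U ^ 4 * (\<epsilon> ^ CARD('d) * k\<^sup>2 + \<theta>))"
  (is "_ * ?lhs \<le> ennreal ?M")
proof -
  define D where "D = \<epsilon> ^ CARD('d) * t * real (card bonds)
    * (2 * (t * (\<epsilon> ^ CARD('d) / \<epsilon>\<^sup>2 * (real (card bonds) * ((2 * U)\<^sup>2 * B)))))\<^sup>2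
    * ((real (card bonds) * t / \<epsilon>\<^sup>2)\<^sup>2 + real (card bonds) * t / \<epsilon>\<^sup>2)"
  let ?I = "real (card bonds) * t / \<epsilon>\<^sup>2"
  have "(\<lambda>m. exp (?I / real m)) \<longlonglongrightarrow> exp 0"
    by (intro tendsto_exp real_tendsto_divide_at_top[OF tendsto_const] filterlim_real_sequentially)
  then have "\<forall>\<^sub>F m in sequentially. exp (?I / real m) < 2"
    by (rule order_tendstoD) simp
  then have ev: "\<forall>\<^sub>F m in sequentially. ?lhs \<le> ennreal (\<epsilon> ^ (CARD('d) + 2) * ?M + D / real m)"
    using eventually_gt_at_top[of 0]
  proof eventually_elim
    case (elim m)
    interpret poisson_mesh \<epsilon> n V P "t / real m" m
      using clocks t elim by unfold_locales auto
    show ?case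
      unfolding \<theta>_def D_def
    proof (rule nn_integral_cost_le_mesh[OF _ g _ _ R k])
      show "t = real m * (t / real m)" using elim by simp
      show "exp total_intensity \<le> 2"
        using elim by (simp add: total_intensity_def intensity_def mult.commute)
    qed (use u B in auto)
  qed
  have "(\<lambda>m. \<epsilon> ^ (CARD('d) + 2) * ?M + D / real m) \<longlonglongrightarrow> \<epsilon> ^ (CARD('d) + 2) * ?M + 0"
    by (intro tendsto_add tendsto_const real_tendsto_divide_at_top[OF tendsto_const] filterlim_real_sequentially)
  then have lim: "(\<lambda>m. ennreal (\<epsilon> ^ (CARD('d) + 2) * ?M + D / real m)) \<longlonglongrightarrow> ennreal (\<epsilon> ^ (CARD('d) + 2) * ?M)"
    by (intro tendsto_ennrealI) simp
  have "?lhs \<le> ennreal (\<epsilon> ^ (CARD('d) + 2) * ?M)"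
    by (rule tendsto_lowerbound[OF lim ev]) simp
  then have "ennreal (1 / \<epsilon> ^ (CARD('d) + 2)) * ?lhs \<le> ennreal (1 / \<epsilon> ^ (CARD('d) + 2)) * ennreal (\<epsilon> ^ (CARD('d) + 2) * ?M)"
    by (rule mult_left_mono) simp
  also have "\<dots> = ennreal (1 / \<epsilon> ^ (CARD('d) + 2) * (\<epsilon> ^ (CARD('d) + 2) * ?M))"
    using eps_pos by (intro ennreal_mult'[symmetric]) simp
  also have "1 / \<epsilon> ^ (CARD('d) + 2) * (\<epsilon> ^ (CARD('d) + 2) * ?M) = ?M"
    using eps_pos by simp
  finally show ?thesis .
qed

text \<open>The scales: averaging boxes of side \<open>n powr \<alpha>\<close> with \<open>\<alpha> = d / (2 d + 4)\<close>, and
  \<open>n powr (d (1 - \<alpha>) / 2)\<close> units of lattice time before the perturbation counts as spread out.\<close>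

lemma exists_scales:
  fixes d n :: nat
  assumes d: "1 \<le> d" and n: "2 \<le> n"
  shows "\<exists>R k. 1 \<le> R \<and> R \<le> n \<and> 1 \<le> k \<and>
    (1 / real n) ^ d * k\<^sup>2 + (2 / real R ^ d + exp (- k / (16 * (real d * real R)\<^sup>2)))
      \<le> (3 + 8192 * real d ^ 4) * (1 / real n) powr ((real d)\<^sup>2 / (2 * real d + 4))"
proof -
  \<comment> \<open>All three terms are to be of order n^(-\<alpha> d). The first requires 2 \<beta>
    - d = -\<alpha> d; the exponential, estimated by an inverse square, requires 2 (\<beta> - 2
    \<alpha>) = \<alpha> d. Together they give \<alpha> (2 d + 4) = d.\<close>
  define \<alpha> where "\<alpha> = real d / (2 * real d + 4)"
  define \<beta> where "\<beta> = real d * (1 - \<alpha>) / 2"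
  define k where "k = real n powr \<beta>"
  define R where "R = nat \<lceil>real n powr \<alpha>\<rceil>"
  \<comment> \<open>A lower bound for the size of the exponent; 64 is 16 times the 4 that comes from
    squaring \<open>R_le\<close>.\<close>
  define x where "x = real n powr (\<beta> - 2 * \<alpha>) / (64 * (real d)\<^sup>2)"
  have n1: "1 \<le> real n" "0 < real n" using n by auto
  have \<alpha>: "0 < \<alpha>" "\<alpha> < 1" using d by (auto simp: \<alpha>_def field_simps)
  have \<beta>: "0 \<le> \<beta>" using \<alpha> by (simp add: \<beta>_def)
  have k1: "1 \<le> k" unfolding k_def using n1 \<beta> by (intro ge_one_powr_ge_zero) auto
  have na1: "1 \<le> real n powr \<alpha>" using n1 \<alpha> by (intro ge_one_powr_ge_zero) auto
  have R_ge: "real n powr \<alpha> \<le> real R" unfolding R_def by linarith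
  have R_le: "real R \<le> 2 * real n powr \<alpha>"
    unfolding R_def using na1 by (simp add: of_nat_nat) linarith
  have R1: "1 \<le> R" using R_ge na1 by linarith
  have Rn: "R \<le> n"
  proof -
    have "real n powr \<alpha> \<le> real n powr 1" using n1 \<alpha> by (intro powr_mono) auto
    then have "real n powr \<alpha> \<le> real n" using n1 by simp
    then show ?thesis unfolding R_def by (simp add: ceiling_le_iff)
  qed
  have target: "(1 / real n) powr ((real d)\<^sup>2 / (2 * real d + 4)) = real n powr (- (\<alpha> * real d))"
    using n1 by (simp add: powr_minus_divide powr_divide \<alpha>_def power2_eq_square)
  have 1: "(1 / real n) ^ d * k\<^sup>2 = real n powr (- (\<alpha> * real d))"
  proof -
    have "(1 / real n) ^ d = real n powr (- real d)"
      using n1 by (simp add: powr_minus powr_realpow power_one_over inverse_eq_divide)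
    moreover have "k\<^sup>2 = real n powr (2 * \<beta>)"
      unfolding k_def using n1 by (simp add: powr_power mult.commute)
    ultimately have "(1 / real n) ^ d * k\<^sup>2 = real n powr (- real d + 2 * \<beta>)" by (simp only: powr_add)
    moreover have "- real d + 2 * \<beta> = - (\<alpha> * real d)" by (simp add: \<beta>_def field_simps)
    ultimately show ?thesis by (simp only:)
  qed
  have 2: "2 / real R ^ d \<le> 2 * real n powr (- (\<alpha> * real d))"
  proof -
    have "(real n powr \<alpha>) ^ d \<le> real R ^ d" using R_ge by (intro power_mono) auto
    then have "2 / real R ^ d \<le> 2 / (real n powr \<alpha>) ^ d"
      using n1 R1 by (intro divide_left_mono) (auto intro!: mult_pos_pos)
    also have "\<dots> = 2 * real n powr (- (\<alpha> * real d))"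
      using n1 by (simp add: powr_power powr_minus_divide mult.commute)
    finally show ?thesis .
  qed
  have gap: "\<beta> - 2 * \<alpha> = \<alpha> * real d / 2"
  proof -
    have "\<alpha> * (2 * real d + 4) = real d" by (simp add: \<alpha>_def)
    then show ?thesis by (simp add: \<beta>_def field_simps)
  qed
  have x_pos: "0 < x" unfolding x_def using n1 d by simp
  have 3: "exp (- k / (16 * (real d * real R)\<^sup>2)) \<le> 8192 * real d ^ 4 * real n powr (- (\<alpha> * real d))"
  proof -
    have "(real R)\<^sup>2 \<le> (2 * real n powr \<alpha>)\<^sup>2" using R_le by (intro power_mono) auto
    also have "\<dots> = 4 * real n powr (2 * \<alpha>)" using n1 by (simp add: power_mult_distrib powr_power mult.commute)
    finally have RR: "(real R)\<^sup>2 \<le> 4 * real n powr (2 * \<alpha>)" .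
    have "x = k / (16 * ((real d)\<^sup>2 * (4 * real n powr (2 * \<alpha>))))"
      by (simp add: x_def k_def powr_diff)
    also have "\<dots> \<le> k / (16 * (real d * real R)\<^sup>2)"
      unfolding power_mult_distrib using k1 RR d R1 n1
      by (intro divide_left_mono mult_left_mono mult_pos_pos) auto
    finally have "exp (- k / (16 * (real d * real R)\<^sup>2)) \<le> exp (- x)" by simp
    \<comment> \<open>A quadratic lower bound for exp is enough, since by \<open>gap\<close> the
      square of \<open>x\<close> already has order n^(\<alpha> d).\<close>
    also have "\<dots> \<le> 2 / x\<^sup>2"
    proof -
      have "x\<^sup>2 / 2 \<le> exp x" using exp_lower_Taylor_quadratic[of x] x_pos by linarith
      then have "1 / exp x \<le> 1 / (x\<^sup>2 / 2)" using x_pos by (intro divide_left_mono) auto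
      then show ?thesis by (simp add: exp_minus inverse_eq_divide)
    qed
    also have "\<dots> = 8192 * real d ^ 4 * real n powr (- (\<alpha> * real d))"
    proof -
      have "x\<^sup>2 = real n powr (\<alpha> * real d) / (4096 * real d ^ 4)"
      proof -
        have "(real n powr (\<alpha> * real d / 2))\<^sup>2 = real n powr (\<alpha> * real d)"
          by (simp add: power2_eq_square powr_add[symmetric])
        then show ?thesis
          by (simp add: x_def gap power_divide power_mult_distrib power_mult[symmetric])
      qed
      then show ?thesis using n1 d by (simp add: powr_minus_divide)
    qed
    finally show ?thesis .
  qed
  have "(1 / real n) ^ d * k\<^sup>2 + (2 / real R ^ d + exp (- k / (16 * (real d * real R)\<^sup>2)))
      \<le> (3 + 8192 * real d ^ 4) * (1 / real n) powr ((real d)\<^sup>2 / (2 * real d + 4))"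
    unfolding target distrib_right using 1 2 3 by linarith
  with k1 R1 Rn show ?thesis by blast
qed

theorem theorem3:
  fixes h :: real
  assumes "0 < h" and "h < 1"
  shows "\<exists>C::real. C > 0 \<and>
    (\<forall>(\<epsilon>::real) (P :: ('d::finite) config measure) (t::real)
       (g :: 'd \<Rightarrow> real \<Rightarrow> real^'d \<Rightarrow> real) (u0 :: real^'d \<Rightarrow> real).
       0 < \<epsilon> \<longrightarrow> \<epsilon> < 1 \<longrightarrow> 1 / \<epsilon> \<in> \<nat> \<longrightarrow> poisson_clocks \<epsilon> P \<longrightarrow> 0 < t \<longrightarrow>
       (\<forall>i. time_torus_continuous (g i)) \<longrightarrow> torus_continuous u0 \<longrightarrow>
       ennreal (1 / \<epsilon> ^ (CARD('d) + 2)) *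
         (\<integral>\<^sup>+ s\<in>{0..}. ennreal (\<epsilon> ^ CARD('d)) *
            (\<Sum>x\<in>torus_lattice \<epsilon>. \<Sum>i\<in>UNIV.
               \<integral>\<^sup>+ \<eta>. ennreal ((add_one_cost (s, x, i) (carre_du_champ \<epsilon> u0 g t) \<eta>)\<^sup>2) \<partial>P)
          \<partial>lborel)
       \<le> ennreal C * time_torus_norm g ^ 2 * torus_norm u0 ^ 4 *
           ennreal ((\<epsilon> powr (real CARD('d) / 2)) powr
             ((1 - h) * (real CARD('d) / (real CARD('d) + 2)))))"
proof -
  let ?d = "real CARD('d)"
  \<comment> \<open>The first two factors come from \<open>malliavin_energy_le\<close>, the last one
    from \<open>exists_scales\<close>.\<close>
  let ?C = "32768 * ?d\<^sup>2 * (3 + 8192 * ?d ^ 4)"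
  have C_pos: "0 < ?C" by (intro mult_pos_pos add_pos_nonneg) auto
  show ?thesis
  proof (intro exI[of _ ?C] conjI allI impI C_pos)
    fix \<epsilon> t :: real and P :: "'d config measure" and g :: "'d \<Rightarrow> real \<Rightarrow> real^'d \<Rightarrow> real" and u0 :: "real^'d \<Rightarrow> real"
    assume \<epsilon>: "0 < \<epsilon>" "\<epsilon> < 1" "1 / \<epsilon> \<in> \<nat>" and clocks: "poisson_clocks \<epsilon> P" and t: "0 < t"
      and g: "\<forall>i. time_torus_continuous (g i)" and u0: "torus_continuous u0"
    obtain n where n: "1 / \<epsilon> = real n" using \<epsilon>(3) by (rule Nats_cases)
    define V :: "(real^'d) set" where "V = torus_lattice \<epsilon>"
    interpret torus_mesh \<epsilon> n V
    proof
      show "\<epsilon> * real n = 1" using \<epsilon>(1) by (simp add: n[symmetric])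
      have "1 < real n" using \<epsilon> by (simp add: n[symmetric])
      then show "2 \<le> n" by simp
    qed (rule V_def)
    define U where "U = Max ((\<lambda>x. \<bar>u0 x\<bar>) ` V)"
    have U: "\<bar>u0 x\<bar> \<le> U" if "x \<in> V" for x
      unfolding U_def using that by (intro Max_ge) auto
    have "U \<in> (\<lambda>x. \<bar>u0 x\<bar>) ` V"
      unfolding U_def using zero_in_lattice by (intro Max_in) auto
    then have U_norm: "ennreal U \<le> torus_norm u0" and U0: "0 \<le> U"
      unfolding torus_norm_def by (auto intro: SUP_upper)
    \<comment> \<open>The norm of \<open>g\<close> may be infinite, so a real bound is taken over
      the finitely many sites and the compact interval [0, t], and compared with the norm
      afterwards.\<close>
    have "\<exists>r\<in>{0..t}. \<forall>r'\<in>{0..t}. \<bar>g i r' x\<bar> \<le> \<bar>g i r x\<bar>" for i x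
      using t g by (intro continuous_attains_sup continuous_intros time_torus_continuous_section) auto
    then obtain r where r: "\<And>i x. r i x \<in> {0..t}" "\<And>i x r'. r' \<in> {0..t} \<Longrightarrow> \<bar>g i r' x\<bar> \<le> \<bar>g i (r i x) x\<bar>"
      by metis
    define B where "B = Max ((\<lambda>p. \<bar>g (snd p) (r (snd p) (fst p)) (fst p)\<bar>) ` bonds)"
    have B: "\<bar>g i s x\<bar> \<le> B" if "0 \<le> s" "s \<le> t" "x \<in> V" for i s x
    proof -
      have "\<bar>g i s x\<bar> \<le> \<bar>g i (r i x) x\<bar>" using that by (intro r(2)) simp
      also have "\<dots> \<le> B"
        unfolding B_def using that by (intro Max_ge) (auto simp: bonds_def intro!: image_eqI[of _ _ "(x, i)"])
      finally show ?thesis .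
    qed
    have "B \<in> (\<lambda>p. \<bar>g (snd p) (r (snd p) (fst p)) (fst p)\<bar>) ` bonds"
      unfolding B_def using zero_in_lattice by (intro Max_in) (auto simp: bonds_def)
    then obtain i z where iz: "B = \<bar>g i (r i z) z\<bar>" by auto
    have B_norm: "ennreal B \<le> time_torus_norm g"
    proof -
      have "ennreal B \<le> (SUP x. ennreal \<bar>g i (r i z) x\<bar>)"
        unfolding iz by (rule SUP_upper) simp
      also have "\<dots> \<le> (SUP s\<in>{0..}. SUP x. ennreal \<bar>g i s x\<bar>)"
        using r(1)[of i z] by (intro SUP_upper2[of "r i z"]) auto
      also have "\<dots> \<le> time_torus_norm g"
        unfolding time_torus_norm_def by (intro Max_ge) auto
      finally show ?thesis .
    qed
    have B0: "0 \<le> B" by (simp add: iz)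
    let ?e = "\<epsilon> powr (?d\<^sup>2 / (2 * ?d + 4))"
    let ?e' = "(\<epsilon> powr (?d / 2)) powr ((1 - h) * (?d / (?d + 2)))"
    obtain R k where R: "1 \<le> R" "R \<le> n" and k: "1 \<le> k"
      and scales: "\<epsilon> ^ CARD('d) * k\<^sup>2 + (2 / real R ^ CARD('d) + exp (- k / (16 * (?d * real R)\<^sup>2)))
        \<le> (3 + 8192 * ?d ^ 4) * ?e"
      using exists_scales[of "CARD('d)" n] n2 unfolding eps_eq by (auto simp: Suc_le_eq)
    \<comment> \<open>The scales give the exponent d^2 / (2 d + 4) = (d / 2) (d / (d + 2)); since
      \<epsilon> < 1, multiplying it by 1 - h only enlarges the power.\<close>
    have e_le: "?e \<le> ?e'"
    proof -
      have "?e' = \<epsilon> powr (?d / 2 * ((1 - h) * (?d / (?d + 2))))" by (simp add: powr_powr)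
      also have "?d / 2 * ((1 - h) * (?d / (?d + 2))) = (1 - h) * (?d\<^sup>2 / (2 * ?d + 4))"
        by (simp add: power2_eq_square field_simps)
      finally have "?e' = \<epsilon> powr ((1 - h) * (?d\<^sup>2 / (2 * ?d + 4)))" .
      moreover have "(1 - h) * (?d\<^sup>2 / (2 * ?d + 4)) \<le> 1 * (?d\<^sup>2 / (2 * ?d + 4))"
        using assms by (intro mult_right_mono) auto
      ultimately show ?thesis using \<epsilon> by (simp add: powr_mono')
    qed
    have "ennreal (1 / \<epsilon> ^ (CARD('d) + 2)) * (\<integral>\<^sup>+ s\<in>{0..}. ennreal (\<epsilon> ^ CARD('d)) * (\<Sum>x\<in>V. \<Sum>i\<in>UNIV.
        \<integral>\<^sup>+ \<eta>. ennreal ((add_one_cost (s, x, i) (carre_du_champ \<epsilon> u0 g t) \<eta>)\<^sup>2) \<partial>P) \<partial>lborel)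
      \<le> ennreal (32768 * ?d\<^sup>2 * B\<^sup>2 * U ^ 4 * (\<epsilon> ^ CARD('d) * k\<^sup>2 + (2 / real R ^ CARD('d) + exp (- k / (16 * (?d * real R)\<^sup>2)))))"
      by (rule malliavin_energy_le[OF clocks _ _ _ t R k]) (use U g B in auto)
    also have "\<dots> \<le> ennreal (32768 * ?d\<^sup>2 * B\<^sup>2 * U ^ 4 * ((3 + 8192 * ?d ^ 4) * ?e'))"
    proof (intro ennreal_leI mult_left_mono[OF order_trans[OF scales]])
      show "(3 + 8192 * ?d ^ 4) * ?e \<le> (3 + 8192 * ?d ^ 4) * ?e'"
        by (intro mult_left_mono e_le) simp
    qed simp
    also have "\<dots> = ennreal ?C * ennreal B ^ 2 * ennreal U ^ 4 * ennreal ?e'"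
      using B0 U0 by (simp add: ennreal_mult'[symmetric] ennreal_power ac_simps)
    also have "\<dots> \<le> ennreal ?C * time_torus_norm g ^ 2 * torus_norm u0 ^ 4 * ennreal ?e'"
      by (intro mult_mono power_mono B_norm U_norm) auto
    finally show "ennreal (1 / \<epsilon> ^ (CARD('d) + 2)) *
         (\<integral>\<^sup>+ s\<in>{0..}. ennreal (\<epsilon> ^ CARD('d)) *
            (\<Sum>x\<in>torus_lattice \<epsilon>. \<Sum>i\<in>UNIV.
               \<integral>\<^sup>+ \<eta>. ennreal ((add_one_cost (s, x, i) (carre_du_champ \<epsilon> u0 g t) \<eta>)\<^sup>2) \<partial>P)
          \<partial>lborel)
       \<le> ennreal ?C * time_torus_norm g ^ 2 * torus_norm u0 ^ 4 * ennreal ?e'"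
      unfolding V_def .
  qed
qed

end
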